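(* Let $(P,\mathcal F)$ be a foliated manifold and let $G$ be a connected Lie group acting freely and properly on $P$ and preserving $\mathcal F$. Let $\pi:P\to M=P/G$, let $\mathcal F_M$ be the singular foliation on $M$ with $\pi^{-1}\mathcal F_M=\Gamma_c(\ker d\pi)+\mathcal F$, and let $\Xi:\mathcal H(\mathcal F)\to\mathcal H(\mathcal F_M)$ be the canonical morphism. Let $H\subset G$ be the connected normal Lie subgroup integrating the Lie ideal $\mathfrak h=\{x\in\mathfrak g: v_x\in\widehat{\mathcal F}\}$. Then the orbits of the Lie 2-group action $\star$ of $H\rtimes G\rightrightarrows G$ on $\mathcal H(\mathcal F)$, given by $(h,g)\star\xi=h\,\overleftarrow{\star}\,(g\,\vec\star\,\xi)$, lie inside the fibres of $\Xi$.
   Context: **Foliations.** $\mathfrak X_c(M)$ denotes the compactly supported vector fields on a smooth manifold $M$. A singular foliation on $M$ is a $C^\infty(M)$-submodule $\mathcal F\subset\mathfrak X_c(M)$ with $[\mathcal F,\mathcal F]\subset\mathcal F$ which is locally finitely generated: every point has an open neighbourhood $U$ and $Y^1,\dots,Y^r\in\mathfrak X(U)$ such that $\{X|_U: X\in\mathcal F,\ \mathrm{supp}\,X\subset U\}$ is the $C_c^\infty(U)$-span of the $Y^i$. The global hull is $\widehat{\mathcal F}=\{X\in\mathfrak X(M): fX\in\mathcal F\ \forall f\in C_c^\infty(M)\}$. For a submersion $\pi:P\to M$, $\pi^{-1}\mathcal F$ is the set of $X\in\mathfrak X_c(P)$ such that $d\pi(X)\in\Gamma(\pi^*TM)$ lies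 in the $C_c^\infty(P)$-span of $\{Y\circ\pi:Y\in\mathcal F\}$. The $G$-action preserves $\mathcal F$ if $\widehat g^{-1}\mathcal F=\mathcal F$ for all $g$, where $\widehat g:P\to P$, $p\mapsto gp$. $\mathfrak g$ is the Lie algebra of $G$ and $v_x\in\mathfrak X(P)$ the generator of the action corresponding to $x\in\mathfrak g$. $\mathfrak h$ is a Lie ideal, and $H$ is the unique connected Lie subgroup of $G$ with Lie algebra $\mathfrak h$; it is normal. Existence and uniqueness of $\mathcal F_M$ is a known fact. **Holonomy groupoid.** A bisubmersion of $(M,\mathcal F)$ is a manifold $U$ with submersions $\mathbf t,\mathbf s:U\to M$ such that $\mathbf s^{-1}\mathcal F=\mathbf t^{-1}\mathcal F=\Gamma_c(\ker d\mathbf s)+\Gamma_c(\ker d\mathbf t)$. Morphisms are smooth maps commuting with $\mathbf s,\mathbf t$. The inverse of $(U,\mathbf t,\mathbf s)$ is $(U,\mathbf s,\mathbf t)$; the composition is $U\circ V=U\,{}_{\mathbf s}\!\times_{\mathbf t}V$ with $\mathbf t(u,v)=\mathbf t(u)$, $\mathbf s(u,v)=\mathbf s(v)$. $U$ carries a local diffeomorphism $\phi$ at $u$ if there is a local section $\sigma$ of $\mathbf s$ through $u$, transverse to the $\mathbf t$-fibres, with $\phi=\mathbf t\circ\sigma$. Points $u_1\in U_1$, $u_2\in U_2$ are equivalent if some morphism of bisubmersions from a neighbourhood of $u_1$ to $U_2$ maps $u_1$ to $u_2$ (equivalently, $U_1$ at $u_1$ and $U_2$ at $u_2$ carry a common local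 diffeomorphism). With $I_x$ the functions vanishing at $x$, a path holonomy bisubmersion at $x_0$ is obtained from $X_1,\dots,X_n\in\mathcal F$ whose classes form a basis of $\mathcal F/I_{x_0}\mathcal F$: it is a neighbourhood $U\subset\mathbb R^n\times M$ of $(0,x_0)$ with $\mathbf s(v,x)=x$, $\mathbf t(v,x)=\exp(\sum v_iX_i)(x)$ (time-one flow), which is a bisubmersion with connected $\mathbf s$-fibres. A path holonomy atlas $\mathcal U$ consists of the finite compositions of elements (and their inverses) of a family of path holonomy bisubmersions whose sources cover $M$. The holonomy groupoid is the topological groupoid $\mathcal H(\mathcal F)=\big(\bigsqcup_{U\in\mathcal U}U\big)/\!\sim$ over $M$ with the quotient topology, $\mathbf s[u]=\mathbf s(u)$, $\mathbf t[u]=\mathbf t(u)$, $[u]\circ[v]=[(u,v)]$; up to canonical isomorphism it is independent of $\mathcal U$. An element $[u]$ carries a diffeomorphism if a representative does. **The map $\Xi$.** If $\mathcal U$ is a path holonomy atlas for $\mathcal F$, then each $\pi U:=(U,\pi\circ\mathbf t,\pi\circ\mathbf s)$, $U\in\mathcal U$, is a bisubmersion for $\mathcal F_M$, the family of these generates an atlas whose groupoid is $\mathcal H(\mathcal F_M)$, and $\Xi([u])=[u]_M$, the class of $u\in\pi U$ in $\mathcal H(\mathcal F_M)$. $\Xi$ is a surjective open morphism of topological groupoids covering $\pi$. **The action $\vec\star$ of $G$.** For $g\in G$ and $W$ in a path holonomy atlas of $\mathcal F$, $gW:=(W,\widehat g\circ\mathbf t,\widehat g\circ\mathbf s)$ is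 a bisubmersion all of whose points are equivalent to points of the atlas; $g\,\vec\star\,[v]:=[v]_{gW}$ is the class of $v\in W$ regarded as an element of $gW$. **The action $\overleftarrow\star$ of $H$.** There is a canonical groupoid morphism $\phi:H\times P\to\mathcal H(\mathcal F)$ from the transformation groupoid of the $H$-action on $P$: $\phi(h,p)$ is the unique element of $\mathcal H(\mathcal F)$ with source $p$ carrying the diffeomorphism $\widehat h$ near $p$. Put $h\,\overleftarrow\star\,\xi:=\phi(h,\mathbf t(\xi))\circ\xi$. **Lie 2-group.** $H\rtimes G\rightrightarrows G$ has source $(h,g)\mapsto g$, target $(h,g)\mapsto hg$, groupoid composition $(h_2,h_1g)\circ(h_1,g)=(h_2h_1,g)$, and group multiplication $(h_1,g_1)\cdot(h_2,g_2)=(h_1\,g_1h_2g_1^{-1},\,g_1g_2)$; $\star$ is a group action whose action map is a groupoid morphism. *)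

theory Defs
  imports "HOL-Analysis.Analysis" "HOL-Algebra.Group_Action"
begin

section \<open>Smooth manifolds\<close>

text \<open>
  The dimension of the bisubmersions in an atlas is unbounded, so Euclidean spaces are indexed by
  a natural number: \<open>Rn n\<close> consists of the sequences vanishing from index \<open>n\<close> on, with the
  product topology of \<^typ>\<open>nat \<Rightarrow> real\<close>.
\<close>

definition Rn :: "nat \<Rightarrow> (nat \<Rightarrow> real) set" where
  "Rn n = {x. \<forall>i\<ge>n. x i = 0}"

abbreviation Rn_top :: "nat \<Rightarrow> (nat \<Rightarrow> real) topology" where
  "Rn_top n \<equiv> top_of_set (Rn n)"

text \<open>\<open>Ck k n V f\<close>: all partial derivatives up to order \<open>k\<close> exist and are continuous on the open
  subset \<open>V\<close> of \<open>Rn n\<close>.\<close>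

fun Ck :: "nat \<Rightarrow> nat \<Rightarrow> (nat \<Rightarrow> real) set \<Rightarrow> ((nat \<Rightarrow> real) \<Rightarrow> real) \<Rightarrow> bool" where
  "Ck 0 n V f \<longleftrightarrow> continuous_on V f"
| "Ck (Suc k) n V f \<longleftrightarrow> continuous_on V f \<and>
     (\<exists>D. \<forall>i<n. (\<forall>x\<in>V. ((\<lambda>r. f (x(i := r))) has_real_derivative D i x) (at (x i))) \<and>
                Ck k n V (D i))"

definition smooth_Rn :: "nat \<Rightarrow> (nat \<Rightarrow> real) set \<Rightarrow> ((nat \<Rightarrow> real) \<Rightarrow> real) \<Rightarrow> bool" where
  "smooth_Rn n V f \<longleftrightarrow> (\<forall>k. Ck k n V f)"

text \<open>A chart is a pair of its domain and its coordinate map; values of the coordinate map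
  outside the domain are irrelevant.\<close>

record 'a smfd =
  mdim :: nat
  charts :: "('a set \<times> ('a \<Rightarrow> nat \<Rightarrow> real)) set"

definition pts :: "'a smfd \<Rightarrow> 'a set" where
  "pts X = \<Union> (fst ` charts X)"

definition mtop :: "'a smfd \<Rightarrow> 'a topology" where
  "mtop X = topology_generated_by
     {{p \<in> D. c p \<in> V} | D c V. (D, c) \<in> charts X \<and> openin (Rn_top (mdim X)) V}"

definition smooth_manifold :: "'a smfd \<Rightarrow> bool" where
  "smooth_manifold X \<longleftrightarrow>
     (\<forall>(D, c) \<in> charts X. inj_on c D \<and> openin (Rn_top (mdim X)) (c ` D)) \<and>
     (\<forall>(D, c) \<in> charts X. \<forall>(E, e) \<in> charts X.
        openin (Rn_top (mdim X)) (c ` (D \<inter> E)) \<and>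
        (\<forall>i < mdim X. smooth_Rn (mdim X) (c ` (D \<inter> E)) (\<lambda>y. e (inv_into D c y) i))) \<and>
     Hausdorff_space (mtop X) \<and> second_countable (mtop X)"

definition smooth_fun :: "'a smfd \<Rightarrow> 'a set \<Rightarrow> ('a \<Rightarrow> real) \<Rightarrow> bool" where
  "smooth_fun X W f \<longleftrightarrow> openin (mtop X) W \<and>
     (\<forall>(D, c) \<in> charts X. smooth_Rn (mdim X) (c ` (D \<inter> W)) (\<lambda>y. f (inv_into D c y)))"

definition smooth_map :: "'a smfd \<Rightarrow> 'b smfd \<Rightarrow> ('a \<Rightarrow> 'b) \<Rightarrow> bool" where
  "smooth_map X Y f \<longleftrightarrow> continuous_map (mtop X) (mtop Y) f \<and>
     (\<forall>(E, e) \<in> charts Y. \<forall>i < mdim Y. smooth_fun X {p \<in> pts X. f p \<in> E} (\<lambda>p. e (f p) i))"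

definition euclidean_mfd :: "nat \<Rightarrow> (nat \<Rightarrow> real) smfd" where
  "euclidean_mfd n = \<lparr>mdim = n, charts = {(Rn n, \<lambda>x. x)}\<rparr>"

definition open_mfd :: "'a smfd \<Rightarrow> 'a set \<Rightarrow> 'a smfd" where
  "open_mfd X W = \<lparr>mdim = mdim X, charts = (\<lambda>(D, c). (D \<inter> W, c)) ` charts X\<rparr>"

definition prod_mfd :: "'a smfd \<Rightarrow> 'b smfd \<Rightarrow> ('a \<times> 'b) smfd" where
  "prod_mfd X Y = \<lparr>mdim = mdim X + mdim Y,
     charts = {(D \<times> E, \<lambda>(p, q) i. if i < mdim X then c p i else e q (i - mdim X)) | D c E e.
                 (D, c) \<in> charts X \<and> (E, e) \<in> charts Y}\<rparr>"

text \<open>Transport of the manifold structure along a map injective on \<open>pts X\<close>.\<close>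

definition image_mfd :: "('a \<Rightarrow> 'b) \<Rightarrow> 'a smfd \<Rightarrow> 'b smfd" where
  "image_mfd f X = \<lparr>mdim = mdim X,
     charts = (\<lambda>(D, c). (f ` D, \<lambda>y. c (inv_into (pts X) f y))) ` charts X\<rparr>"

text \<open>The maximal atlas of a \<open>d\<close>-dimensional embedded submanifold \<open>S\<close> of \<open>X\<close>: charts are the
  homeomorphisms from open subsets of \<open>S\<close> to open subsets of \<open>Rn d\<close> that extend locally to smooth
  maps on \<open>X\<close> and whose inverses are smooth as maps into \<open>X\<close>.\<close>

definition sub_mfd :: "'a smfd \<Rightarrow> 'a set \<Rightarrow> nat \<Rightarrow> 'a smfd" where
  "sub_mfd X S d = \<lparr>mdim = d, charts = {(D, c).
     openin (subtopology (mtop X) S) D \<and> inj_on c D \<and> openin (Rn_top d) (c ` D) \<and>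
     smooth_map (open_mfd (euclidean_mfd d) (c ` D)) X (inv_into D c) \<and>
     (\<forall>p\<in>D. \<exists>W. p \<in> W \<and> (\<forall>i<d. \<exists>f. smooth_fun X W f \<and> (\<forall>q \<in> W \<inter> D. f q = c q i)) \<and>
        openin (mtop X) W)}\<rparr>"


section \<open>Tangent vectors and vector fields\<close>

text \<open>Tangent vectors at \<open>p\<close> are derivations of germs, represented as functionals on all functions
  that only depend on the germ at \<open>p\<close> and vanish on functions not smooth near \<open>p\<close>. The tangent
  spaces of \<open>X\<close> and of an open submanifold are thereby equal.\<close>

definition smooth_near :: "'a smfd \<Rightarrow> 'a \<Rightarrow> ('a \<Rightarrow> real) set" where
  "smooth_near X p = {f. \<exists>W. p \<in> W \<and> smooth_fun X W f}"

definition tangent :: "'a smfd \<Rightarrow> 'a \<Rightarrow> (('a \<Rightarrow> real) \<Rightarrow> real) set" where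
  "tangent X p = {v.
     (\<forall>f. f \<notin> smooth_near X p \<longrightarrow> v f = 0) \<and>
     (\<forall>f \<in> smooth_near X p. \<forall>g \<in> smooth_near X p.
        (\<forall>W. openin (mtop X) W \<longrightarrow> p \<in> W \<longrightarrow> (\<forall>q\<in>W. f q = g q) \<longrightarrow> v f = v g) \<and>
        (\<forall>a b. v (\<lambda>q. a * f q + b * g q) = a * v f + b * v g) \<and>
        v (\<lambda>q. f q * g q) = f p * v g + g p * v f)}"

definition tmap :: "'b smfd \<Rightarrow> ('a \<Rightarrow> 'b) \<Rightarrow> 'a \<Rightarrow>
    (('a \<Rightarrow> real) \<Rightarrow> real) \<Rightarrow> (('b \<Rightarrow> real) \<Rightarrow> real)" where
  "tmap Y f p v = (\<lambda>\<phi>. if \<phi> \<in> smooth_near Y (f p) then v (\<phi> \<circ> f) else 0)"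

definition submersion :: "'a smfd \<Rightarrow> 'b smfd \<Rightarrow> ('a \<Rightarrow> 'b) \<Rightarrow> bool" where
  "submersion X Y f \<longleftrightarrow> smooth_map X Y f \<and>
     (\<forall>p \<in> pts X. tmap Y f p ` tangent X p = tangent Y (f p))"

definition immersion :: "'a smfd \<Rightarrow> 'b smfd \<Rightarrow> ('a \<Rightarrow> 'b) \<Rightarrow> bool" where
  "immersion X Y f \<longleftrightarrow> smooth_map X Y f \<and> (\<forall>p \<in> pts X. inj_on (tmap Y f p) (tangent X p))"

type_synonym 'a vfield = "'a \<Rightarrow> ('a \<Rightarrow> real) \<Rightarrow> real"

text \<open>Vector fields on an open set \<open>U\<close> are extended by \<open>0\<close> outside \<open>U\<close>.\<close>

definition vfields :: "'a smfd \<Rightarrow> 'a set \<Rightarrow> 'a vfield set" where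
  "vfields X U = {Y. (\<forall>p\<in>U. Y p \<in> tangent X p) \<and> (\<forall>p. p \<notin> U \<longrightarrow> Y p = (\<lambda>f. 0)) \<and>
     (\<forall>W f. W \<subseteq> U \<longrightarrow> smooth_fun X W f \<longrightarrow> smooth_fun X W (\<lambda>p. Y p f))}"

definition vsupp :: "'a smfd \<Rightarrow> 'a vfield \<Rightarrow> 'a set" where
  "vsupp X Y = mtop X closure_of {p \<in> pts X. Y p \<noteq> (\<lambda>f. 0)}"

definition fsupp :: "'a smfd \<Rightarrow> ('a \<Rightarrow> real) \<Rightarrow> 'a set" where
  "fsupp X f = mtop X closure_of {p \<in> pts X. f p \<noteq> 0}"

definition vfields_c :: "'a smfd \<Rightarrow> 'a vfield set" where
  "vfields_c X = {Y \<in> vfields X (pts X). compactin (mtop X) (vsupp X Y)}"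

definition Cc :: "'a smfd \<Rightarrow> 'a set \<Rightarrow> ('a \<Rightarrow> real) set" where
  "Cc X U = {f. smooth_fun X (pts X) f \<and> compactin (mtop X) (fsupp X f) \<and> fsupp X f \<subseteq> U}"

definition lincomb :: "nat \<Rightarrow> (nat \<Rightarrow> 'a \<Rightarrow> real) \<Rightarrow> (nat \<Rightarrow> 'a vfield) \<Rightarrow> 'a vfield" where
  "lincomb n f Y = (\<lambda>p \<phi>. \<Sum>i<n. f i p * Y i p \<phi>)"

definition bracket :: "'a smfd \<Rightarrow> 'a vfield \<Rightarrow> 'a vfield \<Rightarrow> 'a vfield" where
  "bracket X Y Z = (\<lambda>p f. if f \<in> smooth_near X p
     then Y p (\<lambda>q. Z q f) - Z p (\<lambda>q. Y q f) else 0)"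

definition vsum :: "'a vfield set \<Rightarrow> 'a vfield set \<Rightarrow> 'a vfield set" where
  "vsum A B = {\<lambda>p \<phi>. Y p \<phi> + Z p \<phi> | Y Z. Y \<in> A \<and> Z \<in> B}"

text \<open>\<open>\<Gamma>\<^sub>c(ker df)\<close>\<close>

definition vertical_c :: "'a smfd \<Rightarrow> 'b smfd \<Rightarrow> ('a \<Rightarrow> 'b) \<Rightarrow> 'a vfield set" where
  "vertical_c X Y f = {Z \<in> vfields_c X. \<forall>p \<in> pts X. tmap Y f p (Z p) = (\<lambda>\<phi>. 0)}"


section \<open>Singular foliations\<close>

text \<open>A field supported in \<open>U\<close> equals its restriction to \<open>U\<close> extended by zero, so the local
  generation condition is an equality of sets of fields.\<close>

definition singular_foliation :: "'a smfd \<Rightarrow> 'a vfield set \<Rightarrow> bool" where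
  "singular_foliation X F \<longleftrightarrow> F \<subseteq> vfields_c X \<and> (\<lambda>p \<phi>. 0) \<in> F \<and>
     (\<forall>Y\<in>F. \<forall>Z\<in>F. (\<lambda>p \<phi>. Y p \<phi> + Z p \<phi>) \<in> F) \<and>
     (\<forall>f. \<forall>Y\<in>F. smooth_fun X (pts X) f \<longrightarrow> (\<lambda>p \<phi>. f p * Y p \<phi>) \<in> F) \<and>
     (\<forall>Y\<in>F. \<forall>Z\<in>F. bracket X Y Z \<in> F) \<and>
     (\<forall>p \<in> pts X. \<exists>U r Y. openin (mtop X) U \<and> p \<in> U \<and> (\<forall>i<r. Y i \<in> vfields X U) \<and>
        {Z \<in> F. vsupp X Z \<subseteq> U} = {lincomb r f Y | f. \<forall>i<r. f i \<in> Cc X U})"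

definition global_hull :: "'a smfd \<Rightarrow> 'a vfield set \<Rightarrow> 'a vfield set" where
  "global_hull X F = {Y \<in> vfields X (pts X). \<forall>f \<in> Cc X (pts X). (\<lambda>p \<phi>. f p * Y p \<phi>) \<in> F}"

definition pullback :: "'a smfd \<Rightarrow> 'b smfd \<Rightarrow> ('a \<Rightarrow> 'b) \<Rightarrow> 'b vfield set \<Rightarrow> 'a vfield set" where
  "pullback X Y f F = {Z \<in> vfields_c X. \<exists>(n::nat) a V.
     (\<forall>i<n. a i \<in> Cc X (pts X) \<and> V i \<in> F) \<and>
     (\<forall>p \<in> pts X. tmap Y f p (Z p) = (\<lambda>\<phi>. \<Sum>i<n. a i p * V i (f p) \<phi>))}"

text \<open>\<open>I\<^sub>x F\<close>\<close>

definition vanishing_mult :: "'a smfd \<Rightarrow> 'a \<Rightarrow> 'a vfield set \<Rightarrow> 'a vfield set" where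
  "vanishing_mult X x F =
     {lincomb n f Y | n f Y. \<forall>i<n. smooth_fun X (pts X) (f i) \<and> f i x = 0 \<and> Y i \<in> F}"

definition basis_mod :: "'a smfd \<Rightarrow> 'a \<Rightarrow> 'a vfield set \<Rightarrow> nat \<Rightarrow> (nat \<Rightarrow> 'a vfield) \<Rightarrow> bool" where
  "basis_mod X x F n Y \<longleftrightarrow> (\<forall>i<n. Y i \<in> F) \<and>
     (\<forall>a :: nat \<Rightarrow> real. lincomb n (\<lambda>i p. a i) Y \<in> vanishing_mult X x F \<longrightarrow> (\<forall>i<n. a i = 0)) \<and>
     (\<forall>Z\<in>F. \<exists>a :: nat \<Rightarrow> real.
        (\<lambda>p \<phi>. Z p \<phi> - lincomb n (\<lambda>i p. a i) Y p \<phi>) \<in> vanishing_mult X x F)"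

text \<open>\<open>time_one X Y x y\<close> says \<open>exp(Y)(x) = y\<close>.\<close>

definition time_one :: "'a smfd \<Rightarrow> 'a vfield \<Rightarrow> 'a \<Rightarrow> 'a \<Rightarrow> bool" where
  "time_one X Y x y \<longleftrightarrow> (\<exists>\<gamma>. \<gamma> 0 = x \<and> \<gamma> 1 = y \<and>
     continuous_map (top_of_set {0..1::real}) (mtop X) \<gamma> \<and>
     (\<forall>\<tau>\<in>{0..1}. \<forall>f \<in> smooth_near X (\<gamma> \<tau>).
        ((\<lambda>r. f (\<gamma> r)) has_real_derivative Y (\<gamma> \<tau>) f) (at \<tau> within {0..1})))"


section \<open>Bisubmersions and the holonomy groupoid\<close>

record ('u, 'a) bisub =
  total_mfd :: "'u smfd"
  tgt :: "'u \<Rightarrow> 'a"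
  src :: "'u \<Rightarrow> 'a"

definition bisubmersion :: "'a smfd \<Rightarrow> 'a vfield set \<Rightarrow> ('u, 'a) bisub \<Rightarrow> bool" where
  "bisubmersion X F U \<longleftrightarrow> smooth_manifold (total_mfd U) \<and>
     submersion (total_mfd U) X (tgt U) \<and> submersion (total_mfd U) X (src U) \<and>
     pullback (total_mfd U) X (src U) F = pullback (total_mfd U) X (tgt U) F \<and>
     pullback (total_mfd U) X (tgt U) F =
       vsum (vertical_c (total_mfd U) X (src U)) (vertical_c (total_mfd U) X (tgt U))"

definition inverse_bisub :: "('u, 'a) bisub \<Rightarrow> ('u, 'a) bisub" where
  "inverse_bisub U = \<lparr>total_mfd = total_mfd U, tgt = src U, src = tgt U\<rparr>"

text \<open>For \<open>f = \<pi>\<close> this is \<open>\<pi>U\<close>, for the translation by \<open>g\<close> it is \<open>gU\<close>.\<close>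

definition push_bisub :: "('a \<Rightarrow> 'b) \<Rightarrow> ('u, 'a) bisub \<Rightarrow> ('u, 'b) bisub" where
  "push_bisub f U = \<lparr>total_mfd = total_mfd U, tgt = f \<circ> tgt U, src = f \<circ> src U\<rparr>"

text \<open>One carrier type closed under fibre products, so that the members of a path holonomy atlas
  form a set: \<open>Path v x\<close> stands for \<open>(v, x) \<in> \<real>\<^sup>n \<times> P\<close>, and \<open>Comp u v\<close> for the pair \<open>(u, v)\<close>.\<close>

datatype 'p hpt = Path "nat \<Rightarrow> real" 'p | Comp (lft: "'p hpt") (rgt: "'p hpt")

definition comp_bisub :: "'a smfd \<Rightarrow> ('p hpt, 'a) bisub \<Rightarrow> ('p hpt, 'a) bisub \<Rightarrow> ('p hpt, 'a) bisub"
  where "comp_bisub X U V =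
    \<lparr>total_mfd = image_mfd (\<lambda>(u, v). Comp u v)
       (sub_mfd (prod_mfd (total_mfd U) (total_mfd V))
          {(u, v). u \<in> pts (total_mfd U) \<and> v \<in> pts (total_mfd V) \<and> src U u = tgt V v}
          (mdim (total_mfd U) + mdim (total_mfd V) - mdim X)),
     tgt = (\<lambda>w. tgt U (lft w)), src = (\<lambda>w. src V (rgt w))\<rparr>"

definition path_holonomy_bisub ::
    "'p smfd \<Rightarrow> 'p vfield set \<Rightarrow> 'p \<Rightarrow> ('p hpt, 'p) bisub \<Rightarrow> bool" where
  "path_holonomy_bisub P F x0 U \<longleftrightarrow> x0 \<in> pts P \<and> bisubmersion P F U \<and>
     (\<forall>x \<in> pts P. connectedin (mtop (total_mfd U)) {u \<in> pts (total_mfd U). src U u = x}) \<and>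
     (\<exists>n Y N. basis_mod P x0 F n Y \<and>
        openin (mtop (prod_mfd (euclidean_mfd n) P)) N \<and> ((\<lambda>i. 0), x0) \<in> N \<and>
        total_mfd U = image_mfd (\<lambda>(v, x). Path v x) (open_mfd (prod_mfd (euclidean_mfd n) P) N) \<and>
        (\<forall>(v, x) \<in> N. src U (Path v x) = x \<and>
           time_one P (lincomb n (\<lambda>i p. v i) Y) x (tgt U (Path v x))))"

inductive_set generated_atlas ::
    "'a smfd \<Rightarrow> ('p hpt, 'a) bisub set \<Rightarrow> ('p hpt, 'a) bisub set"
  for X :: "'a smfd" and S :: "('p hpt, 'a) bisub set" where
  elem: "U \<in> S \<Longrightarrow> U \<in> generated_atlas X S"
| inverse: "U \<in> S \<Longrightarrow> inverse_bisub U \<in> generated_atlas X S"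
| comp: "U \<in> generated_atlas X S \<Longrightarrow> V \<in> generated_atlas X S \<Longrightarrow>
    comp_bisub X U V \<in> generated_atlas X S"

text \<open>The holonomy groupoid does not depend on the path holonomy atlas; we use the largest one,
  generated by all path holonomy bisubmersions.\<close>

definition path_holonomy_atlas :: "'p smfd \<Rightarrow> 'p vfield set \<Rightarrow> ('p hpt, 'p) bisub set" where
  "path_holonomy_atlas P F = generated_atlas P {U. \<exists>x0. path_holonomy_bisub P F x0 U}"

definition local_morphism :: "('u, 'a) bisub \<Rightarrow> 'u \<Rightarrow> ('w, 'a) bisub \<Rightarrow> 'w \<Rightarrow> bool" where
  "local_morphism U u V v \<longleftrightarrow> (\<exists>W f. openin (mtop (total_mfd U)) W \<and> u \<in> W \<and>
     smooth_map (open_mfd (total_mfd U) W) (total_mfd V) f \<and> f u = v \<and>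
     (\<forall>w\<in>W. src V (f w) = src U w \<and> tgt V (f w) = tgt U w))"

definition atlas_points :: "('u, 'a) bisub set \<Rightarrow> (('u, 'a) bisub \<times> 'u) set" where
  "atlas_points A = {(U, u). U \<in> A \<and> u \<in> pts (total_mfd U)}"

text \<open>Existence of a local morphism is known to be an equivalence relation on the points of an
  atlas; taking the generated equivalence avoids building this theorem into the definition.\<close>

definition point_equiv ::
    "('u, 'a) bisub set \<Rightarrow> ((('u, 'a) bisub \<times> 'u) \<times> (('u, 'a) bisub \<times> 'u)) set" where
  "point_equiv A = {(x, y). x \<in> atlas_points A \<and> y \<in> atlas_points A \<and>
     equivclp (\<lambda>a b. a \<in> atlas_points A \<and> b \<in> atlas_points A \<and>
        local_morphism (fst a) (snd a) (fst b) (snd b)) x y}"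

definition germ_class ::
    "('u, 'a) bisub set \<Rightarrow> ('u, 'a) bisub \<Rightarrow> 'u \<Rightarrow> (('u, 'a) bisub \<times> 'u) set" where
  "germ_class A U u = point_equiv A `` {(U, u)}"

definition atlas_groupoid :: "('u, 'a) bisub set \<Rightarrow> (('u, 'a) bisub \<times> 'u) set set" where
  "atlas_groupoid A = atlas_points A // point_equiv A"

definition holonomy_groupoid ::
    "'p smfd \<Rightarrow> 'p vfield set \<Rightarrow> (('p hpt, 'p) bisub \<times> 'p hpt) set set" where
  "holonomy_groupoid P F = atlas_groupoid (path_holonomy_atlas P F)"

definition hol_src :: "(('u, 'a) bisub \<times> 'u) set \<Rightarrow> 'a" where
  "hol_src \<xi> = the_elem ((\<lambda>(U, u). src U u) ` \<xi>)"

definition hol_tgt :: "(('u, 'a) bisub \<times> 'u) set \<Rightarrow> 'a" where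
  "hol_tgt \<xi> = the_elem ((\<lambda>(U, u). tgt U u) ` \<xi>)"

definition hol_comp :: "'p smfd \<Rightarrow> 'p vfield set \<Rightarrow> (('p hpt, 'p) bisub \<times> 'p hpt) set \<Rightarrow>
    (('p hpt, 'p) bisub \<times> 'p hpt) set \<Rightarrow> (('p hpt, 'p) bisub \<times> 'p hpt) set" where
  "hol_comp P F \<xi> \<eta> = the_elem
     ((\<lambda>((U, u), (V, v)). germ_class (path_holonomy_atlas P F) (comp_bisub P U V) (Comp u v)) `
      (\<xi> \<times> \<eta>))"

definition carries_at :: "'a smfd \<Rightarrow> ('u, 'a) bisub \<Rightarrow> 'u \<Rightarrow> ('a \<Rightarrow> 'a) \<Rightarrow> bool" where
  "carries_at X U u \<phi> \<longleftrightarrow> (\<exists>W \<sigma>. openin (mtop X) W \<and> src U u \<in> W \<and>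
     smooth_map (open_mfd X W) (total_mfd U) \<sigma> \<and> \<sigma> (src U u) = u \<and>
     (\<forall>x\<in>W. src U (\<sigma> x) = x \<and> tgt U (\<sigma> x) = \<phi> x) \<and>
     (\<forall>x\<in>W. \<forall>w \<in> tangent (total_mfd U) (\<sigma> x). \<exists>a \<in> tangent X x. \<exists>b \<in> tangent (total_mfd U) (\<sigma> x).
        tmap X (tgt U) (\<sigma> x) b = (\<lambda>f. 0) \<and> w = (\<lambda>f. tmap (total_mfd U) \<sigma> x a f + b f)))"

definition hol_carries ::
    "'a smfd \<Rightarrow> (('u, 'a) bisub \<times> 'u) set \<Rightarrow> ('a \<Rightarrow> 'a) \<Rightarrow> bool" where
  "hol_carries X \<xi> \<phi> \<longleftrightarrow> (\<exists>(U, u) \<in> \<xi>. carries_at X U u \<phi>)"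


section \<open>Lie groups and their actions\<close>

definition lie_group :: "('g, 'c) monoid_scheme \<Rightarrow> 'g smfd \<Rightarrow> bool" where
  "lie_group G GM \<longleftrightarrow> group G \<and> smooth_manifold GM \<and> pts GM = carrier G \<and>
     smooth_map (prod_mfd GM GM) GM (\<lambda>(a, b). a \<otimes>\<^bsub>G\<^esub> b) \<and> smooth_map GM GM (\<lambda>a. inv\<^bsub>G\<^esub> a)"

definition smooth_action ::
    "('g, 'c) monoid_scheme \<Rightarrow> 'g smfd \<Rightarrow> 'p smfd \<Rightarrow> ('g \<Rightarrow> 'p \<Rightarrow> 'p) \<Rightarrow> bool" where
  "smooth_action G GM P act \<longleftrightarrow> group_action G (pts P) act \<and>
     smooth_map (prod_mfd GM P) P (\<lambda>(g, p). act g p)"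

definition free_action ::
    "('g, 'c) monoid_scheme \<Rightarrow> 'p smfd \<Rightarrow> ('g \<Rightarrow> 'p \<Rightarrow> 'p) \<Rightarrow> bool" where
  "free_action G P act \<longleftrightarrow> (\<forall>p \<in> pts P. stabilizer G act p = {\<one>\<^bsub>G\<^esub>})"

definition proper_action :: "'g smfd \<Rightarrow> 'p smfd \<Rightarrow> ('g \<Rightarrow> 'p \<Rightarrow> 'p) \<Rightarrow> bool" where
  "proper_action GM P act \<longleftrightarrow>
     proper_map (prod_topology (mtop GM) (mtop P)) (prod_topology (mtop P) (mtop P))
       (\<lambda>(g, p). (act g p, p))"

text \<open>\<open>M\<close> is the orbit space with its (unique) smooth structure making the projection a
  submersion.\<close>

definition quotient_mfd ::
    "('g, 'c) monoid_scheme \<Rightarrow> 'p smfd \<Rightarrow> ('g \<Rightarrow> 'p \<Rightarrow> 'p) \<Rightarrow> 'p set smfd \<Rightarrow> bool" where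
  "quotient_mfd G P act M \<longleftrightarrow> smooth_manifold M \<and> pts M = orbits G (pts P) act \<and>
     submersion P M (orbit G act)"

text \<open>\<open>v\<^sub>x\<close> is the derivative of \<open>g \<mapsto> gp\<close> at the identity in direction \<open>x\<close>. The opposite sign
  convention gives the same ideal below.\<close>

definition generator :: "('g, 'c) monoid_scheme \<Rightarrow> 'p smfd \<Rightarrow> ('g \<Rightarrow> 'p \<Rightarrow> 'p) \<Rightarrow>
    (('g \<Rightarrow> real) \<Rightarrow> real) \<Rightarrow> 'p vfield" where
  "generator G P act x = (\<lambda>p. if p \<in> pts P then tmap P (\<lambda>g. act g p) \<one>\<^bsub>G\<^esub> x else (\<lambda>f. 0))"

definition foliation_ideal :: "('g, 'c) monoid_scheme \<Rightarrow> 'g smfd \<Rightarrow> 'p smfd \<Rightarrow> 'p vfield set \<Rightarrow>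
    ('g \<Rightarrow> 'p \<Rightarrow> 'p) \<Rightarrow> (('g \<Rightarrow> real) \<Rightarrow> real) set" where
  "foliation_ideal G GM P F act =
     {x \<in> tangent GM \<one>\<^bsub>G\<^esub>. generator G P act x \<in> global_hull P F}"

text \<open>Lie subgroups are immersed: \<open>HM\<close> need not carry the subspace topology. The Lie algebra is
  taken inside that of \<open>G\<close> via the differential of the inclusion.\<close>

definition connected_lie_subgroup :: "('g, 'c) monoid_scheme \<Rightarrow> 'g smfd \<Rightarrow> 'g set \<Rightarrow> 'g smfd \<Rightarrow>
    (('g \<Rightarrow> real) \<Rightarrow> real) set \<Rightarrow> bool" where
  "connected_lie_subgroup G GM H HM \<hh> \<longleftrightarrow> subgroup H G \<and> lie_group (G\<lparr>carrier := H\<rparr>) HM \<and>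
     connected_space (mtop HM) \<and> immersion HM GM (\<lambda>h. h) \<and>
     tmap GM (\<lambda>h. h) \<one>\<^bsub>G\<^esub> ` tangent HM \<one>\<^bsub>G\<^esub> = \<hh>"


section \<open>The map to the holonomy groupoid of the quotient, and the Lie 2-group action\<close>

text \<open>The \<open>\<pi>U\<close> are bisubmersions for the quotient foliation and generate an atlas for it.\<close>

definition quotient_atlas :: "'p smfd \<Rightarrow> 'p vfield set \<Rightarrow> 'm smfd \<Rightarrow> ('p \<Rightarrow> 'm) \<Rightarrow>
    ('p hpt, 'm) bisub set" where
  "quotient_atlas P F M \<pi> = generated_atlas M (push_bisub \<pi> ` path_holonomy_atlas P F)"

definition Xi :: "'p smfd \<Rightarrow> 'p vfield set \<Rightarrow> 'm smfd \<Rightarrow> ('p \<Rightarrow> 'm) \<Rightarrow>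
    (('p hpt, 'p) bisub \<times> 'p hpt) set \<Rightarrow> (('p hpt, 'm) bisub \<times> 'p hpt) set" where
  "Xi P F M \<pi> \<xi> =
     the_elem ((\<lambda>(U, u). germ_class (quotient_atlas P F M \<pi>) (push_bisub \<pi> U) u) ` \<xi>)"

text \<open>The class in the holonomy groupoid of \<open>v \<in> W\<close> regarded as a point of \<open>gW\<close>.\<close>

definition vec_star :: "'p smfd \<Rightarrow> 'p vfield set \<Rightarrow> ('g \<Rightarrow> 'p \<Rightarrow> 'p) \<Rightarrow> 'g \<Rightarrow>
    (('p hpt, 'p) bisub \<times> 'p hpt) set \<Rightarrow> (('p hpt, 'p) bisub \<times> 'p hpt) set" where
  "vec_star P F act g \<xi> = (THE \<eta>. \<eta> \<in> holonomy_groupoid P F \<and>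
     (\<exists>(W, v) \<in> \<xi>. \<exists>(V, w) \<in> \<eta>. local_morphism (push_bisub (act g) W) v V w))"

text \<open>\<open>\<Phi> h p\<close> is the element of the holonomy groupoid with source \<open>p\<close> carrying the translation by
  \<open>h\<close>. It is known to exist and to be unique, so this determines \<open>\<Phi>\<close> on \<open>H \<times> P\<close>.\<close>

definition translation_morphism :: "'p smfd \<Rightarrow> 'p vfield set \<Rightarrow> ('g \<Rightarrow> 'p \<Rightarrow> 'p) \<Rightarrow> 'g set \<Rightarrow>
    ('g \<Rightarrow> 'p \<Rightarrow> (('p hpt, 'p) bisub \<times> 'p hpt) set) \<Rightarrow> bool" where
  "translation_morphism P F act H \<Phi> \<longleftrightarrow> (\<forall>h\<in>H. \<forall>p \<in> pts P.
     \<Phi> h p \<in> holonomy_groupoid P F \<and> hol_src (\<Phi> h p) = p \<and> hol_carries P (\<Phi> h p) (act h))"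

definition left_star :: "'p smfd \<Rightarrow> 'p vfield set \<Rightarrow>
    ('g \<Rightarrow> 'p \<Rightarrow> (('p hpt, 'p) bisub \<times> 'p hpt) set) \<Rightarrow> 'g \<Rightarrow>
    (('p hpt, 'p) bisub \<times> 'p hpt) set \<Rightarrow> (('p hpt, 'p) bisub \<times> 'p hpt) set" where
  "left_star P F \<Phi> h \<xi> = hol_comp P F (\<Phi> h (hol_tgt \<xi>)) \<xi>"

text \<open>The group of arrows of the Lie 2-group.\<close>

definition semidirect :: "'g set \<Rightarrow> ('g, 'c) monoid_scheme \<Rightarrow> ('g \<times> 'g) monoid" where
  "semidirect H G = \<lparr>carrier = H \<times> carrier G,
     mult = (\<lambda>(h1, g1) (h2, g2).
       (h1 \<otimes>\<^bsub>G\<^esub> (g1 \<otimes>\<^bsub>G\<^esub> h2 \<otimes>\<^bsub>G\<^esub> inv\<^bsub>G\<^esub> g1), g1 \<otimes>\<^bsub>G\<^esub> g2)),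
     one = (\<one>\<^bsub>G\<^esub>, \<one>\<^bsub>G\<^esub>)\<rparr>"

definition star :: "'p smfd \<Rightarrow> 'p vfield set \<Rightarrow> ('g \<Rightarrow> 'p \<Rightarrow> 'p) \<Rightarrow>
    ('g \<Rightarrow> 'p \<Rightarrow> (('p hpt, 'p) bisub \<times> 'p hpt) set) \<Rightarrow> 'g \<times> 'g \<Rightarrow>
    (('p hpt, 'p) bisub \<times> 'p hpt) set \<Rightarrow> (('p hpt, 'p) bisub \<times> 'p hpt) set" where
  "star P F act \<Phi> = (\<lambda>(h, g) \<xi>. left_star P F \<Phi> h (vec_star P F act g \<xi>))"

end

theory Submission
  imports Defs
begin

text \<open>
  Both translations disappear in the quotient. Since \<open>\<pi> \<circ> g = \<pi>\<close>, a local morphism from \<open>gW\<close> to a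
  member \<open>V\<close> of the atlas is also one from \<open>\<pi>W\<close> to \<open>\<pi>V\<close>. If \<open>U\<close> carries the translation by \<open>h\<close>
  along a section \<open>\<sigma>\<close> of the source map, then \<open>v \<mapsto> (\<sigma>(t v), v)\<close> is a local morphism from \<open>\<pi>V\<close> to
  \<open>\<pi>(U \<circ> V)\<close>, because \<open>\<pi> \<circ> h = \<pi>\<close>. The work lies in the existence of the operations: every point of
  the fibre product \<open>U \<circ> V\<close> must have a chart, for which the source map of \<open>U\<close> is straightened by
  exchanging coordinates one at a time, and the translation by \<open>g\<close> must carry path holonomy
  bisubmersions diffeomorphically to path holonomy bisubmersions.
\<close>

subsection \<open>Calculus on open subsets of Euclidean space\<close>

text \<open>Composition, \<Xi> and both actions are defined by \<open>the_elem\<close> or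
  \<open>THE\<close> over germ classes, so each must first be shown independent of representatives.
  The equivalence is generated by local morphisms and no symmetry of these is used: one morphism
  identifies two classes, but uniqueness in \<open>vec_star\<close> asks for a morphism back from
  the lift to \<open>gW\<close>. Hence the translation is lifted to a diffeomorphism on every member
  of the atlas, along its generation. The second obstacle is \<open>sub_mfd\<close>, which collects
  whatever charts exist: a composable pair is a point of the composition only if a chart of the
  right dimension is exhibited there. Compositions are not shown to be bisubmersions; the induction
  carries smoothness of both ends and a normal form of the source, which is what the next fibre
  product consumes. As \<open>Rn n\<close> is a set of sequences and smoothness means iterated
  partial derivatives, the chain rule and the inverse function theorem are built on calculus in one
  variable and Hadamard's expansion.\<close>

definition Rn_box :: "nat \<Rightarrow> (nat \<Rightarrow> real) \<Rightarrow> real \<Rightarrow> (nat \<Rightarrow> real) set" where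
  "Rn_box n a e = {y \<in> Rn n. \<forall>i<n. \<bar>y i - a i\<bar> < e}"

text \<open>\<open>deriv\<close> is total, so \<open>partial\<close> has a value even where no
  derivative exists; existence is carried separately by \<open>has_partial\<close>.\<close>

definition partial :: "nat \<Rightarrow> ((nat \<Rightarrow> real) \<Rightarrow> real) \<Rightarrow> (nat \<Rightarrow> real) \<Rightarrow> real" where
  "partial i f x = deriv (\<lambda>r. f (x(i := r))) (x i)"

definition has_partial :: "nat \<Rightarrow> ((nat \<Rightarrow> real) \<Rightarrow> real) \<Rightarrow> real \<Rightarrow> (nat \<Rightarrow> real) \<Rightarrow> bool" where
  "has_partial i f d x \<longleftrightarrow> ((\<lambda>r. f (x(i := r))) has_real_derivative d) (at (x i))"

lemma partial_eq: "has_partial i f d x \<Longrightarrow> partial i f x = d"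
  by (simp add: has_partial_def partial_def DERIV_imp_deriv)

lemma Rn_box_subset_Rn: "Rn_box n a e \<subseteq> Rn n"
  by (auto simp: Rn_box_def)

lemma center_in_Rn_box: "a \<in> Rn n \<Longrightarrow> e > 0 \<Longrightarrow> a \<in> Rn_box n a e"
  by (auto simp: Rn_box_def)

lemma openin_Rn_box: "openin (Rn_top n) (Rn_box n a e)"
proof -
  have "open (\<Inter>i\<in>{..<n}. {y :: nat \<Rightarrow> real. \<bar>y i - a i\<bar> < e})"
    by (intro open_INT finite_lessThan ballI open_Collect_less continuous_intros
        continuous_on_product_coordinates)
  moreover have "Rn_box n a e = Rn n \<inter> (\<Inter>i\<in>{..<n}. {y. \<bar>y i - a i\<bar> < e})"
    by (auto simp: Rn_box_def)
  ultimately show ?thesis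
    by (auto simp: openin_open)
qed

text \<open>Points of \<open>Rn n\<close> vanish from index n on, so only the first n factors of a
  basic open set of the product topology constrain anything, and the minimum of n radii serves for
  all of them.\<close>

lemma openin_Rn_iff:
  "openin (Rn_top n) V \<longleftrightarrow> V \<subseteq> Rn n \<and> (\<forall>a\<in>V. \<exists>e>0. Rn_box n a e \<subseteq> V)"
proof
  assume L: "openin (Rn_top n) V"
  then obtain T where T: "open T" "V = Rn n \<inter> T"
    by (auto simp: openin_open)
  have "\<exists>e>0. Rn_box n a e \<subseteq> V" if a: "a \<in> V" for a
  proof -
    have "openin (product_topology (\<lambda>i. euclidean) UNIV) T" "a \<in> T"
      using T a by (auto simp: open_fun_def)
    then obtain X where X: "a \<in> PiE UNIV X" "\<And>i. open (X i)" "PiE UNIV X \<subseteq> T"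
      using product_topology_open_contains_basis[of "\<lambda>i. euclidean" UNIV T a] by auto
    \<comment> \<open>The basis lemma supplies an open factor for every index; induction on k takes
      the minimum of the first k radii.\<close>
    have "\<exists>e>0. \<forall>i<k. \<forall>t. \<bar>t - a i\<bar> < e \<longrightarrow> t \<in> X i" for k :: nat
    proof (induction k)
      case 0
      then show ?case by (auto intro: exI[of _ 1])
    next
      case (Suc k)
      then obtain e where e: "e > 0" "\<forall>i<k. \<forall>t. \<bar>t - a i\<bar> < e \<longrightarrow> t \<in> X i" by auto
      have "a k \<in> X k" using X(1) by auto
      with X(2)[of k] obtain e' where e': "e' > 0" "\<forall>t. \<bar>t - a k\<bar> < e' \<longrightarrow> t \<in> X k"
        by (auto simp: open_dist dist_real_def)
      show ?case
        using e e' by (intro exI[of _ "min e e'"]) (auto simp: less_Suc_eq)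
    qed
    then obtain e where e: "e > 0" "\<forall>i<n. \<forall>t. \<bar>t - a i\<bar> < e \<longrightarrow> t \<in> X i" by blast
    have "y \<in> V" if y: "y \<in> Rn_box n a e" for y
    proof -
      have "y i \<in> X i" for i
      proof (cases "i < n")
        case True
        then show ?thesis using y e by (auto simp: Rn_box_def)
      next
        case False
        then have "y i = a i" using y a T by (auto simp: Rn_box_def Rn_def)
        then show ?thesis using X(1) by auto
      qed
      then show ?thesis using X(3) y T by (auto simp: Rn_box_def PiE_UNIV_domain)
    qed
    then show ?thesis using e by blast
  qed
  then show "V \<subseteq> Rn n \<and> (\<forall>a\<in>V. \<exists>e>0. Rn_box n a e \<subseteq> V)"
    using T by auto
next
  assume R: "V \<subseteq> Rn n \<and> (\<forall>a\<in>V. \<exists>e>0. Rn_box n a e \<subseteq> V)"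
  show "openin (Rn_top n) V"
  proof (subst openin_subopen, intro ballI)
    fix a assume "a \<in> V"
    with R obtain e where "e > 0" "Rn_box n a e \<subseteq> V" "a \<in> Rn n" by blast
    then show "\<exists>T. openin (Rn_top n) T \<and> a \<in> T \<and> T \<subseteq> V"
      using openin_Rn_box[of n a e] center_in_Rn_box[of a n e] by (intro exI[of _ "Rn_box n a e"]) simp
  qed
qed

lemma openin_Rn_subset: "openin (Rn_top n) V \<Longrightarrow> V \<subseteq> Rn n"
  by (simp add: openin_Rn_iff)

lemma Rn_upd: "x \<in> Rn n \<Longrightarrow> i < n \<Longrightarrow> x(i := r) \<in> Rn n"
  by (auto simp: Rn_def)

lemma continuous_on_coord: "continuous_on S f \<Longrightarrow> continuous_on S (\<lambda>x. f x (i :: nat) :: real)"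
  using continuous_on_compose2[OF continuous_on_product_coordinates] by auto

lemma continuous_on_upd:
  fixes f :: "'a :: topological_space \<Rightarrow> nat \<Rightarrow> real"
  assumes "continuous_on S f" "continuous_on S g"
  shows "continuous_on S (\<lambda>x. (f x)(i := g x))"
proof (rule continuous_on_coordinatewise_then_product)
  show "continuous_on S (\<lambda>x. ((f x)(i := g x)) j)" for j
    by (cases "j = i") (simp_all add: assms continuous_on_coord)
qed

text \<open>This makes partial derivatives at a point of an open V depend only on the values on
  V.\<close>

lemma eventually_upd_in:
  assumes "openin (Rn_top n) V" "x \<in> V" "i < n"
  shows "\<forall>\<^sub>F r in nhds (x i). x(i := r) \<in> V"
proof -
  from assms obtain e where e: "e > 0" "Rn_box n x e \<subseteq> V" "x \<in> Rn n"
    unfolding openin_Rn_iff by blast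
  have "x(i := r) \<in> V" if "dist r (x i) < e" for r
  proof -
    have "x(i := r) \<in> Rn_box n x e"
      using that e assms(3) by (auto simp: Rn_box_def Rn_upd dist_real_def)
    then show ?thesis using e by auto
  qed
  then show ?thesis
    using e(1) by (auto simp: eventually_nhds_metric)
qed

lemma has_partial_cong:
  assumes "openin (Rn_top n) V" "x \<in> V" "i < n" "\<And>y. y \<in> V \<Longrightarrow> f y = g y"
  shows "has_partial i f d x \<longleftrightarrow> has_partial i g d x"
  unfolding has_partial_def
  by (rule DERIV_cong_ev)
    (use assms(4) in \<open>auto intro: eventually_mono[OF eventually_upd_in[OF assms(1-3)]]\<close>)

lemma partial_cong:
  assumes "openin (Rn_top n) V" "x \<in> V" "i < n" "\<And>y. y \<in> V \<Longrightarrow> f y = g y"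
  shows "partial i f x = partial i g x"
proof -
  have "has_partial i f d x \<longleftrightarrow> has_partial i g d x" for d
    using has_partial_cong[OF assms(1-3), of f g] assms(4) by auto
  then show ?thesis by (simp add: partial_def deriv_def has_partial_def)
qed

section \<open>Functions of class C^k: locality and closure properties\<close>

lemma Ck_Suc: "Ck (Suc k) n V f \<longleftrightarrow> continuous_on V f \<and>
     (\<exists>D. (\<forall>i<n. \<forall>x\<in>V. has_partial i f (D i x) x) \<and> (\<forall>i<n. Ck k n V (D i)))"
  unfolding Ck.simps has_partial_def by blast

declare Ck.simps(2) [simp del]

lemma Ck_SucI:
  assumes "continuous_on V f" "\<And>i x. i < n \<Longrightarrow> x \<in> V \<Longrightarrow> has_partial i f (D i x) x"
    "\<And>i. i < n \<Longrightarrow> Ck k n V (D i)"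
  shows "Ck (Suc k) n V f"
  using assms by (auto simp: Ck_Suc)

lemma Ck_SucE:
  assumes "Ck (Suc k) n V f"
  obtains D where "continuous_on V f" "\<And>i x. i < n \<Longrightarrow> x \<in> V \<Longrightarrow> has_partial i f (D i x) x"
    "\<And>i. i < n \<Longrightarrow> Ck k n V (D i)"
  using assms by (auto simp: Ck_Suc)

lemma Ck_cong:
  assumes "openin (Rn_top n) V" "\<And>y. y \<in> V \<Longrightarrow> f y = g y"
  shows "Ck k n V f \<longleftrightarrow> Ck k n V g"
proof -
  have c: "continuous_on V f \<longleftrightarrow> continuous_on V g"
    using assms(2) by (intro continuous_on_cong) auto
  show ?thesis
  proof (cases k)
    case (Suc j)
    have "has_partial i f d x \<longleftrightarrow> has_partial i g d x" if "x \<in> V" "i < n" for i d x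
      using has_partial_cong[OF assms(1) that, of f g] assms(2) by auto
    then have "(\<forall>i<n. \<forall>x\<in>V. has_partial i f (D i x) x) \<longleftrightarrow> (\<forall>i<n. \<forall>x\<in>V. has_partial i g (D i x) x)" for D
      by simp
    then show ?thesis unfolding Suc Ck_Suc c by simp
  qed (simp add: c)
qed

text \<open>The witnesses D hidden in \<open>Ck\<close> are forced, because a derivative in one
  variable is unique. Replacing them by \<open>partial\<close> gives a choice that does not depend
  on V, which gluing relies on.\<close>

lemma Ck_Suc_iff:
  assumes "openin (Rn_top n) V"
  shows "Ck (Suc k) n V f \<longleftrightarrow> continuous_on V f \<and>
     (\<forall>i<n. (\<forall>x\<in>V. has_partial i f (partial i f x) x) \<and> Ck k n V (partial i f))" (is "_ \<longleftrightarrow> ?R")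
proof
  assume "Ck (Suc k) n V f"
  then obtain D where D: "continuous_on V f"
    "\<And>i x. i < n \<Longrightarrow> x \<in> V \<Longrightarrow> has_partial i f (D i x) x" "\<And>i. i < n \<Longrightarrow> Ck k n V (D i)"
    by (rule Ck_SucE) blast
  have "partial i f x = D i x" if "i < n" "x \<in> V" for i x
    using D(2)[OF that] by (rule partial_eq)
  then show ?R
    using D Ck_cong[OF assms, of "partial i f" "D i" k for i] by auto
qed (auto intro: Ck_SucI[where D = "\<lambda>i. partial i f"])

lemma Ck_continuous: "Ck k n V f \<Longrightarrow> continuous_on V f"
  by (cases k) (auto simp: Ck_Suc)

lemma Ck_has_partial: "openin (Rn_top n) V \<Longrightarrow> Ck (Suc k) n V f \<Longrightarrow> i < n \<Longrightarrow> x \<in> V \<Longrightarrow>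
    has_partial i f (partial i f x) x"
  by (auto simp: Ck_Suc_iff)

lemma Ck_partial: "openin (Rn_top n) V \<Longrightarrow> Ck (Suc k) n V f \<Longrightarrow> i < n \<Longrightarrow> Ck k n V (partial i f)"
  by (auto simp: Ck_Suc_iff)

lemma Ck_Suc_imp: "Ck (Suc k) n V f \<Longrightarrow> Ck k n V f"
proof (induction k arbitrary: f)
  case (Suc k)
  from Suc.prems obtain D where "continuous_on V f"
    "\<And>i x. i < n \<Longrightarrow> x \<in> V \<Longrightarrow> has_partial i f (D i x) x" "\<And>i. i < n \<Longrightarrow> Ck (Suc k) n V (D i)"
    by (rule Ck_SucE) blast
  then show ?case using Suc.IH by (intro Ck_SucI) auto
qed (simp add: Ck_Suc)

lemma Ck_subset: "Ck k n V f \<Longrightarrow> V' \<subseteq> V \<Longrightarrow> Ck k n V' f"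
proof (induction k arbitrary: f)
  case (Suc k)
  from Suc.prems(1) obtain D where "continuous_on V f"
    "\<And>i x. i < n \<Longrightarrow> x \<in> V \<Longrightarrow> has_partial i f (D i x) x" "\<And>i. i < n \<Longrightarrow> Ck k n V (D i)"
    by (rule Ck_SucE) blast
  then show ?case using Suc by (intro Ck_SucI[where D = D]) (auto intro: continuous_on_subset)
qed (auto intro: continuous_on_subset)

lemma continuous_on_openin_local:
  fixes f :: "(nat \<Rightarrow> real) \<Rightarrow> real"
  assumes "\<And>x. x \<in> V \<Longrightarrow> \<exists>W. openin (Rn_top n) W \<and> x \<in> W \<and> continuous_on (V \<inter> W) f"
    "V \<subseteq> Rn n"
  shows "continuous_on V f"
  unfolding continuous_on_def
proof
  fix x assume x: "x \<in> V"
  then obtain T where T: "open T" "x \<in> T" "continuous_on (V \<inter> (Rn n \<inter> T)) f"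
    using assms(1) by (auto simp: openin_open)
  then have "(f \<longlongrightarrow> f x) (at x within V \<inter> (Rn n \<inter> T))"
    using x assms(2) by (auto simp: continuous_on_def)
  moreover have "at x within V \<inter> (Rn n \<inter> T) = at x within V"
    by (rule at_within_nhd[OF T(2,1)]) (use assms(2) in auto)
  ultimately show "(f \<longlongrightarrow> f x) (at x within V)" by simp
qed

text \<open>Local witnesses for the derivatives need no matching on overlaps, since all of them are
  \<open>partial i f\<close>; the induction hypothesis then applies to that one function.\<close>

lemma Ck_local:
  assumes V: "openin (Rn_top n) V"
    and "\<And>x. x \<in> V \<Longrightarrow> \<exists>W. openin (Rn_top n) W \<and> x \<in> W \<and> Ck k n W f"
  shows "Ck k n V f"
  using assms(2)
proof (induction k arbitrary: f)
  case 0
  have "continuous_on V f"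
  proof (rule continuous_on_openin_local)
    show "\<exists>W. openin (Rn_top n) W \<and> x \<in> W \<and> continuous_on (V \<inter> W) f" if "x \<in> V" for x
      using 0[OF that] by (metis Ck.simps(1) Int_lower2 continuous_on_subset)
  qed (use V in \<open>simp add: openin_Rn_iff\<close>)
  then show ?case by simp
next
  case (Suc k)
  show ?case unfolding Ck_Suc_iff[OF V]
  proof (intro conjI allI impI ballI)
    show "continuous_on V f"
    proof (rule continuous_on_openin_local)
      show "\<exists>W. openin (Rn_top n) W \<and> x \<in> W \<and> continuous_on (V \<inter> W) f" if "x \<in> V" for x
        using Suc.prems[OF that] Ck_continuous by (meson Int_lower2 continuous_on_subset)
    qed (use V in \<open>simp add: openin_Rn_iff\<close>)
    show "has_partial i f (partial i f x) x" if i: "i < n" and x: "x \<in> V" for i x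
    proof -
      from Suc.prems[OF x] obtain W where "openin (Rn_top n) W" "x \<in> W" "Ck (Suc k) n W f" by auto
      then show ?thesis using Ck_has_partial i by simp
    qed
    show "Ck k n V (partial i f)" if i: "i < n" for i
    proof (rule Suc.IH)
      fix x assume x: "x \<in> V"
      from Suc.prems[OF x] obtain W where "openin (Rn_top n) W" "x \<in> W" "Ck (Suc k) n W f" by auto
      then show "\<exists>W. openin (Rn_top n) W \<and> x \<in> W \<and> Ck k n W (partial i f)"
        using Ck_partial i by metis
    qed
  qed
qed

lemma Ck_const: "Ck k n V (\<lambda>x. c)"
  by (induction k arbitrary: c) (auto simp: Ck_Suc has_partial_def intro!: exI[of _ "\<lambda>i x. 0"])

lemma Ck_coord: "Ck k n V (\<lambda>x. x j)"
proof (cases k)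
  case 0
  then show ?thesis by (auto intro: continuous_on_coord continuous_on_id)
next
  case (Suc l)
  have "has_partial i (\<lambda>x. x j) (if i = j then 1 else 0) x" for i x
    by (cases "i = j") (auto simp: has_partial_def)
  then show ?thesis unfolding Suc
    by (intro Ck_SucI[where D = "\<lambda>i x. if i = j then 1 else 0"])
      (auto intro: continuous_on_coord continuous_on_id Ck_const)
qed

lemma Ck_add: "Ck k n V f \<Longrightarrow> Ck k n V g \<Longrightarrow> Ck k n V (\<lambda>x. f x + g x)"
proof (induction k arbitrary: f g)
  case (Suc k)
  from Suc.prems(1) obtain D where D: "continuous_on V f"
    "\<And>i x. i < n \<Longrightarrow> x \<in> V \<Longrightarrow> has_partial i f (D i x) x" "\<And>i. i < n \<Longrightarrow> Ck k n V (D i)"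
    by (rule Ck_SucE) blast
  from Suc.prems(2) obtain E where E: "continuous_on V g"
    "\<And>i x. i < n \<Longrightarrow> x \<in> V \<Longrightarrow> has_partial i g (E i x) x" "\<And>i. i < n \<Longrightarrow> Ck k n V (E i)"
    by (rule Ck_SucE) blast
  have "has_partial i (\<lambda>x. f x + g x) (D i x + E i x) x" if "i < n" "x \<in> V" for i x
    using DERIV_add[OF D(2)[OF that, unfolded has_partial_def] E(2)[OF that, unfolded has_partial_def]]
    by (simp add: has_partial_def)
  then show ?case
    by (intro Ck_SucI[where D = "\<lambda>i x. D i x + E i x"])
      (auto intro: continuous_on_add D E Suc.IH)
qed (auto intro: continuous_on_add)

lemma Ck_mult: "Ck k n V f \<Longrightarrow> Ck k n V g \<Longrightarrow> Ck k n V (\<lambda>x. f x * g x)"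
proof (induction k arbitrary: f g)
  case (Suc k)
  from Suc.prems(1) obtain D where D: "continuous_on V f"
    "\<And>i x. i < n \<Longrightarrow> x \<in> V \<Longrightarrow> has_partial i f (D i x) x" "\<And>i. i < n \<Longrightarrow> Ck k n V (D i)"
    by (rule Ck_SucE) blast
  from Suc.prems(2) obtain E where E: "continuous_on V g"
    "\<And>i x. i < n \<Longrightarrow> x \<in> V \<Longrightarrow> has_partial i g (E i x) x" "\<And>i. i < n \<Longrightarrow> Ck k n V (E i)"
    by (rule Ck_SucE) blast
  have "has_partial i (\<lambda>x. f x * g x) (D i x * g x + E i x * f x) x" if "i < n" "x \<in> V" for i x
    using DERIV_mult[OF D(2)[OF that, unfolded has_partial_def] E(2)[OF that, unfolded has_partial_def]]
    by (simp add: has_partial_def)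
  moreover have "Ck k n V (\<lambda>x. D i x * g x + E i x * f x)" if "i < n" for i
    using Suc.prems[THEN Ck_Suc_imp] D(3)[OF that] E(3)[OF that] by (intro Ck_add Suc.IH)
  ultimately show ?case
    by (intro Ck_SucI[where D = "\<lambda>i x. D i x * g x + E i x * f x"])
      (auto intro: continuous_on_mult D E)
qed (auto intro: continuous_on_mult)

lemma Ck_sum: "(\<And>j. j \<in> J \<Longrightarrow> Ck k n V (f j)) \<Longrightarrow> Ck k n V (\<lambda>x. \<Sum>j\<in>J. f j x)"
  by (induction J rule: infinite_finite_induct) (auto intro: Ck_const Ck_add)

lemma Ck_inverse:
  "Ck k n V f \<Longrightarrow> (\<And>x. x \<in> V \<Longrightarrow> f x \<noteq> 0) \<Longrightarrow> Ck k n V (\<lambda>x. inverse (f x))"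
proof (induction k)
  case (Suc k)
  from Suc.prems(1) obtain D where D: "continuous_on V f"
    "\<And>i x. i < n \<Longrightarrow> x \<in> V \<Longrightarrow> has_partial i f (D i x) x" "\<And>i. i < n \<Longrightarrow> Ck k n V (D i)"
    by (rule Ck_SucE) blast
  \<comment> \<open>The derivative of 1/f, written with products only. It involves 1/f itself, which
    the induction hypothesis makes of class k.\<close>
  let ?D = "\<lambda>i x. (-1) * (inverse (f x) * (D i x * inverse (f x)))"
  have "Ck k n V (\<lambda>x. inverse (f x))"
    using Suc Ck_Suc_imp by blast
  then have "Ck k n V (?D i)" if "i < n" for i
    using D(3)[OF that] by (intro Ck_mult Ck_const)
  moreover have "has_partial i (\<lambda>x. inverse (f x)) (?D i x) x" if "i < n" "x \<in> V" for i x
    using DERIV_inverse'[OF D(2)[OF that, unfolded has_partial_def]] Suc.prems(2)[OF that(2)]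
    by (simp add: has_partial_def mult.assoc)
  ultimately show ?case
    using Suc.prems(2) D(1)
    by (intro Ck_SucI[where D = ?D]) (auto intro: continuous_on_inverse)
qed (auto intro: continuous_on_inverse)

section \<open>Convergence, continuity and open preimages in \<open>Rn n\<close>\<close>

text \<open>Neighbourhoods of a in \<open>Rn m\<close> contain boxes, so the first m coordinates
  decide once the values lie in \<open>Rn m\<close>.\<close>

lemma tendsto_Rn:
  assumes "\<forall>\<^sub>F r in F. \<gamma> r \<in> Rn m" "a \<in> Rn m" "\<And>j. j < m \<Longrightarrow> ((\<lambda>r. \<gamma> r j) \<longlongrightarrow> a j) F"
  shows "(\<gamma> \<longlongrightarrow> a) F"
proof (rule topological_tendstoI)
  fix S :: "(nat \<Rightarrow> real) set" assume S: "open S" "a \<in> S"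
  have "openin (Rn_top m) (Rn m \<inter> S)" using S by (auto simp: openin_open)
  then obtain e where e: "e > 0" "Rn_box m a e \<subseteq> S"
    using S assms(2) by (force simp: openin_Rn_iff)
  have "\<forall>\<^sub>F r in F. \<forall>j\<in>{..<m}. dist (\<gamma> r j) (a j) < e"
    using assms(3) e(1) by (intro eventually_ball_finite ballI tendstoD) auto
  with assms(1) show "\<forall>\<^sub>F r in F. \<gamma> r \<in> S"
    by eventually_elim (use e(2) in \<open>auto simp: Rn_box_def dist_real_def\<close>)
qed

lemma continuous_on_bxI:
  fixes f :: "(nat \<Rightarrow> real) \<Rightarrow> real"
  assumes "V \<subseteq> Rn n"
    "\<And>x \<epsilon>. x \<in> V \<Longrightarrow> \<epsilon> > 0 \<Longrightarrow> \<exists>\<eta>>0. \<forall>y\<in>V \<inter> Rn_box n x \<eta>. \<bar>f y - f x\<bar> < \<epsilon>"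
  shows "continuous_on V f"
  unfolding continuous_on_def
proof (intro ballI tendstoI)
  fix x \<epsilon> assume x: "x \<in> V" "(0::real) < \<epsilon>"
  then obtain \<eta> where \<eta>: "\<eta> > 0" "\<forall>y\<in>V \<inter> Rn_box n x \<eta>. \<bar>f y - f x\<bar> < \<epsilon>"
    using assms(2) by blast
  obtain T where T: "open T" "Rn_box n x \<eta> = Rn n \<inter> T"
    using openin_Rn_box[of n x \<eta>] by (auto simp: openin_open)
  have "x \<in> T" using T(2) \<eta>(1) x(1) assms(1) center_in_Rn_box[of x n \<eta>] by auto
  then show "\<forall>\<^sub>F y in at x within V. dist (f y) (f x) < \<epsilon>"
    unfolding eventually_at_topological
    using T \<eta>(2) assms(1) by (intro exI[of _ T]) (auto simp: dist_real_def)
qed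

lemma continuous_on_into_Rn:
  assumes "\<And>x. x \<in> V \<Longrightarrow> F x \<in> Rn m" "\<And>j. j < m \<Longrightarrow> continuous_on V (\<lambda>x. F x j)"
  shows "continuous_on V F"
proof (rule continuous_on_coordinatewise_then_product)
  fix j
  show "continuous_on V (\<lambda>x. F x j)"
  proof (cases "j < m")
    case False
    then have "continuous_on V (\<lambda>x. F x j) \<longleftrightarrow> continuous_on V (\<lambda>x. 0 :: real)"
      using assms(1) by (intro continuous_on_cong) (auto simp: Rn_def)
    then show ?thesis by simp
  qed (use assms(2) in auto)
qed

lemma openin_preimage:
  assumes "openin (Rn_top n) V" "continuous_on V f" "open T"
  shows "openin (Rn_top n) {x \<in> V. f x \<in> T}"
proof -
  have "openin (top_of_set V) (V \<inter> f -` T)"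
    using assms by (intro continuous_openin_preimage_gen)
  moreover have "V \<inter> f -` T = {x \<in> V. f x \<in> T}" by auto
  ultimately show ?thesis using openin_trans[OF _ assms(1)] by simp
qed

lemma openin_preimage_Rn:
  assumes "openin (Rn_top n) V" "continuous_on V F" "openin (Rn_top m) W"
    "\<And>x. x \<in> V \<Longrightarrow> F x \<in> Rn m"
  shows "openin (Rn_top n) {x \<in> V. F x \<in> W}"
proof -
  obtain T where T: "open T" "W = Rn m \<inter> T" using assms(3) by (auto simp: openin_open)
  have "{x \<in> V. F x \<in> W} = {x \<in> V. F x \<in> T}" using T assms(4) by auto
  then show ?thesis using openin_preimage[OF assms(1,2) T(1)] by simp
qed

text \<open>The path from \<open>a\<close> to \<open>y\<close> changes one coordinate at a time, so that the Hadamard expansion below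
  needs only the fundamental theorem in one variable and can be used to prove the chain rule.\<close>

definition hadamard_point :: "nat \<Rightarrow> (nat \<Rightarrow> real) \<Rightarrow> real \<Rightarrow> (nat \<Rightarrow> real) \<Rightarrow> nat \<Rightarrow> real" where
  "hadamard_point j a t y = (\<lambda>l. if l < j then y l else if l = j then a j + t * (y j - a j) else a l)"

text \<open>The weight t^m makes the family closed under differentiation: a derivative in the j-th
  variable produces one more factor t. The expansion itself uses m = 0.\<close>

definition hadamard_integral :: "nat \<Rightarrow> (nat \<Rightarrow> real) \<Rightarrow> nat \<Rightarrow> ((nat \<Rightarrow> real) \<Rightarrow> real) \<Rightarrow> (nat \<Rightarrow> real) \<Rightarrow> real" where
  "hadamard_integral j a m f y = integral {0..1} (\<lambda>t. t ^ m * f (hadamard_point j a t y))"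

text \<open>Each coordinate of the path lies between those of a and y, and the box is convex with
  centre a.\<close>

lemma hadamard_point_in_Rn_box:
  assumes "y \<in> Rn_box n a e" "a \<in> Rn n" "t \<in> {0..1}" "j < n"
  shows "hadamard_point j a t y \<in> Rn_box n a e"
proof -
  have e: "\<bar>y j - a j\<bar> < e" using assms by (auto simp: Rn_box_def)
  then have "0 < e" by linarith
  moreover have "\<bar>t * (y j - a j)\<bar> < e"
    using e assms(3) mult_left_le_one_le[of "\<bar>y j - a j\<bar>" t] by (auto simp: abs_mult)
  ultimately show ?thesis using assms by (auto simp: Rn_box_def hadamard_point_def Rn_def)
qed

lemma continuous_on_hadamard_point: "continuous_on S (\<lambda>z. hadamard_point j a (snd z) (fst z))"
proof (rule continuous_on_coordinatewise_then_product)
  fix l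
  have c: "continuous_on S (\<lambda>z :: (nat \<Rightarrow> real) \<times> real. fst z i)" for i
    by (intro continuous_on_coord continuous_intros)
  show "continuous_on S (\<lambda>z. hadamard_point j a (snd z) (fst z) l)"
    by (cases l j rule: linorder_cases) (auto simp: hadamard_point_def intro!: continuous_intros c)
qed

text \<open>Joint continuity in (y, t) is what continuity of parameter integrals and differentiation
  under the integral sign require.\<close>

lemma continuous_on_hadamard_integral_arg:
  assumes "continuous_on (Rn_box n a e) f" "a \<in> Rn n" "j < n"
  shows "continuous_on (Rn_box n a e \<times> cbox 0 1) (\<lambda>(y, t). t ^ m * f (hadamard_point j a t y))"
proof -
  let ?S = "Rn_box n a e \<times> cbox (0::real) 1"
  have "continuous_on ?S (\<lambda>z. f (hadamard_point j a (snd z) (fst z)))"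
    by (rule continuous_on_compose2[OF assms(1) continuous_on_hadamard_point])
      (use hadamard_point_in_Rn_box[OF _ assms(2) _ assms(3)] in auto)
  then have "continuous_on ?S (\<lambda>z. snd z ^ m * f (hadamard_point j a (snd z) (fst z)))"
    by (intro continuous_on_mult continuous_on_power continuous_on_snd continuous_on_id)
  then show ?thesis by (simp add: case_prod_unfold)
qed

text \<open>Differentiation under the integral sign. For l < j the path point moves with
  \<open>y l\<close> at unit speed, for l = j at speed t, and for l > j it does not depend on
  \<open>y l\<close>.\<close>

lemma has_partial_hadamard_integral:
  assumes f: "Ck (Suc 0) n (Rn_box n a e) f" and a: "a \<in> Rn n" and j: "j < n" and l: "l < n"
    and y: "y \<in> Rn_box n a e"
  shows "has_partial l (hadamard_integral j a m f) (if l < j then hadamard_integral j a m (partial l f) y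
     else if l = j then hadamard_integral j a (Suc m) (partial j f) y else 0) y"
proof -
  let ?U = "{a l - e<..<a l + e}"
  define fx where "fx x t = (if l < j then t ^ m * partial l f (hadamard_point j a t (y(l := x)))
     else if l = j then t ^ Suc m * partial j f (hadamard_point j a t (y(l := x))) else 0)" for x t :: real
  have yU: "y l \<in> ?U" using y l by (auto simp: Rn_box_def abs_less_iff)
  have upd: "y(l := x) \<in> Rn_box n a e" if "x \<in> ?U" for x
    using y l that by (auto simp: Rn_box_def Rn_upd)
  have cpd: "continuous_on (Rn_box n a e) (partial i f)" if "i < n" for i
    using Ck_partial[OF openin_Rn_box f that] by simp
  have hpd: "((\<lambda>r. f (z(i := r))) has_real_derivative partial i f z) (at (z i))"
    if "z \<in> Rn_box n a e" "i < n" for i z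
    using Ck_has_partial[OF openin_Rn_box f that(2,1)] by (simp add: has_partial_def)
  have "((\<lambda>x. integral (cbox 0 1) ((\<lambda>x t. t ^ m * f (hadamard_point j a t (y(l := x)))) x))
      has_field_derivative integral (cbox 0 1) (fx (y l))) (at (y l) within ?U)"
  proof (rule leibniz_rule_field_derivative)
    fix x t :: real assume x: "x \<in> ?U" and t: "t \<in> cbox 0 1"
    then have in_Rn_box: "hadamard_point j a t (y(l := x)) \<in> Rn_box n a e"
      using hadamard_point_in_Rn_box[OF upd[OF x] a _ j] by auto
    show "((\<lambda>x. t ^ m * f (hadamard_point j a t (y(l := x)))) has_field_derivative fx x t) (at x within ?U)"
    proof (cases l j rule: linorder_cases)
      case less
      then have "(hadamard_point j a t (y(l := x)))(l := r) = hadamard_point j a t (y(l := r))"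
        "hadamard_point j a t (y(l := x)) l = x" for r x
        by (auto simp: hadamard_point_def fun_eq_iff)
      then have "((\<lambda>r. f (hadamard_point j a t (y(l := r)))) has_real_derivative
          partial l f (hadamard_point j a t (y(l := x)))) (at x)"
        using hpd[OF in_Rn_box l] by simp
      from has_field_derivative_at_within[OF DERIV_cmult[OF this, of "t ^ m"]]
      show ?thesis
        using less by (simp add: fx_def)
    next
      case equal
      have eq: "(hadamard_point j a t (y(l := x)))(l := a j + t * (r - a j)) = hadamard_point j a t (y(l := r))"
        "hadamard_point j a t (y(l := x)) l = a j + t * (x - a j)" for r x
        using equal by (auto simp: hadamard_point_def fun_eq_iff)
      have "((\<lambda>r. a j + t * (r - a j)) has_real_derivative t) (at x)"
        by (auto intro!: derivative_eq_intros)
      from DERIV_chain2[OF hpd[OF in_Rn_box l, unfolded eq(2)] this]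
      have "((\<lambda>r. f (hadamard_point j a t (y(l := r)))) has_real_derivative
          partial l f (hadamard_point j a t (y(l := x))) * t) (at x)"
        by (simp add: eq)
      from has_field_derivative_at_within[OF DERIV_cmult[OF this, of "t ^ m"]]
      show ?thesis
        using equal by (simp add: fx_def mult_ac)
    next
      case greater
      then have "hadamard_point j a t (y(l := x)) = hadamard_point j a t y" for x
        by (auto simp: hadamard_point_def fun_eq_iff)
      then show ?thesis using greater by (simp add: fx_def)
    qed
  next
    fix x assume x: "x \<in> ?U"
    have "continuous_on {0..1} (\<lambda>t. (y(l := x), t :: real))"
      by (intro continuous_on_Pair continuous_on_const continuous_on_id)
    from continuous_on_compose2[OF continuous_on_hadamard_integral_arg[OF Ck_continuous[OF f] a j, of m] this]
    have "continuous_on {0..1} (\<lambda>t. t ^ m * f (hadamard_point j a t (y(l := x))))"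
      using upd[OF x] by auto
    then show "(\<lambda>t. t ^ m * f (hadamard_point j a t (y(l := x)))) integrable_on cbox 0 1"
      by (simp add: integrable_continuous_real)
  next
    have up: "continuous_on (?U \<times> cbox 0 1) (\<lambda>z. (y(l := fst z), snd z :: real))"
      by (intro continuous_intros continuous_on_upd)
    have c: "continuous_on (?U \<times> cbox 0 1) (\<lambda>z. (snd z) ^ k * partial i f (hadamard_point j a (snd z) (y(l := fst z))))"
      if "i < n" for i k
      using continuous_on_compose2[OF continuous_on_hadamard_integral_arg[OF cpd[OF that] a j, of k] up] upd
      by (force simp: case_prod_unfold)
    show "continuous_on (?U \<times> cbox 0 1) (\<lambda>(x, t). fx x t)"
      using c[OF l, of m] c[OF j, of "Suc m"]
      by (cases l j rule: linorder_cases) (simp_all add: fx_def case_prod_unfold)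
  qed (use yU in auto)
  moreover have "at (y l) within ?U = at (y l)"
    using yU by (intro at_within_open) auto
  moreover have "integral (cbox 0 1) (fx (y l)) = (if l < j then hadamard_integral j a m (partial l f) y
     else if l = j then hadamard_integral j a (Suc m) (partial j f) y else 0)"
    by (auto simp: fx_def[abs_def] hadamard_integral_def)
  ultimately show ?thesis
    by (simp add: has_partial_def hadamard_integral_def)
qed

text \<open>The exponent m has to be arbitrary in the induction, since differentiating in direction
  j passes from m to m + 1.\<close>

lemma Ck_hadamard_integral:
  assumes "Ck k n (Rn_box n a e) f" "a \<in> Rn n" "j < n"
  shows "Ck k n (Rn_box n a e) (hadamard_integral j a m f)"
  using assms(1)
proof (induction k arbitrary: f m)
  case 0
  have "continuous_on (Rn_box n a e) (\<lambda>y. integral (cbox 0 1) ((\<lambda>y t. t ^ m * f (hadamard_point j a t y)) y))"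
    by (rule integral_continuous_on_param, rule continuous_on_hadamard_integral_arg) (use 0 assms in auto)
  then show ?case by (simp add: hadamard_integral_def[abs_def])
next
  case (Suc k)
  have C1: "Ck (Suc 0) n (Rn_box n a e) f"
    using Suc.prems by (induction k) (auto dest: Ck_Suc_imp)
  have "continuous_on (Rn_box n a e) (\<lambda>y. integral (cbox 0 1) ((\<lambda>y t. t ^ m * f (hadamard_point j a t y)) y))"
    by (rule integral_continuous_on_param, rule continuous_on_hadamard_integral_arg)
      (use Ck_continuous[OF Suc.prems] assms in auto)
  then have c: "continuous_on (Rn_box n a e) (hadamard_integral j a m f)" by (simp add: hadamard_integral_def[abs_def])
  show ?case
  proof (rule Ck_SucI[OF c has_partial_hadamard_integral[OF C1 assms(2,3)]])
    fix l assume l: "l < n"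
    show "Ck k n (Rn_box n a e) (\<lambda>y. if l < j then hadamard_integral j a m (partial l f) y
       else if l = j then hadamard_integral j a (Suc m) (partial j f) y else 0)"
      using Suc.IH[OF Ck_partial[OF openin_Rn_box Suc.prems]] l assms(3)
      by (cases l j rule: linorder_cases) (auto simp: Ck_const)
  qed
qed

text \<open>At the centre the path is constant. Hence the coefficients of the expansion below take
  there the values of the partial derivatives.\<close>

lemma hadamard_integral_center: "hadamard_integral j a 0 f a = f a"
proof -
  have "hadamard_point j a t a = a" for t by (auto simp: hadamard_point_def fun_eq_iff)
  then show ?thesis by (simp add: hadamard_integral_def)
qed

text \<open>Telescoping over the corners \<open>p j\<close> of the path: on the j-th edge only
  coordinate j varies, and the fundamental theorem of calculus turns the increment into
  \<open>y j - a j\<close> times an integral.\<close>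

lemma hadamard_expansion:
  assumes g: "Ck (Suc 0) n (Rn_box n a e) g" and a: "a \<in> Rn n" and y: "y \<in> Rn_box n a e"
  shows "g y = g a + (\<Sum>j<n. (y j - a j) * hadamard_integral j a 0 (partial j g) y)"
proof -
  define p where "p j = (\<lambda>l. if l < j then y l else a l)" for j :: nat
  have step: "(y j - a j) * hadamard_integral j a 0 (partial j g) y = g (p (Suc j)) - g (p j)" if j: "j < n" for j
  proof -
    have "((\<lambda>t. (y j - a j) * partial j g (hadamard_point j a t y)) has_integral
        g (hadamard_point j a 1 y) - g (hadamard_point j a 0 y)) {0..1}"
    proof (rule fundamental_theorem_of_calculus)
      fix t :: real assume t: "t \<in> {0..1}"
      have eq: "(hadamard_point j a t y)(j := a j + s * (y j - a j)) = hadamard_point j a s y"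
        "hadamard_point j a t y j = a j + t * (y j - a j)" for s
        by (auto simp: hadamard_point_def fun_eq_iff)
      have "((\<lambda>t. a j + t * (y j - a j)) has_real_derivative (y j - a j)) (at t)"
        by (auto intro!: derivative_eq_intros)
      from DERIV_chain2[OF Ck_has_partial[OF openin_Rn_box g j hadamard_point_in_Rn_box[OF y a t j],
          unfolded has_partial_def eq(2)] this]
      show "((\<lambda>t. g (hadamard_point j a t y)) has_vector_derivative (y j - a j) * partial j g (hadamard_point j a t y))
          (at t within {0..1})"
        unfolding eq by (simp add: has_real_derivative_iff_has_vector_derivative[symmetric]
            has_field_derivative_at_within mult.commute)
    qed simp
    moreover have "hadamard_point j a 1 y = p (Suc j)" "hadamard_point j a 0 y = p j"
      by (auto simp: hadamard_point_def p_def fun_eq_iff less_Suc_eq)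
    ultimately show ?thesis
      by (simp add: hadamard_integral_def integral_mult_right[symmetric] integral_unique del: integral_mult_right)
  qed
  have "p 0 = a" by (simp add: p_def)
  moreover have "p n = y" using a y by (auto simp: p_def fun_eq_iff Rn_box_def Rn_def)
  ultimately show ?thesis
    using step by (simp add: sum_lessThan_telescope[of "\<lambda>j. g (p j)"])
qed

section \<open>The chain rule from Hadamard's expansion\<close>

text \<open>Where u vanishes, the difference quotient of u * H is that of u times H, so a limit of H
  takes the place of its differentiability.\<close>

lemma DERIV_mult_zero:
  fixes u H :: "real \<Rightarrow> real"
  assumes "(u has_real_derivative d) (at x)" "u x = 0" "(H \<longlongrightarrow> h) (at x)"
  shows "((\<lambda>r. u r * H r) has_real_derivative d * h) (at x)"
  using tendsto_mult[OF assms(1)[unfolded has_field_derivative_iff] assms(3)] assms(2)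
  by (simp add: has_field_derivative_iff)

text \<open>By \<open>hadamard_expansion\<close> about a = \<open>\<gamma> r0\<close>, g along the
  curve is a constant plus products of \<open>\<gamma> r j - a j\<close> with
  \<open>h j (\<gamma> r)\<close>. The first factor vanishes at r0, so
  \<open>DERIV_mult_zero\<close> asks no more of \<open>h j\<close> than continuity.\<close>

lemma DERIV_compose_Rn:
  assumes W: "openin (Rn_top m) W" and g: "Ck (Suc 0) m W g" and r0: "\<gamma> r0 \<in> W"
    and ev: "\<forall>\<^sub>F r in at r0. \<gamma> r \<in> Rn m"
    and d: "\<And>j. j < m \<Longrightarrow> ((\<lambda>r. \<gamma> r j) has_real_derivative d j) (at r0)"
  shows "((\<lambda>r. g (\<gamma> r)) has_real_derivative (\<Sum>j<m. d j * partial j g (\<gamma> r0))) (at r0)"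
proof -
  define a where "a = \<gamma> r0"
  have a: "a \<in> Rn m" using W r0 by (auto simp: openin_Rn_iff a_def)
  obtain e where e: "e > 0" "Rn_box m a e \<subseteq> W" using W r0 by (auto simp: openin_Rn_iff a_def)
  have gb: "Ck (Suc 0) m (Rn_box m a e) g" using Ck_subset[OF g e(2)] .
  define h where "h j = hadamard_integral j a 0 (partial j g)" for j
  have h: "continuous_on (Rn_box m a e) (h j)" if "j < m" for j
    using Ck_hadamard_integral[OF Ck_partial[OF openin_Rn_box gb that] a that] by (simp add: h_def)
  have lim: "(\<gamma> \<longlongrightarrow> a) (at r0)"
    using DERIV_isCont[OF d] by (intro tendsto_Rn[OF ev a]) (auto simp: isCont_def a_def)
  obtain T where T: "open T" "Rn_box m a e = Rn m \<inter> T" using openin_Rn_box[of m a e] by (auto simp: openin_open)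
  have "a \<in> T" using T(2) center_in_Rn_box[OF a e(1)] by auto
  from topological_tendstoD[OF lim T(1) this] ev
  have evb: "\<forall>\<^sub>F r in at r0. \<gamma> r \<in> Rn_box m a e"
    by eventually_elim (simp add: T(2))
  have "((\<lambda>r. h j (\<gamma> r)) \<longlongrightarrow> h j a) (at r0)" if "j < m" for j
    by (rule continuous_on_tendsto_compose[OF h[OF that] lim center_in_Rn_box[OF a e(1)] evb])
  then have "((\<lambda>r. (\<gamma> r j - a j) * h j (\<gamma> r)) has_real_derivative d j * h j a) (at r0)"
    if "j < m" for j
    using DERIV_diff[OF d[OF that] DERIV_const[of "a j"]] that
    by (intro DERIV_mult_zero) (auto simp: a_def)
  then have "((\<lambda>r. g a + (\<Sum>j<m. (\<gamma> r j - a j) * h j (\<gamma> r))) has_real_derivative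
      0 + (\<Sum>j<m. d j * h j a)) (at r0)"
    by (intro DERIV_add DERIV_const DERIV_sum) auto
  moreover have "\<forall>\<^sub>F r in nhds r0. g (\<gamma> r) = g a + (\<Sum>j<m. (\<gamma> r j - a j) * h j (\<gamma> r))"
    unfolding eventually_nhds_conv_at
  proof
    show "\<forall>\<^sub>F r in at r0. g (\<gamma> r) = g a + (\<Sum>j<m. (\<gamma> r j - a j) * h j (\<gamma> r))"
      using evb by eventually_elim (use hadamard_expansion[OF gb a] in \<open>simp add: h_def\<close>)
  qed (simp add: a_def)
  moreover have "h j a = partial j g a" for j by (simp add: h_def hadamard_integral_center)
  ultimately show ?thesis
    using DERIV_cong_ev[of r0 r0 "\<lambda>r. g (\<gamma> r)"] by (simp add: a_def)
qed

lemma has_partial_compose: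
  assumes W: "openin (Rn_top m) W" and g: "Ck (Suc 0) m W g" and V: "openin (Rn_top n) V"
    and F: "\<And>j. j < m \<Longrightarrow> has_partial i (\<lambda>x. F x j) (d j) x" "\<And>x. x \<in> V \<Longrightarrow> F x \<in> W"
    and i: "i < n" and x: "x \<in> V"
  shows "has_partial i (\<lambda>x. g (F x)) (\<Sum>j<m. d j * partial j g (F x)) x"
proof -
  have "\<forall>\<^sub>F r in at (x i). F (x(i := r)) \<in> Rn m"
    using eventually_nhds_conv_at[THEN iffD1, OF eventually_upd_in[OF V x i], THEN conjunct1]
    by eventually_elim (use F(2) openin_Rn_subset[OF W] in auto)
  then show ?thesis
    using DERIV_compose_Rn[OF W g, of "\<lambda>r. F (x(i := r))" "x i" d] F x
    by (simp add: has_partial_def)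
qed

text \<open>A partial derivative of the composite is a sum of products of partial derivatives of F
  with partial derivatives of g taken at F; the latter are of class k by the induction hypothesis
  for another g.\<close>

lemma Ck_compose:
  assumes W: "openin (Rn_top m) W" and V: "openin (Rn_top n) V"
    and g: "Ck k m W g" and F: "\<And>j. j < m \<Longrightarrow> Ck k n V (\<lambda>x. F x j)" "\<And>x. x \<in> V \<Longrightarrow> F x \<in> W"
  shows "Ck k n V (\<lambda>x. g (F x))"
  using g F(1)
proof (induction k arbitrary: g)
  case 0
  have "continuous_on V F"
    using F(2) openin_Rn_subset[OF W] 0 by (intro continuous_on_into_Rn[where m = m]) auto
  then show ?case
    using 0 continuous_on_compose2[of W g V F] F(2) by auto
next
  case (Suc k)
  have C1: "Ck (Suc 0) m W g"
    using Suc.prems(1) by (induction k) (auto dest: Ck_Suc_imp)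
  have "continuous_on V F"
    using F(2) openin_Rn_subset[OF W] Ck_continuous[OF Suc.prems(2)]
    by (intro continuous_on_into_Rn[where m = m]) auto
  then have c: "continuous_on V (\<lambda>x. g (F x))"
    using continuous_on_compose2[of W g V F] Ck_continuous[OF C1] F(2) by auto
  show ?case
  proof (rule Ck_SucI[OF c])
    show "has_partial i (\<lambda>x. g (F x)) (\<Sum>j<m. partial i (\<lambda>x. F x j) x * partial j g (F x)) x"
      if "i < n" "x \<in> V" for i x
      using has_partial_compose[OF W C1 V Ck_has_partial[OF V Suc.prems(2)] F(2)] that by blast
    show "Ck k n V (\<lambda>x. \<Sum>j<m. partial i (\<lambda>x. F x j) x * partial j g (F x))" if i: "i < n" for i
    proof (rule Ck_sum, rule Ck_mult)
      fix j assume j: "j \<in> {..<m}"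
      then show "Ck k n V (partial i (\<lambda>x. F x j))"
        using Ck_partial[OF V Suc.prems(2) i] by simp
      show "Ck k n V (\<lambda>x. partial j g (F x))"
        using Suc.IH[OF Ck_partial[OF W Suc.prems(1)]] Suc.prems(2) Ck_Suc_imp j by simp
    qed
  qed
qed

lemma smooth_Rn_continuous: "smooth_Rn n V f \<Longrightarrow> continuous_on V f"
  unfolding smooth_Rn_def using Ck_continuous by blast

lemma smooth_Rn_subset: "smooth_Rn n V f \<Longrightarrow> V' \<subseteq> V \<Longrightarrow> smooth_Rn n V' f"
  unfolding smooth_Rn_def using Ck_subset by blast

lemma smooth_Rn_cong:
  "openin (Rn_top n) V \<Longrightarrow> (\<And>y. y \<in> V \<Longrightarrow> f y = g y) \<Longrightarrow> smooth_Rn n V f \<longleftrightarrow> smooth_Rn n V g"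
  using Ck_cong[of n V f g] by (auto simp: smooth_Rn_def)

lemma smooth_Rn_local:
  assumes "openin (Rn_top n) V"
    "\<And>x. x \<in> V \<Longrightarrow> \<exists>W. openin (Rn_top n) W \<and> x \<in> W \<and> smooth_Rn n W f"
  shows "smooth_Rn n V f"
  unfolding smooth_Rn_def
proof
  fix k
  show "Ck k n V f"
    by (rule Ck_local[OF assms(1)]) (use assms(2) in \<open>auto simp: smooth_Rn_def\<close>)
qed

lemma smooth_Rn_const: "smooth_Rn n V (\<lambda>x. c)"
  by (simp add: smooth_Rn_def Ck_const)

lemma smooth_Rn_coord: "smooth_Rn n V (\<lambda>x. x j)"
  by (simp add: smooth_Rn_def Ck_coord)

lemma smooth_Rn_add: "smooth_Rn n V f \<Longrightarrow> smooth_Rn n V g \<Longrightarrow> smooth_Rn n V (\<lambda>x. f x + g x)"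
  by (simp add: smooth_Rn_def Ck_add)

lemma smooth_Rn_mult: "smooth_Rn n V f \<Longrightarrow> smooth_Rn n V g \<Longrightarrow> smooth_Rn n V (\<lambda>x. f x * g x)"
  by (simp add: smooth_Rn_def Ck_mult)

lemma smooth_Rn_partial: "openin (Rn_top n) V \<Longrightarrow> smooth_Rn n V f \<Longrightarrow> i < n \<Longrightarrow> smooth_Rn n V (partial i f)"
  by (simp add: smooth_Rn_def Ck_partial)

lemma smooth_Rn_has_partial: "openin (Rn_top n) V \<Longrightarrow> smooth_Rn n V f \<Longrightarrow> i < n \<Longrightarrow> x \<in> V \<Longrightarrow>
    has_partial i f (partial i f x) x"
  using Ck_has_partial by (auto simp: smooth_Rn_def)

lemma smooth_Rn_compose:
  assumes "openin (Rn_top m) W" "openin (Rn_top n) V" "smooth_Rn m W g"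
    "\<And>j. j < m \<Longrightarrow> smooth_Rn n V (\<lambda>x. F x j)" "\<And>x. x \<in> V \<Longrightarrow> F x \<in> W"
  shows "smooth_Rn n V (\<lambda>x. g (F x))"
  using Ck_compose[OF assms(1,2)] assms(3-5) by (simp add: smooth_Rn_def)

lemma smooth_Rn_hadamard_integral:
  "smooth_Rn n (Rn_box n a e) f \<Longrightarrow> a \<in> Rn n \<Longrightarrow> j < n \<Longrightarrow> smooth_Rn n (Rn_box n a e) (hadamard_integral j a m f)"
  by (simp add: smooth_Rn_def Ck_hadamard_integral)

section \<open>The inverse function theorem for the exchange of one coordinate\<close>

text \<open>The map replaces coordinate i by \<phi>. Its inverse also changes coordinate i only, so
  a single function G describes it. The factor s carries the sign of the partial derivative, so that
  s * \<phi> increases in direction i; the domain is a box so that segments in this direction stay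
  inside.\<close>

locale exchange =
  fixes n i :: nat and s :: real and a :: "nat \<Rightarrow> real" and e :: real and \<phi> :: "(nat \<Rightarrow> real) \<Rightarrow> real"
  assumes i: "i < n" and a: "a \<in> Rn n" and s: "s \<noteq> 0"
    and smooth: "smooth_Rn n (Rn_box n a e) \<phi>"
    and pos: "\<And>x. x \<in> Rn_box n a e \<Longrightarrow> s * partial i \<phi> x > 0"
begin

abbreviation "B \<equiv> Rn_box n a e"

definition "\<Psi> x = x(i := \<phi> x)"

definition "G y = inv_into B \<Psi> y i"

lemma has_partial: "x \<in> B \<Longrightarrow> j < n \<Longrightarrow> has_partial j \<phi> (partial j \<phi> x) x"
  by (rule smooth_Rn_has_partial[OF openin_Rn_box smooth])

lemma upd_in: "x \<in> B \<Longrightarrow> \<bar>u - a i\<bar> < e \<Longrightarrow> x(i := u) \<in> B"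
  using i by (auto simp: Rn_box_def Rn_upd)

lemma mono:
  assumes x: "x \<in> B" and u: "\<bar>u - a i\<bar> < e" "\<bar>w - a i\<bar> < e" "u < w"
  shows "s * \<phi> (x(i := u)) < s * \<phi> (x(i := w))"
proof (rule DERIV_pos_imp_increasing[OF u(3)])
  fix t assume "u \<le> t" "t \<le> w"
  then have xt: "x(i := t) \<in> B" using x u by (intro upd_in) auto
  have "((\<lambda>r. s * \<phi> (x(i := r))) has_real_derivative s * partial i \<phi> (x(i := t))) (at t)"
    using DERIV_cmult[OF has_partial[OF xt i, unfolded has_partial_def]] by simp
  then show "\<exists>y. ((\<lambda>r. s * \<phi> (x(i := r))) has_real_derivative y) (at t) \<and> 0 < y"
    using pos[OF xt] by blast
qed

text \<open>Points with the same image differ at most in coordinate i, hence lie on one segment,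
  where \<phi> is strictly monotone.\<close>

lemma inj: "inj_on \<Psi> B"
proof (rule inj_onI)
  fix x y assume xy: "x \<in> B" "y \<in> B" "\<Psi> x = \<Psi> y"
  have eq: "x(i := y i) = y" "\<phi> x = \<phi> y"
    using xy(3) by (auto simp: \<Psi>_def fun_eq_iff split: if_splits)
  have b: "\<bar>x i - a i\<bar> < e" "\<bar>y i - a i\<bar> < e" using xy i by (auto simp: Rn_box_def)
  have "x i = y i"
    using mono[OF xy(1) b] mono[OF xy(1) b(2,1)] eq by (cases "x i" "y i" rule: linorder_cases) auto
  then show "x = y" using eq(1) by (metis fun_upd_triv)
qed

text \<open>The intermediate value theorem on a short segment around \<open>x i\<close>. The strict
  inequalities at its ends are open conditions on y, so one segment works for all y near
  \<open>\<Psi> x\<close>. Openness of the image and continuity of the inverse both follow from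
  this.\<close>

lemma local_solution:
  assumes x: "x \<in> B" and \<delta>: "\<delta> > 0"
  shows "\<exists>\<eta>>0. \<forall>y\<in>Rn_box n (\<Psi> x) \<eta>. \<exists>r. \<bar>r - x i\<bar> < \<delta> \<and> y(i := r) \<in> B \<and> \<phi> (y(i := r)) = y i"
proof -
  have xi: "\<bar>x i - a i\<bar> < e" using x i by (auto simp: Rn_box_def)
  \<comment> \<open>Halving keeps both ends of the segment strictly inside the box and strictly
    within \<delta> of \<open>x i\<close>.\<close>
  define d where "d = min \<delta> (e - \<bar>x i - a i\<bar>) / 2"
  have d: "d > 0" "d < \<delta>" "d < e - \<bar>x i - a i\<bar>" using \<delta> xi by (auto simp: d_def min_def)
  define u w where "u = x i - d" and "w = x i + d"
  have uw: "\<bar>u - a i\<bar> < e" "\<bar>w - a i\<bar> < e" "u < x i" "x i < w" "u < w"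
    using d by (auto simp: u_def w_def)
  have c: "continuous_on S (\<lambda>y :: nat \<Rightarrow> real. y(i := v))" for S v
    by (intro continuous_on_upd continuous_on_id continuous_on_const)
  \<comment> \<open>On N0 both end points over y lie in the box, so that \<phi> at these points is
    continuous in y; N then imposes the two inequalities.\<close>
  define N0 where "N0 = {y \<in> {y \<in> Rn n. y(i := u) \<in> B}. y(i := w) \<in> B}"
  have N0: "openin (Rn_top n) N0" unfolding N0_def
    by (intro openin_preimage_Rn[where m = n] c openin_Rn_box) (use i in \<open>auto intro: Rn_upd\<close>)
  have c\<phi>: "continuous_on N0 (\<lambda>y. \<phi> (y(i := v)))" if "v = u \<or> v = w" for v
    by (rule continuous_on_compose2[OF smooth_Rn_continuous[OF smooth] c])
      (use that in \<open>auto simp: N0_def\<close>)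
  define N where "N = {y \<in> {y \<in> N0. s * y i - s * \<phi> (y(i := u)) \<in> {0<..}}.
      s * \<phi> (y(i := w)) - s * y i \<in> {0<..}}"
  have ci: "continuous_on S (\<lambda>y :: nat \<Rightarrow> real. y i)" for S
    by (intro continuous_on_coord continuous_on_id)
  have N1: "openin (Rn_top n) {y \<in> N0. s * y i - s * \<phi> (y(i := u)) \<in> {0<..}}"
    by (rule openin_preimage[OF N0])
      (auto intro!: continuous_on_diff continuous_on_mult continuous_on_const ci c\<phi>)
  have N: "openin (Rn_top n) N" unfolding N_def
    by (rule openin_preimage[OF N1])
      (auto intro!: continuous_on_diff continuous_on_mult continuous_on_const ci
        continuous_on_subset[OF c\<phi>])
  have "\<Psi> x \<in> N"
    using x uw mono[OF x uw(1) xi] mono[OF x xi uw(2)] i upd_in[OF x]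
    by (auto simp: N_def N0_def \<Psi>_def Rn_box_def intro: Rn_upd)
  then obtain \<eta> where \<eta>: "\<eta> > 0" "Rn_box n (\<Psi> x) \<eta> \<subseteq> N"
    using N by (auto simp: openin_Rn_iff)
  have "\<exists>r. \<bar>r - x i\<bar> < \<delta> \<and> y(i := r) \<in> B \<and> \<phi> (y(i := r)) = y i" if "y \<in> Rn_box n (\<Psi> x) \<eta>" for y
  proof -
    have y: "y(i := u) \<in> B" "s * \<phi> (y(i := u)) \<le> s * y i" "s * y i \<le> s * \<phi> (y(i := w))"
      using that \<eta> by (auto simp: N_def N0_def)
    have yr: "y(i := r) \<in> B" if "r \<in> {u..w}" for r
      using upd_in[OF y(1), of r] that uw by auto
    have "continuous_on {u..w} (\<lambda>r. s * \<phi> (y(i := r)))"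
      by (intro continuous_on_mult continuous_on_const
          continuous_on_compose2[OF smooth_Rn_continuous[OF smooth]] continuous_on_upd
          continuous_on_id) (use yr in auto)
    then obtain r where r: "u \<le> r" "r \<le> w" "s * \<phi> (y(i := r)) = s * y i"
      using IVT'[of "\<lambda>r. s * \<phi> (y(i := r))" u "s * y i" w] y uw by auto
    then show ?thesis using yr[of r] s d by (intro exI[of _ r]) (auto simp: u_def w_def)
  qed
  then show ?thesis using \<eta> by blast
qed

lemma \<Psi>_in_Rn: "x \<in> B \<Longrightarrow> \<Psi> x \<in> Rn n"
  using i by (auto simp: \<Psi>_def Rn_box_def intro: Rn_upd)

lemma \<Psi>_solution: "y(i := r) \<in> B \<Longrightarrow> \<phi> (y(i := r)) = y i \<Longrightarrow> \<Psi> (y(i := r)) = y"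
  by (auto simp: \<Psi>_def)

lemma G_\<Psi>: "x \<in> B \<Longrightarrow> G (\<Psi> x) = x i"
  by (simp add: G_def inj)

lemma upd_G: "x \<in> B \<Longrightarrow> (\<Psi> x)(i := G (\<Psi> x)) = x"
  by (simp add: G_\<Psi>) (simp add: \<Psi>_def)

lemma open_image: "openin (Rn_top n) (\<Psi> ` B)"
proof -
  have "\<exists>\<eta>>0. Rn_box n (\<Psi> x) \<eta> \<subseteq> \<Psi> ` B" if x: "x \<in> B" for x
  proof -
    from local_solution[OF x zero_less_one] obtain \<eta> where \<eta>: "\<eta> > 0"
      "\<forall>y\<in>Rn_box n (\<Psi> x) \<eta>. \<exists>r. \<bar>r - x i\<bar> < 1 \<and> y(i := r) \<in> B \<and> \<phi> (y(i := r)) = y i" by auto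
    have "y \<in> \<Psi> ` B" if "y \<in> Rn_box n (\<Psi> x) \<eta>" for y
    proof -
      from \<eta>(2) that obtain r where "y(i := r) \<in> B" "\<phi> (y(i := r)) = y i" by auto
      then show ?thesis using \<Psi>_solution[of y r] by (metis image_eqI)
    qed
    then show ?thesis using \<eta>(1) by auto
  qed
  then show ?thesis by (auto simp: openin_Rn_iff \<Psi>_in_Rn)
qed

text \<open>\<open>local_solution\<close> with \<delta> = \<epsilon> finds a preimage whose i-th
  coordinate is within \<epsilon> of \<open>x i\<close>; by injectivity it is the one that G
  picks.\<close>

lemma continuous_G: "continuous_on (\<Psi> ` B) G"
proof (rule continuous_on_bxI[where n = n])
  show "\<Psi> ` B \<subseteq> Rn n" by (auto simp: \<Psi>_in_Rn)
  fix y0 \<epsilon> assume "y0 \<in> \<Psi> ` B" "(0::real) < \<epsilon>"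
  then obtain x where x: "x \<in> B" "y0 = \<Psi> x" by auto
  from local_solution[OF x(1) \<open>0 < \<epsilon>\<close>] obtain \<eta> where \<eta>: "\<eta> > 0"
    "\<forall>y\<in>Rn_box n (\<Psi> x) \<eta>. \<exists>r. \<bar>r - x i\<bar> < \<epsilon> \<and> y(i := r) \<in> B \<and> \<phi> (y(i := r)) = y i" by auto
  have "\<bar>G y - G y0\<bar> < \<epsilon>" if y: "y \<in> Rn_box n (\<Psi> x) \<eta>" for y
  proof -
    from \<eta>(2) y obtain r where r: "\<bar>r - x i\<bar> < \<epsilon>" "y(i := r) \<in> B" "\<phi> (y(i := r)) = y i" by auto
    have "G y = r" using G_\<Psi>[OF r(2)] \<Psi>_solution[OF r(2,3)] by simp
    then show ?thesis using r(1) x G_\<Psi> by simp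
  qed
  then show "\<exists>\<eta>>0. \<forall>y\<in>\<Psi> ` B \<inter> Rn_box n y0 \<eta>. \<bar>G y - G y0\<bar> < \<epsilon>"
    using \<eta>(1) x(2) by auto
qed

lemma inverse_in: "y \<in> \<Psi> ` B \<Longrightarrow> y(i := G y) \<in> B"
  by (auto simp: upd_G)

lemma \<phi>_inverse: "y \<in> \<Psi> ` B \<Longrightarrow> \<phi> (y(i := G y)) = y i"
  by (auto simp: upd_G) (simp add: \<Psi>_def)

text \<open>Moving y in direction j moves the preimage in directions i and j only, so the expansion
  of \<phi> about x0 reduces to at most two terms and can be solved for the increment of G. The
  resulting quotient converges because G is continuous.\<close>

lemma has_partial_G:
  assumes y0: "y0 \<in> \<Psi> ` B" and j: "j < n"
  shows "has_partial j G ((if j = i then 1 else - partial j \<phi> (y0(i := G y0))) *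
    inverse (partial i \<phi> (y0(i := G y0)))) y0"
proof -
  define x0 where "x0 = y0(i := G y0)"
  have x0B: "x0 \<in> B" using inverse_in[OF y0] by (simp add: x0_def)
  then have x0n: "x0 \<in> Rn n" using Rn_box_subset_Rn by auto
  obtain e0 where e0: "e0 > 0" "Rn_box n x0 e0 \<subseteq> B"
    using openin_Rn_box[of n a e] x0B unfolding openin_Rn_iff by blast
  define h where "h l = hadamard_integral l x0 0 (partial l \<phi>)" for l
  have smooth0: "smooth_Rn n (Rn_box n x0 e0) \<phi>" by (rule smooth_Rn_subset[OF smooth e0(2)])
  have h: "continuous_on (Rn_box n x0 e0) (h l)" if "l < n" for l
    unfolding h_def
    by (intro smooth_Rn_continuous[OF smooth_Rn_hadamard_integral] smooth_Rn_partial openin_Rn_box smooth0 x0n that)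
  have h0: "h l x0 = partial l \<phi> x0" for l by (simp add: h_def hadamard_integral_center)
  have expand: "\<phi> x = \<phi> x0 + (\<Sum>l<n. (x l - x0 l) * h l x)" if "x \<in> Rn_box n x0 e0" for x
    unfolding h_def by (rule hadamard_expansion[OF _ x0n that]) (use smooth0 in \<open>simp add: smooth_Rn_def\<close>)
  define y where "y r = y0(j := r)" for r
  define x where "x r = (y r)(i := G (y r))" for r
  have y0': "y (y0 j) = y0" "x (y0 j) = x0" by (simp_all add: y_def x_def x0_def)
  have ev_y: "\<forall>\<^sub>F r in at (y0 j). y r \<in> \<Psi> ` B"
    using eventually_nhds_conv_at[THEN iffD1, OF eventually_upd_in[OF open_image y0 j], THEN conjunct1]
    by (simp add: y_def)
  have lim_y: "(y \<longlongrightarrow> y0) (at (y0 j))"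
  proof (rule tendsto_Rn[where m = n])
    show "\<forall>\<^sub>F r in at (y0 j). y r \<in> Rn n"
      using ev_y by eventually_elim (auto simp: \<Psi>_in_Rn)
    show "y0 \<in> Rn n" using y0 \<Psi>_in_Rn by auto
    show "((\<lambda>r. y r l) \<longlongrightarrow> y0 l) (at (y0 j))" for l
      by (cases "l = j") (auto simp: y_def)
  qed
  have lim_G: "((\<lambda>r. G (y r)) \<longlongrightarrow> G y0) (at (y0 j))"
    by (rule continuous_on_tendsto_compose[OF continuous_G lim_y y0 ev_y])
  have lim_x: "(x \<longlongrightarrow> x0) (at (y0 j))"
  proof (rule tendsto_Rn[where m = n])
    show "\<forall>\<^sub>F r in at (y0 j). x r \<in> Rn n"
      using ev_y by eventually_elim (simp add: x_def subsetD[OF Rn_box_subset_Rn inverse_in])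
    show "((\<lambda>r. x r l) \<longlongrightarrow> x0 l) (at (y0 j))" for l
    proof (cases "l = i")
      case False
      then show ?thesis by (cases "l = j") (auto simp: x_def y_def x0_def)
    qed (use lim_G in \<open>auto simp: x_def x0_def\<close>)
  qed (rule x0n)
  obtain T where T: "open T" "Rn_box n x0 e0 = Rn n \<inter> T"
    using openin_Rn_box[of n x0 e0] by (auto simp: openin_open)
  have "x0 \<in> T" using T(2) center_in_Rn_box[OF x0n e0(1)] by auto
  from topological_tendstoD[OF lim_x T(1) this] ev_y
  have ev_x: "\<forall>\<^sub>F r in at (y0 j). x r \<in> Rn_box n x0 e0"
  proof eventually_elim
    case (elim r)
    then have "x r \<in> Rn n" by (simp add: x_def subsetD[OF Rn_box_subset_Rn inverse_in])
    then show ?case using elim T(2) by auto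
  qed
  have lim_h: "((\<lambda>r. h l (x r)) \<longlongrightarrow> partial l \<phi> x0) (at (y0 j))" if "l < n" for l
    using continuous_on_tendsto_compose[OF h[OF that] lim_x center_in_Rn_box[OF x0n e0(1)] ev_x]
    by (simp add: h0)
  have nz: "partial i \<phi> x0 \<noteq> 0" using pos[OF x0B] by auto
  \<comment> \<open>The difference quotient of G, as solved from the expansion.\<close>
  define H where "H r = (if j = i then 1 else - h j (x r)) * inverse (h i (x r))" for r
  have lim_H: "(H \<longlongrightarrow> (if j = i then 1 else - partial j \<phi> x0) * inverse (partial i \<phi> x0)) (at (y0 j))"
    unfolding H_def[abs_def]
    by (intro tendsto_mult tendsto_inverse lim_h[OF i] nz)
      (use lim_h[OF j] in \<open>auto intro: tendsto_minus\<close>)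
  have "((\<lambda>r. G y0 + (r - y0 j) * H r) has_real_derivative
      0 + 1 * ((if j = i then 1 else - partial j \<phi> x0) * inverse (partial i \<phi> x0))) (at (y0 j))"
    by (intro DERIV_add DERIV_const DERIV_mult_zero lim_H) (auto intro!: derivative_eq_intros)
  moreover have "\<forall>\<^sub>F r in nhds (y0 j). G (y r) = G y0 + (r - y0 j) * H r"
    unfolding eventually_nhds_conv_at
  proof
    have "\<forall>\<^sub>F r in at (y0 j). h i (x r) \<noteq> 0"
      by (rule tendsto_imp_eventually_ne[OF lim_h[OF i] nz])
    with ev_x ev_y show "\<forall>\<^sub>F r in at (y0 j). G (y r) = G y0 + (r - y0 j) * H r"
    proof eventually_elim
      case (elim r)
      let ?g = "\<lambda>l. (x r l - x0 l) * h l (x r)"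
      have "y r i = y0 i + (\<Sum>l<n. ?g l)"
        using expand[OF elim(1)] \<phi>_inverse[OF elim(2)] \<phi>_inverse[OF y0]
        by (simp add: x_def x0_def)
      \<comment> \<open>The points \<open>x r\<close> and x0 agree in all other coordinates; for j =
        i the index set is a singleton.\<close>
      moreover have "(\<Sum>l<n. ?g l) = (\<Sum>l\<in>{i, j}. ?g l)"
        using i j by (intro sum.mono_neutral_right) (auto simp: x_def y_def x0_def)
      ultimately have *: "y r i = y0 i + (\<Sum>l\<in>{i, j}. ?g l)" by simp
      have xi: "x r i = G (y r)" "x0 i = G y0" by (simp_all add: x_def x0_def)
      show ?case
      proof (cases "j = i")
        case True
        then have "r = y0 j + (G (y r) - G y0) * h i (x r)"
          using * xi by (simp add: y_def)
        then show ?thesis using True elim(3) by (simp add: H_def field_simps)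
      next
        case False
        then have "0 = (G (y r) - G y0) * h i (x r) + (r - y0 j) * h j (x r)"
          using * xi by (simp add: x_def x0_def y_def)
        then have "G (y r) - G y0 = - ((r - y0 j) * h j (x r)) / h i (x r)"
          using elim(3) by (simp add: field_simps)
        then show ?thesis using False by (simp add: H_def divide_inverse)
      qed
    qed
  qed (simp add: y0')
  ultimately have "((\<lambda>r. G (y r)) has_real_derivative
      0 + 1 * ((if j = i then 1 else - partial j \<phi> x0) * inverse (partial i \<phi> x0))) (at (y0 j))"
    by (subst DERIV_cong_ev[OF refl _ refl])
  then show ?thesis
    by (simp only: has_partial_def y_def x0_def add_0 mult_1_left)
qed

text \<open>Bootstrap: the derivatives of G are smooth expressions in G and y, so class k for G
  gives class k + 1.\<close>

lemma Ck_G: "Ck k n (\<Psi> ` B) G"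
proof (induction k)
  case 0
  then show ?case by (simp add: continuous_G)
next
  case (Suc k)
  have cmp: "Ck k n (\<Psi> ` B) (\<lambda>y. partial j \<phi> (y(i := G y)))" if "j < n" for j
  proof (rule Ck_compose[where g = "partial j \<phi>" and F = "\<lambda>y. y(i := G y)", OF openin_Rn_box open_image])
    show "Ck k n B (partial j \<phi>)"
      using smooth_Rn_partial[OF openin_Rn_box smooth that] by (simp add: smooth_Rn_def)
    show "Ck k n (\<Psi> ` B) (\<lambda>y. (y(i := G y)) l)" for l
      using Suc by (cases "l = i") (simp_all add: Ck_coord)
  qed (simp_all add: inverse_in)
  let ?D = "\<lambda>j y. (if j = i then 1 else - partial j \<phi> (y(i := G y))) * inverse (partial i \<phi> (y(i := G y)))"
  show ?case
  proof (rule Ck_SucI[where D = ?D, OF continuous_G])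
    fix j assume j: "j < n"
    show "has_partial j G (?D j y) y" if "y \<in> \<Psi> ` B" for y
      by (rule has_partial_G[OF that j])
    have "Ck k n (\<Psi> ` B) (\<lambda>y. (-1) * partial j \<phi> (y(i := G y)))"
      by (intro Ck_mult Ck_const cmp j)
    then have "Ck k n (\<Psi> ` B) (\<lambda>y. if j = i then 1 else - partial j \<phi> (y(i := G y)))"
      by (cases "j = i") (simp_all add: Ck_const)
    moreover have "partial i \<phi> (y(i := G y)) \<noteq> 0" if "y \<in> \<Psi> ` B" for y
      using pos[OF inverse_in[OF that]] by auto
    ultimately show "Ck k n (\<Psi> ` B) (?D j)"
      by (intro Ck_mult Ck_inverse cmp i)
  qed
qed

end

lemma exchange_coordinate:
  assumes V: "openin (Rn_top n) V" and a: "a \<in> V" and \<phi>: "smooth_Rn n V \<phi>" and i: "i < n"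
    and nz: "partial i \<phi> a \<noteq> 0"
  obtains B G where "openin (Rn_top n) B" "a \<in> B" "B \<subseteq> V" "inj_on (\<lambda>x. x(i := \<phi> x)) B"
    "openin (Rn_top n) ((\<lambda>x. x(i := \<phi> x)) ` B)" "smooth_Rn n ((\<lambda>x. x(i := \<phi> x)) ` B) G"
    "\<And>x. x \<in> B \<Longrightarrow> G (x(i := \<phi> x)) = x i"
proof -
  \<comment> \<open>With this choice s times the derivative is a square at a, and it stays positive
    nearby by continuity.\<close>
  define s where "s = partial i \<phi> a"
  have "openin (Rn_top n) {x \<in> V. s * partial i \<phi> x \<in> {0<..}}"
    by (intro openin_preimage V continuous_on_mult continuous_on_const
        smooth_Rn_continuous[OF smooth_Rn_partial[OF V \<phi> i]]) auto
  moreover have "a \<in> {x \<in> V. s * partial i \<phi> x \<in> {0<..}}"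
    using a nz by (auto simp: s_def zero_less_mult_iff linorder_neq_iff)
  ultimately obtain e where e: "e > 0" "Rn_box n a e \<subseteq> {x \<in> V. s * partial i \<phi> x \<in> {0<..}}"
    unfolding openin_Rn_iff by blast
  have aR: "a \<in> Rn n" using V a by (auto simp: openin_Rn_iff)
  interpret exchange n i s a e \<phi>
    using i aR nz e smooth_Rn_subset[OF \<phi>] by unfold_locales (auto simp: s_def)
  show thesis
    using that[of B G, OF openin_Rn_box center_in_Rn_box[OF aR e(1)]] e inj open_image Ck_G G_\<Psi>
    by (auto simp: \<Psi>_def[abs_def] smooth_Rn_def)
qed

subsection \<open>Germs of smooth functions on a manifold\<close>

text \<open>The part of \<open>smooth_manifold\<close> that is followed through products,
  submanifolds and compositions. The two topological axioms reach translated bisubmersions by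
  homeomorphism.\<close>

definition smooth_atlas :: "'a smfd \<Rightarrow> bool" where
  "smooth_atlas X \<longleftrightarrow>
     (\<forall>(D, c) \<in> charts X. inj_on c D \<and> openin (Rn_top (mdim X)) (c ` D)) \<and>
     (\<forall>(D, c) \<in> charts X. \<forall>(E, e) \<in> charts X.
        openin (Rn_top (mdim X)) (c ` (D \<inter> E)) \<and>
        (\<forall>i < mdim X. smooth_Rn (mdim X) (c ` (D \<inter> E)) (\<lambda>y. e (inv_into D c y) i)))"

lemma smooth_manifold_iff: "smooth_manifold X \<longleftrightarrow>
    smooth_atlas X \<and> Hausdorff_space (mtop X) \<and> second_countable (mtop X)"
  by (auto simp: smooth_manifold_def smooth_atlas_def)

lemma smooth_manifold_atlas: "smooth_manifold X \<Longrightarrow> smooth_atlas X"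
  by (simp add: smooth_manifold_iff)

lemma
  assumes "smooth_atlas X" "(D, c) \<in> charts X"
  shows chart_inj: "inj_on c D"
    and chart_open: "openin (Rn_top (mdim X)) (c ` D)"
  using assms by (auto simp: smooth_atlas_def)

lemma
  assumes "smooth_atlas X" "(D, c) \<in> charts X" "(E, e) \<in> charts X"
  shows transition_open: "openin (Rn_top (mdim X)) (c ` (D \<inter> E))"
    and transition_smooth:
      "i < mdim X \<Longrightarrow> smooth_Rn (mdim X) (c ` (D \<inter> E)) (\<lambda>y. e (inv_into D c y) i)"
  using assms by (fastforce simp: smooth_atlas_def)+

lemma chart_in_Rn: "smooth_atlas X \<Longrightarrow> (D, c) \<in> charts X \<Longrightarrow> p \<in> D \<Longrightarrow> c p \<in> Rn (mdim X)"
  using openin_Rn_subset[OF chart_open] by blast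

lemma chart_inv: "smooth_atlas X \<Longrightarrow> (D, c) \<in> charts X \<Longrightarrow> p \<in> D \<Longrightarrow> inv_into D c (c p) = p"
  by (simp add: chart_inj inv_into_f_f)

lemma ptsE:
  assumes "p \<in> pts X" obtains D c where "(D, c) \<in> charts X" "p \<in> D"
  using assms by (auto simp: pts_def)

lemma ptsI: "(D, c) \<in> charts X \<Longrightarrow> p \<in> D \<Longrightarrow> p \<in> pts X"
  by (force simp: pts_def)

lemma openin_chart_preimage:
  "(D, c) \<in> charts X \<Longrightarrow> openin (Rn_top (mdim X)) V \<Longrightarrow> openin (mtop X) {p \<in> D. c p \<in> V}"
  unfolding mtop_def by (rule topology_generated_by_Basis) auto

lemma openin_chart_domain:
  assumes "smooth_atlas X" "(D, c) \<in> charts X"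
  shows "openin (mtop X) D"
proof -
  have "{p \<in> D. c p \<in> c ` D} = D" by auto
  then show ?thesis using openin_chart_preimage[OF assms(2) chart_open[OF assms]] by simp
qed

lemma topspace_mtop: "smooth_atlas X \<Longrightarrow> topspace (mtop X) = pts X"
proof
  show "topspace (mtop X) \<subseteq> pts X"
    by (auto simp: mtop_def topology_generated_by_topspace intro: ptsI)
  show "pts X \<subseteq> topspace (mtop X)" if "smooth_atlas X"
    using openin_subset[OF openin_chart_domain[OF that]] by (auto elim!: ptsE)
qed

lemma continuous_on_transition:
  assumes "smooth_atlas X" "(D, c) \<in> charts X" "(E, e) \<in> charts X"
  shows "continuous_on (c ` (D \<inter> E)) (\<lambda>y. e (inv_into D c y))"
proof (rule continuous_on_into_Rn)
  show "e (inv_into D c y) \<in> Rn (mdim X)" if "y \<in> c ` (D \<inter> E)" for y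
    using that chart_inv[OF assms(1,2)] chart_in_Rn[OF assms(1,3)] by auto
qed (rule smooth_Rn_continuous[OF transition_smooth[OF assms]])

text \<open>The topology is given by generators only. From left to right the proof is an induction
  on the generation: injectivity of charts handles intersections, continuity of the transition maps
  handles the generators. Conversely W is a union of chart preimages of its chart images.\<close>

lemma openin_mtop_iff:
  assumes X: "smooth_atlas X"
  shows "openin (mtop X) W \<longleftrightarrow>
    W \<subseteq> pts X \<and> (\<forall>(D, c) \<in> charts X. openin (Rn_top (mdim X)) (c ` (D \<inter> W)))"
proof
  assume "openin (mtop X) W"
  then have "generate_topology_on {{p \<in> D. c p \<in> V} | D c V. (D, c) \<in> charts X \<and>
      openin (Rn_top (mdim X)) V} W" (is "generate_topology_on ?S W")
    by (simp add: mtop_def openin_topology_generated_by_iff)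
  then have "openin (Rn_top (mdim X)) (c ` (D \<inter> W))" if dc: "(D, c) \<in> charts X" for D c
  proof (induction rule: generate_topology_on.induct)
    case Empty
    then show ?case by simp
  next
    case (Int a b)
    have "c ` (D \<inter> (a \<inter> b)) = c ` (D \<inter> a) \<inter> c ` (D \<inter> b)"
      using chart_inj[OF X dc] by (auto simp: inj_on_def)
    then show ?case using Int by auto
  next
    case (UN K)
    have "c ` (D \<inter> \<Union>K) = (\<Union>k\<in>K. c ` (D \<inter> k))" by auto
    then show ?case using UN by auto
  next
    case (Basis s)
    then obtain E e V where E: "(E, e) \<in> charts X" "openin (Rn_top (mdim X)) V"
      "s = {p \<in> E. e p \<in> V}" by auto
    have "c ` (D \<inter> s) = {y \<in> c ` (D \<inter> E). e (inv_into D c y) \<in> V}"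
      using chart_inv[OF X dc] E(3) by auto
    moreover have "e (inv_into D c y) \<in> Rn (mdim X)" if y: "y \<in> c ` (D \<inter> E)" for y
      using y chart_inv[OF X dc] chart_in_Rn[OF X E(1)] by auto
    ultimately show ?case
      using openin_preimage_Rn[OF transition_open[OF X dc E(1)]
          continuous_on_transition[OF X dc E(1)] E(2)] by simp
  qed
  moreover have "W \<subseteq> pts X"
    using openin_subset[OF \<open>openin (mtop X) W\<close>] topspace_mtop[OF X] by simp
  ultimately show "W \<subseteq> pts X \<and> (\<forall>(D, c) \<in> charts X. openin (Rn_top (mdim X)) (c ` (D \<inter> W)))"
    by auto
next
  assume R: "W \<subseteq> pts X \<and> (\<forall>(D, c) \<in> charts X. openin (Rn_top (mdim X)) (c ` (D \<inter> W)))"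
  show "openin (mtop X) W"
  proof (subst openin_subopen, intro ballI)
    fix p assume p: "p \<in> W"
    with R have "p \<in> pts X" by blast
    then obtain D c where D: "(D, c) \<in> charts X" "p \<in> D" by (rule ptsE)
    have "openin (mtop X) {q \<in> D. c q \<in> c ` (D \<inter> W)}"
      using R D by (intro openin_chart_preimage) auto
    moreover have "{q \<in> D. c q \<in> c ` (D \<inter> W)} \<subseteq> W"
      using chart_inj[OF X D(1)] by (auto simp: inj_on_def)
    ultimately show "\<exists>T. openin (mtop X) T \<and> p \<in> T \<and> T \<subseteq> W"
      using p D by (intro exI[of _ "{q \<in> D. c q \<in> c ` (D \<inter> W)}"]) auto
  qed
qed

lemma openin_chart_image:
  "smooth_atlas X \<Longrightarrow> (D, c) \<in> charts X \<Longrightarrow> openin (mtop X) W \<Longrightarrow>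
    openin (Rn_top (mdim X)) (c ` (D \<inter> W))"
  by (auto simp: openin_mtop_iff)

lemma openin_mtop_subset: "smooth_atlas X \<Longrightarrow> openin (mtop X) W \<Longrightarrow> W \<subseteq> pts X"
  by (simp add: openin_mtop_iff)

lemma openin_pts: "smooth_atlas X \<Longrightarrow> openin (mtop X) (pts X)"
  by (metis openin_topspace topspace_mtop)

lemma smooth_near_iff: "f \<in> smooth_near X p \<longleftrightarrow> (\<exists>W. p \<in> W \<and> smooth_fun X W f)"
  by (simp add: smooth_near_def)

text \<open>One chart decides, because the transition maps carry smoothness to every other
  chart.\<close>

lemma smooth_near_chart:
  assumes X: "smooth_atlas X" and D: "(D, c) \<in> charts X" and p: "p \<in> D"
  shows "f \<in> smooth_near X p \<longleftrightarrow> (\<exists>V. openin (Rn_top (mdim X)) V \<and> c p \<in> V \<and> V \<subseteq> c ` D \<and>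
    smooth_Rn (mdim X) V (\<lambda>y. f (inv_into D c y)))"
proof
  assume "f \<in> smooth_near X p"
  then obtain W where W: "p \<in> W" "openin (mtop X) W"
    "smooth_Rn (mdim X) (c ` (D \<inter> W)) (\<lambda>y. f (inv_into D c y))"
    using D by (auto simp: smooth_near_iff smooth_fun_def)
  then show "\<exists>V. openin (Rn_top (mdim X)) V \<and> c p \<in> V \<and> V \<subseteq> c ` D \<and>
    smooth_Rn (mdim X) V (\<lambda>y. f (inv_into D c y))"
    using openin_chart_image[OF X D W(2)] p by (intro exI[of _ "c ` (D \<inter> W)"]) auto
next
  assume "\<exists>V. openin (Rn_top (mdim X)) V \<and> c p \<in> V \<and> V \<subseteq> c ` D \<and>
    smooth_Rn (mdim X) V (\<lambda>y. f (inv_into D c y))"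
  then obtain V where V: "openin (Rn_top (mdim X)) V" "c p \<in> V" "V \<subseteq> c ` D"
    "smooth_Rn (mdim X) V (\<lambda>y. f (inv_into D c y))" by auto
  let ?W = "{q \<in> D. c q \<in> V}"
  have W: "openin (mtop X) ?W" by (rule openin_chart_preimage[OF D V(1)])
  have "smooth_Rn (mdim X) (e ` (E \<inter> ?W)) (\<lambda>y. f (inv_into E e y))" if E: "(E, e) \<in> charts X" for E e
  proof -
    have o: "openin (Rn_top (mdim X)) (e ` (E \<inter> ?W))" by (rule openin_chart_image[OF X E W])
    let ?F = "\<lambda>y. c (inv_into E e y)"
    have eq: "inv_into E e y \<in> E \<inter> ?W" if "y \<in> e ` (E \<inter> ?W)" for y
      using that chart_inv[OF X E] by auto
    have "smooth_Rn (mdim X) (e ` (E \<inter> ?W)) (\<lambda>y. f (inv_into D c (?F y)))"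
      by (rule smooth_Rn_compose[where g = "\<lambda>y. f (inv_into D c y)" and F = ?F, OF V(1) o V(4)
            smooth_Rn_subset[OF transition_smooth[OF X E D]]]) (use eq in auto)
    then show ?thesis
      using eq chart_inv[OF X D] by (subst smooth_Rn_cong[OF o]) auto
  qed
  then have "smooth_fun X ?W f" using W by (auto simp: smooth_fun_def)
  then show "f \<in> smooth_near X p"
    using V p unfolding smooth_near_iff by (intro exI[of _ ?W]) simp
qed

lemma smooth_near_pts: "smooth_atlas X \<Longrightarrow> f \<in> smooth_near X p \<Longrightarrow> p \<in> pts X"
  by (auto simp: smooth_near_iff smooth_fun_def openin_mtop_iff)

lemma smooth_fun_iff_near:
  assumes X: "smooth_atlas X"
  shows "smooth_fun X W f \<longleftrightarrow> openin (mtop X) W \<and> (\<forall>p\<in>W. f \<in> smooth_near X p)"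
proof
  assume "smooth_fun X W f"
  then show "openin (mtop X) W \<and> (\<forall>p\<in>W. f \<in> smooth_near X p)"
    by (auto simp: smooth_near_iff smooth_fun_def)
next
  assume R: "openin (mtop X) W \<and> (\<forall>p\<in>W. f \<in> smooth_near X p)"
  have "smooth_Rn (mdim X) (c ` (D \<inter> W)) (\<lambda>y. f (inv_into D c y))" if D: "(D, c) \<in> charts X" for D c
  proof (rule smooth_Rn_local)
    show "openin (Rn_top (mdim X)) (c ` (D \<inter> W))" using openin_chart_image[OF X D] R by simp
    fix y assume "y \<in> c ` (D \<inter> W)"
    then obtain p where p: "p \<in> D" "p \<in> W" "y = c p" by auto
    then have "f \<in> smooth_near X p" using R by blast
    then show "\<exists>W. openin (Rn_top (mdim X)) W \<and> y \<in> W \<and>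
        smooth_Rn (mdim X) W (\<lambda>y. f (inv_into D c y))"
      unfolding p(3) smooth_near_chart[OF X D p(1)] by blast
  qed
  then show "smooth_fun X W f" using R by (auto simp: smooth_fun_def)
qed

lemma smooth_near_open:
  assumes "smooth_atlas X" "f \<in> smooth_near X p"
  obtains W where "openin (mtop X) W" "p \<in> W" "\<And>q. q \<in> W \<Longrightarrow> f \<in> smooth_near X q"
proof -
  from assms(2) obtain W where "p \<in> W" "smooth_fun X W f" by (auto simp: smooth_near_def)
  then show thesis using that[of W] unfolding smooth_fun_iff_near[OF assms(1)] by blast
qed

lemma smooth_near_cong_imp:
  assumes X: "smooth_atlas X" and W: "openin (mtop X) W" "p \<in> W" "\<And>q. q \<in> W \<Longrightarrow> f q = g q"
    and f: "f \<in> smooth_near X p"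
  shows "g \<in> smooth_near X p"
proof -
  obtain D c where D: "(D, c) \<in> charts X" "p \<in> D"
    using smooth_near_pts[OF X f] by (rule ptsE)
  obtain V where V: "openin (Rn_top (mdim X)) V" "c p \<in> V" "V \<subseteq> c ` D"
    "smooth_Rn (mdim X) V (\<lambda>y. f (inv_into D c y))"
    using f smooth_near_chart[OF X D] by auto
  let ?V = "V \<inter> c ` (D \<inter> W)"
  have V': "openin (Rn_top (mdim X)) ?V"
    using V(1) openin_chart_image[OF X D(1) W(1)] by auto
  have "smooth_Rn (mdim X) ?V (\<lambda>y. f (inv_into D c y))"
    using smooth_Rn_subset[OF V(4)] by auto
  then have "smooth_Rn (mdim X) ?V (\<lambda>y. g (inv_into D c y))"
    by (subst (asm) smooth_Rn_cong[OF V', where g = "\<lambda>y. g (inv_into D c y)"])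
      (use chart_inv[OF X D(1)] W(3) in auto)
  then show ?thesis
    using V' V W(2) D(2) by (subst smooth_near_chart[OF X D]) (intro exI[of _ ?V], auto)
qed

lemma smooth_near_cong:
  assumes "smooth_atlas X" "openin (mtop X) W" "p \<in> W" "\<And>q. q \<in> W \<Longrightarrow> f q = g q"
  shows "f \<in> smooth_near X p \<longleftrightarrow> g \<in> smooth_near X p"
  using smooth_near_cong_imp[OF assms(1-3), of f g] smooth_near_cong_imp[OF assms(1-3), of g f]
    assms(4) by auto

text \<open>The composition rule behind most smoothness proofs below. The coordinates of u are
  smooth on finitely many neighbourhoods, and the chain rule applies on their intersection.\<close>

lemma smooth_near_compose:
  assumes X: "smooth_atlas X" and W: "openin (mtop X) W" "p \<in> W" "\<And>q. q \<in> W \<Longrightarrow> u q \<in> Rn m"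
    and u: "\<And>i. i < m \<Longrightarrow> (\<lambda>q. u q i) \<in> smooth_near X p"
    and V: "openin (Rn_top m) V" "u p \<in> V" "smooth_Rn m V g"
  shows "(\<lambda>q. g (u q)) \<in> smooth_near X p"
proof -
  have "p \<in> pts X" using openin_mtop_subset[OF X W(1)] W(2) by blast
  then obtain D c where D: "(D, c) \<in> charts X" "p \<in> D" by (rule ptsE)
  let ?n = "mdim X"
  have "\<forall>i\<in>{..<m}. \<exists>V. openin (Rn_top ?n) V \<and> c p \<in> V \<and> V \<subseteq> c ` D \<and>
      smooth_Rn ?n V (\<lambda>y. u (inv_into D c y) i)"
    using u smooth_near_chart[OF X D] by auto
  then obtain N where N: "\<And>i. i < m \<Longrightarrow> openin (Rn_top ?n) (N i) \<and> c p \<in> N i \<and> N i \<subseteq> c ` D \<and>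
      smooth_Rn ?n (N i) (\<lambda>y. u (inv_into D c y) i)"
    by (auto dest!: bchoice)
  define N0 where "N0 = \<Inter>(insert (c ` (D \<inter> W)) (N ` {..<m}))"
  have N0: "openin (Rn_top ?n) N0" unfolding N0_def
    using N openin_chart_image[OF X D(1) W(1)] by (intro openin_Inter) auto
  have inW: "inv_into D c y \<in> W \<inter> D" "c (inv_into D c y) = y" if "y \<in> N0" for y
    using that chart_inv[OF X D(1)] by (auto simp: N0_def)
  let ?F = "\<lambda>y. u (inv_into D c y)"
  have F: "smooth_Rn ?n N0 (\<lambda>y. ?F y i)" if "i < m" for i
    using N[OF that] that by (auto simp: N0_def intro: smooth_Rn_subset)
  have FR: "?F y \<in> Rn m" if "y \<in> N0" for y
    using inW[OF that] W(3) by auto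
  define N1 where "N1 = {y \<in> N0. ?F y \<in> V}"
  have "continuous_on N0 ?F"
    using FR smooth_Rn_continuous[OF F] by (rule continuous_on_into_Rn)
  from openin_preimage_Rn[OF N0 this V(1) FR] have N1: "openin (Rn_top ?n) N1"
    by (simp add: N1_def)
  have "smooth_Rn ?n N1 (\<lambda>y. g (?F y))"
    by (rule smooth_Rn_compose[where g = g and F = ?F, OF V(1) N1 V(3)])
      (auto simp: N1_def intro: smooth_Rn_subset[OF F])
  moreover have "c p \<in> N0" using N D(2) W(2) by (auto simp: N0_def)
  moreover have "N1 \<subseteq> c ` D" by (auto simp: N1_def N0_def)
  ultimately show ?thesis
    using N1 V(2) chart_inv[OF X D]
    by (subst smooth_near_chart[OF X D]) (auto simp: N1_def intro!: exI[of _ N1])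
qed

lemma smooth_near_const:
  assumes X: "smooth_atlas X" and p: "p \<in> pts X"
  shows "(\<lambda>q. c) \<in> smooth_near X p"
proof -
  obtain D e where D: "(D, e) \<in> charts X" "p \<in> D" using p by (rule ptsE)
  show ?thesis using chart_open[OF X D(1)] D(2)
    by (subst smooth_near_chart[OF X D]) (auto intro!: exI[of _ "e ` D"] smooth_Rn_const)
qed

lemma smooth_near_binop:
  assumes X: "smooth_atlas X" and f: "f \<in> smooth_near X p" "g \<in> smooth_near X p"
    and op: "smooth_Rn 2 (Rn 2) (\<lambda>x. h (x 0) (x 1))"
  shows "(\<lambda>q. h (f q) (g q)) \<in> smooth_near X p"
proof -
  \<comment> \<open>The pair (f, g) as a point of \<open>Rn 2\<close>, where all coordinates from 2
    on have to be 0.\<close>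
  let ?u = "\<lambda>q i. if i = 0 then f q else if i = Suc 0 then g q else 0"
  have "(\<lambda>q. h (?u q 0) (?u q 1)) \<in> smooth_near X p"
  proof (rule smooth_near_compose[where g = "\<lambda>x. h (x 0) (x 1)" and u = ?u,
        OF X openin_pts[OF X] smooth_near_pts[OF X f(1)] _ _ _ _ op])
    show "(\<lambda>q. ?u q i) \<in> smooth_near X p" if "i < 2" for i
      using that f by (cases "i = 0") auto
  qed (auto simp: Rn_def)
  then show ?thesis by simp
qed

lemma smooth_near_add:
  "smooth_atlas X \<Longrightarrow> f \<in> smooth_near X p \<Longrightarrow> g \<in> smooth_near X p \<Longrightarrow>
    (\<lambda>q. f q + g q) \<in> smooth_near X p"
  by (rule smooth_near_binop[where h = "(+)"]) (auto intro: smooth_Rn_add smooth_Rn_coord)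

lemma smooth_near_mult:
  "smooth_atlas X \<Longrightarrow> f \<in> smooth_near X p \<Longrightarrow> g \<in> smooth_near X p \<Longrightarrow>
    (\<lambda>q. f q * g q) \<in> smooth_near X p"
  by (rule smooth_near_binop[where h = "(*)"]) (auto intro: smooth_Rn_mult smooth_Rn_coord)

lemma smooth_near_sum:
  assumes "smooth_atlas X" "p \<in> pts X" "\<And>j. j \<in> J \<Longrightarrow> f j \<in> smooth_near X p"
  shows "(\<lambda>q. \<Sum>j\<in>J. f j q) \<in> smooth_near X p"
  using assms(3)
  by (induction J rule: infinite_finite_induct)
    (auto intro: smooth_near_const smooth_near_add assms(1,2))

lemma smooth_near_continuous:
  assumes X: "smooth_atlas X" and f: "f \<in> smooth_near X p" and T: "open T" "f p \<in> T"
  obtains W where "openin (mtop X) W" "p \<in> W" "\<And>q. q \<in> W \<Longrightarrow> f q \<in> T"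
proof -
  obtain D c where D: "(D, c) \<in> charts X" "p \<in> D"
    using smooth_near_pts[OF X f] by (rule ptsE)
  obtain V where V: "openin (Rn_top (mdim X)) V" "c p \<in> V" "V \<subseteq> c ` D"
    "smooth_Rn (mdim X) V (\<lambda>y. f (inv_into D c y))"
    using f smooth_near_chart[OF X D] by auto
  have "openin (Rn_top (mdim X)) {y \<in> V. f (inv_into D c y) \<in> T}"
    by (rule openin_preimage[OF V(1) smooth_Rn_continuous[OF V(4)] T(1)])
  from openin_chart_preimage[OF D(1) this] show thesis
  proof (rule that)
    show "p \<in> {q \<in> D. c q \<in> {y \<in> V. f (inv_into D c y) \<in> T}}"
      using V(2) D(2) T(2) chart_inv[OF X D] by simp
    show "f q \<in> T" if "q \<in> {q \<in> D. c q \<in> {y \<in> V. f (inv_into D c y) \<in> T}}" for q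
      using that chart_inv[OF X D(1)] by auto
  qed
qed

section \<open>Smoothness of a map at a point\<close>

text \<open>Smoothness as for morphisms of ringed spaces: germs pull back to germs. Without charts
  in the definition, composition is immediate and a change of domain or codomain comes down to a
  comparison of germs.\<close>

definition smooth_at :: "'a smfd \<Rightarrow> 'b smfd \<Rightarrow> ('a \<Rightarrow> 'b) \<Rightarrow> 'a \<Rightarrow> bool" where
  "smooth_at X Y f p \<longleftrightarrow> p \<in> pts X \<and> f p \<in> pts Y \<and>
     (\<forall>\<phi> \<in> smooth_near Y (f p). (\<lambda>q. \<phi> (f q)) \<in> smooth_near X p)"

lemma sm_atD: "smooth_at X Y f p \<Longrightarrow> \<phi> \<in> smooth_near Y (f p) \<Longrightarrow> (\<lambda>q. \<phi> (f q)) \<in> smooth_near X p"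
  by (simp add: smooth_at_def)

lemma smooth_at_pts: "smooth_at X Y f p \<Longrightarrow> p \<in> pts X" "smooth_at X Y f p \<Longrightarrow> f p \<in> pts Y"
  by (simp_all add: smooth_at_def)

lemma smooth_at_compose: "smooth_at X Y f p \<Longrightarrow> smooth_at Y Z g (f p) \<Longrightarrow> smooth_at X Z (\<lambda>q. g (f q)) p"
  by (auto simp: smooth_at_def)

lemma smooth_at_id: "p \<in> pts X \<Longrightarrow> smooth_at X X (\<lambda>q. q) p"
  by (simp add: smooth_at_def)

lemma smooth_at_const: "smooth_atlas X \<Longrightarrow> p \<in> pts X \<Longrightarrow> y \<in> pts Y \<Longrightarrow> smooth_at X Y (\<lambda>q. y) p"
  by (simp add: smooth_at_def smooth_near_const)

lemma smooth_at_cong: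
  assumes X: "smooth_atlas X" and W: "openin (mtop X) W" "p \<in> W" "\<And>q. q \<in> W \<Longrightarrow> f q = g q"
    and f: "smooth_at X Y f p"
  shows "smooth_at X Y g p"
proof -
  have "f p = g p" using W by auto
  moreover have "(\<lambda>q. \<phi> (g q)) \<in> smooth_near X p" if "\<phi> \<in> smooth_near Y (f p)" for \<phi>
    using smooth_near_cong[OF X W(1,2), of "\<lambda>q. \<phi> (f q)" "\<lambda>q. \<phi> (g q)"] sm_atD[OF f that] W(3)
    by auto
  ultimately show ?thesis using f by (auto simp: smooth_at_def)
qed

text \<open>The indicator function of an open set is smooth on it, so pulling back germs of smooth
  functions to germs of smooth functions already forces continuity.\<close>

lemma smooth_at_openin:
  assumes X: "smooth_atlas X" and Y: "smooth_atlas Y" and f: "smooth_at X Y f p"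
    and Q: "openin (mtop Y) Q" "f p \<in> Q"
  obtains W where "openin (mtop X) W" "p \<in> W" "f ` W \<subseteq> Q"
proof -
  let ?\<phi> = "\<lambda>y. if y \<in> Q then 1 else 0 :: real"
  have "?\<phi> \<in> smooth_near Y (f p)"
    by (rule smooth_near_cong_imp[OF Y Q _ smooth_near_const[OF Y, of _ 1]])
      (use smooth_at_pts[OF f] in auto)
  from sm_atD[OF f this] obtain W where W: "openin (mtop X) W" "p \<in> W"
    "\<And>q. q \<in> W \<Longrightarrow> ?\<phi> (f q) \<in> {1/2<..}"
    by (rule smooth_near_continuous[OF X, where T = "{1/2<..}"]) (use Q in auto)
  show thesis
  proof (rule that[OF W(1,2)])
    show "f ` W \<subseteq> Q" using W(3) by (fastforce split: if_splits)
  qed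
qed

lemma openin_sm_preimage:
  assumes X: "smooth_atlas X" and Y: "smooth_atlas Y" and W: "openin (mtop X) W"
    and f: "\<And>p. p \<in> W \<Longrightarrow> smooth_at X Y f p" and Q: "openin (mtop Y) Q"
  shows "openin (mtop X) {p \<in> W. f p \<in> Q}"
proof (subst openin_subopen, intro ballI)
  fix p assume "p \<in> {p \<in> W. f p \<in> Q}"
  then have p: "p \<in> W" "f p \<in> Q" by auto
  obtain W' where W': "openin (mtop X) W'" "p \<in> W'" "f ` W' \<subseteq> Q"
    by (rule smooth_at_openin[OF X Y f[OF p(1)] Q p(2)])
  then show "\<exists>T. openin (mtop X) T \<and> p \<in> T \<and> T \<subseteq> {p \<in> W. f p \<in> Q}"
    using p W by (intro exI[of _ "W \<inter> W'"]) auto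
qed

lemma chart_coord_smooth:
  assumes X: "smooth_atlas X" and D: "(D, c) \<in> charts X" "p \<in> D"
  shows "(\<lambda>q. c q i) \<in> smooth_near X p"
proof -
  have "smooth_Rn (mdim X) (c ` D) (\<lambda>y. c (inv_into D c y) i)"
    by (subst smooth_Rn_cong[OF chart_open[OF X D(1)], where g = "\<lambda>y. y i"])
      (auto simp: chart_inv[OF X D(1)] intro: smooth_Rn_coord)
  then show ?thesis
    using chart_open[OF X D(1)] D(2) by (subst smooth_near_chart[OF X D]) auto
qed

text \<open>The coordinates of f decide, since every smooth germ on Y is a smooth function of the
  coordinates e.\<close>

lemma smooth_at_chartI:
  assumes X: "smooth_atlas X" and Y: "smooth_atlas Y" and E: "(E, e) \<in> charts Y"
    and W: "openin (mtop X) W" "p \<in> W" "f ` W \<subseteq> E"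
    and c: "\<And>i. i < mdim Y \<Longrightarrow> (\<lambda>q. e (f q) i) \<in> smooth_near X p"
  shows "smooth_at X Y f p"
  unfolding smooth_at_def
proof (intro conjI ballI)
  have fp: "f p \<in> E" using W by auto
  show "p \<in> pts X" using W openin_mtop_subset[OF X] by auto
  show "f p \<in> pts Y" by (rule ptsI[OF E fp])
  fix \<phi> assume "\<phi> \<in> smooth_near Y (f p)"
  then obtain V where V: "openin (Rn_top (mdim Y)) V" "e (f p) \<in> V"
    "smooth_Rn (mdim Y) V (\<lambda>y. \<phi> (inv_into E e y))"
    using smooth_near_chart[OF Y E fp] by auto
  have "(\<lambda>q. \<phi> (inv_into E e (e (f q)))) \<in> smooth_near X p"
    by (rule smooth_near_compose[where u = "\<lambda>q. e (f q)" and g = "\<lambda>y. \<phi> (inv_into E e y)",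
          OF X W(1,2) _ c V]) (use W(3) chart_in_Rn[OF Y E] in auto)
  then show "(\<lambda>q. \<phi> (f q)) \<in> smooth_near X p"
    by (rule smooth_near_cong_imp[OF X W(1,2), rotated]) (use W(3) chart_inv[OF Y E] in auto)
qed

lemma smooth_map_iff:
  assumes X: "smooth_atlas X" and Y: "smooth_atlas Y"
  shows "smooth_map X Y f \<longleftrightarrow> (\<forall>p \<in> pts X. smooth_at X Y f p)"
proof
  assume f: "smooth_map X Y f"
  then have cont: "continuous_map (mtop X) (mtop Y) f" by (simp add: smooth_map_def)
  show "\<forall>p \<in> pts X. smooth_at X Y f p"
  proof
    fix p assume p: "p \<in> pts X"
    then have "f p \<in> pts Y"
      using cont topspace_mtop[OF X] topspace_mtop[OF Y] by (auto simp: continuous_map_def)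
    then obtain E e where E: "(E, e) \<in> charts Y" "f p \<in> E" by (rule ptsE)
    have W: "smooth_fun X {p \<in> pts X. f p \<in> E} (\<lambda>p. e (f p) i)" if "i < mdim Y" for i
      using f E(1) that by (auto simp: smooth_map_def)
    have o: "openin (mtop X) {p \<in> pts X. f p \<in> E}"
      using openin_continuous_map_preimage[OF cont openin_chart_domain[OF Y E(1)]]
      by (simp add: topspace_mtop[OF X])
    show "smooth_at X Y f p"
      by (rule smooth_at_chartI[OF X Y E(1) o])
        (use W p E in \<open>auto simp: smooth_fun_iff_near[OF X]\<close>)
  qed
next
  assume f: "\<forall>p \<in> pts X. smooth_at X Y f p"
  then have sm: "\<And>p. p \<in> pts X \<Longrightarrow> smooth_at X Y f p" by auto
  have o: "openin (mtop X) {p \<in> pts X. f p \<in> U}" if "openin (mtop Y) U" for U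
    by (rule openin_sm_preimage[OF X Y openin_pts[OF X] sm that])
  then have "continuous_map (mtop X) (mtop Y) f"
    using smooth_at_pts(2)[OF sm] by (auto simp: continuous_map_def topspace_mtop X Y)
  moreover have "smooth_fun X {p \<in> pts X. f p \<in> E} (\<lambda>p. e (f p) i)" if "(E, e) \<in> charts Y" for E e i
    using o[OF openin_chart_domain[OF Y that]] sm_atD[OF sm chart_coord_smooth[OF Y that]]
    by (simp add: smooth_fun_iff_near[OF X])
  ultimately show "smooth_map X Y f" by (auto simp: smooth_map_def)
qed

subsection \<open>Open submanifolds, images and products\<close>

lemma smooth_atlasI:
  assumes "\<And>D c. (D, c) \<in> charts X \<Longrightarrow> inj_on c D"
    and "\<And>D c. (D, c) \<in> charts X \<Longrightarrow> openin (Rn_top (mdim X)) (c ` D)"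
    and "\<And>D c E e. (D, c) \<in> charts X \<Longrightarrow> (E, e) \<in> charts X \<Longrightarrow>
      openin (Rn_top (mdim X)) (c ` (D \<inter> E))"
    and "\<And>D c E e i. (D, c) \<in> charts X \<Longrightarrow> (E, e) \<in> charts X \<Longrightarrow> i < mdim X \<Longrightarrow>
      smooth_Rn (mdim X) (c ` (D \<inter> E)) (\<lambda>y. e (inv_into D c y) i)"
  shows "smooth_atlas X"
  using assms by (auto simp: smooth_atlas_def)

lemma chart_subset_pts: "(D, c) \<in> charts X \<Longrightarrow> D \<subseteq> pts X"
  by (force simp: pts_def)

lemma inv_into_restrict: "inj_on c D \<Longrightarrow> y \<in> c ` (D \<inter> W) \<Longrightarrow> inv_into (D \<inter> W) c y = inv_into D c y"
  by (auto simp: inj_on_Int)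

lemma mdim_euclidean_mfd [simp]: "mdim (euclidean_mfd n) = n"
  and charts_euclidean_mfd: "charts (euclidean_mfd n) = {(Rn n, \<lambda>x. x)}"
  by (simp_all add: euclidean_mfd_def)

lemma inv_into_Rn: "y \<in> Rn n \<Longrightarrow> inv_into (Rn n) (\<lambda>x. x) y = y"
  using inv_into_f_f[of "\<lambda>x. x" "Rn n" y] by simp

lemma openin_Rn: "openin (Rn_top n) (Rn n)"
  by (metis openin_subtopology_self)

lemma smooth_atlas_euclidean: "smooth_atlas (euclidean_mfd n)"
proof (rule smooth_atlasI)
  fix D E :: "(nat \<Rightarrow> real) set" and c e :: "(nat \<Rightarrow> real) \<Rightarrow> nat \<Rightarrow> real" and i
  assume "(D, c) \<in> charts (euclidean_mfd n)" "(E, e) \<in> charts (euclidean_mfd n)"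
  then have eq: "D = Rn n" "E = Rn n" "c = (\<lambda>x. x)" "e = (\<lambda>x. x)"
    by (auto simp: charts_euclidean_mfd)
  show "openin (Rn_top (mdim (euclidean_mfd n))) (c ` (D \<inter> E))"
    by (simp add: eq openin_Rn)
  show "smooth_Rn (mdim (euclidean_mfd n)) (c ` (D \<inter> E)) (\<lambda>y. e (inv_into D c y) i)"
    unfolding eq by (subst smooth_Rn_cong[where g = "\<lambda>y. y i"])
      (simp_all add: openin_Rn inv_into_Rn smooth_Rn_coord)
qed (auto simp: charts_euclidean_mfd openin_Rn)

lemma pts_euclidean_mfd: "pts (euclidean_mfd n) = Rn n"
  by (simp add: pts_def charts_euclidean_mfd)

lemma smooth_near_euclidean:
  assumes "x \<in> Rn n"
  shows "f \<in> smooth_near (euclidean_mfd n) x \<longleftrightarrow>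
    (\<exists>V. openin (Rn_top n) V \<and> x \<in> V \<and> smooth_Rn n V f)"
proof -
  have "(Rn n, \<lambda>x. x) \<in> charts (euclidean_mfd n)" by (simp add: charts_euclidean_mfd)
  note * = smooth_near_chart[OF smooth_atlas_euclidean this assms, of f]
  have "smooth_Rn n V (\<lambda>y. f (inv_into (Rn n) (\<lambda>x. x) y)) \<longleftrightarrow> smooth_Rn n V f"
    if "openin (Rn_top n) V" for V
    using that openin_Rn_subset[OF that] by (intro smooth_Rn_cong) (auto simp: inv_into_Rn)
  then show ?thesis unfolding * using openin_Rn_subset[of n] by auto
qed

lemma openin_mtop_euclidean: "openin (mtop (euclidean_mfd n)) W \<longleftrightarrow> openin (Rn_top n) W"
  unfolding openin_mtop_iff[OF smooth_atlas_euclidean]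
  using openin_Rn_subset[of n W]
  by (auto simp: charts_euclidean_mfd pts_euclidean_mfd Int_absorb1)

section \<open>Open submanifolds\<close>

lemma mdim_open_mfd [simp]: "mdim (open_mfd X W) = mdim X"
  by (simp add: open_mfd_def)

lemma charts_open_mfdE:
  assumes "(D, c) \<in> charts (open_mfd X W)"
  obtains D' where "(D', c) \<in> charts X" "D = D' \<inter> W"
  using assms by (auto simp: open_mfd_def)

lemma charts_open_mfdI: "(D, c) \<in> charts X \<Longrightarrow> (D \<inter> W, c) \<in> charts (open_mfd X W)"
  by (force simp: open_mfd_def)

lemma smooth_atlas_open_mfd:
  assumes X: "smooth_atlas X" and W: "openin (mtop X) W"
  shows "smooth_atlas (open_mfd X W)"
proof -
  have o: "openin (Rn_top (mdim X)) (c ` (D \<inter> W \<inter> (E \<inter> W)))"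
    if "(D, c) \<in> charts X" "(E, e) \<in> charts X" for D c E e
    using openin_chart_image[OF X that(1), of "E \<inter> W"] openin_chart_domain[OF X that(2)] W
    by (simp add: Int_assoc Int_left_commute openin_Int)
  show ?thesis
  proof (rule smooth_atlasI)
    fix D c E e i
    assume *: "(D, c) \<in> charts (open_mfd X W)" "(E, e) \<in> charts (open_mfd X W)"
    obtain D' where D: "(D', c) \<in> charts X" "D = D' \<inter> W"
      by (rule charts_open_mfdE[OF *(1)])
    obtain E' where E: "(E', e) \<in> charts X" "E = E' \<inter> W"
      by (rule charts_open_mfdE[OF *(2)])
    show "inj_on c D" using chart_inj[OF X D(1)] D(2) by (simp add: inj_on_Int)
    show oi: "openin (Rn_top (mdim (open_mfd X W))) (c ` (D \<inter> E))"
      using o[OF D(1) E(1)] D E by simp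
    assume "i < mdim (open_mfd X W)"
    then have "smooth_Rn (mdim X) (c ` (D \<inter> E)) (\<lambda>y. e (inv_into D' c y) i)"
      using transition_smooth[OF X D(1) E(1)] D E by (auto intro: smooth_Rn_subset)
    then show "smooth_Rn (mdim (open_mfd X W)) (c ` (D \<inter> E)) (\<lambda>y. e (inv_into D c y) i)"
      using oi chart_inj[OF X D(1)]
      by (subst smooth_Rn_cong[where g = "\<lambda>y. e (inv_into D' c y) i"])
        (auto simp: D(2) inv_into_restrict)
  next
    fix D c assume "(D, c) \<in> charts (open_mfd X W)"
    then obtain D' where D: "(D', c) \<in> charts X" "D = D' \<inter> W" by (rule charts_open_mfdE)
    show "openin (Rn_top (mdim (open_mfd X W))) (c ` D)"
      using openin_chart_image[OF X D(1) W] D(2) by simp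
  qed
qed

lemma pts_open_mfd: "pts (open_mfd X W) = pts X \<inter> W"
  by (auto simp: pts_def open_mfd_def)

lemma pts_open_mfd': "smooth_atlas X \<Longrightarrow> openin (mtop X) W \<Longrightarrow> pts (open_mfd X W) = W"
  using openin_mtop_subset[of X W] by (auto simp: pts_open_mfd)

text \<open>Charts are only cut down to W, so near p they read functions in the same way. It follows
  that \<open>smooth_at\<close> does not distinguish X from an open part.\<close>

lemma smooth_near_open_mfd:
  assumes X: "smooth_atlas X" and W: "openin (mtop X) W" "p \<in> W"
  shows "smooth_near (open_mfd X W) p = smooth_near X p"
proof (rule Set.set_eqI)
  fix f
  have "p \<in> pts X" using openin_mtop_subset[OF X W(1)] W(2) by blast
  then obtain D c where D: "(D, c) \<in> charts X" "p \<in> D" by (rule ptsE)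
  have pD: "p \<in> D \<inter> W" using D W by simp
  have eq: "smooth_Rn (mdim X) V (\<lambda>y. f (inv_into (D \<inter> W) c y)) \<longleftrightarrow>
      smooth_Rn (mdim X) V (\<lambda>y. f (inv_into D c y))"
    if "openin (Rn_top (mdim X)) V" "V \<subseteq> c ` (D \<inter> W)" for V
    using that chart_inj[OF X D(1)] by (intro smooth_Rn_cong) (auto simp: inv_into_restrict)
  show "f \<in> smooth_near (open_mfd X W) p \<longleftrightarrow> f \<in> smooth_near X p"
    unfolding smooth_near_chart[OF X D]
      smooth_near_chart[OF smooth_atlas_open_mfd[OF X W(1)] charts_open_mfdI[OF D(1)] pD]
  proof (simp, rule iffI)
    assume "\<exists>V. openin (Rn_top (mdim X)) V \<and> c p \<in> V \<and> V \<subseteq> c ` (D \<inter> W) \<and>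
        smooth_Rn (mdim X) V (\<lambda>y. f (inv_into (D \<inter> W) c y))"
    then obtain V where "openin (Rn_top (mdim X)) V" "c p \<in> V" "V \<subseteq> c ` (D \<inter> W)"
        "smooth_Rn (mdim X) V (\<lambda>y. f (inv_into (D \<inter> W) c y))" by auto
    then show "\<exists>V. openin (Rn_top (mdim X)) V \<and> c p \<in> V \<and> V \<subseteq> c ` D \<and>
        smooth_Rn (mdim X) V (\<lambda>y. f (inv_into D c y))"
      using eq by (intro exI[of _ V]) auto
  next
    assume "\<exists>V. openin (Rn_top (mdim X)) V \<and> c p \<in> V \<and> V \<subseteq> c ` D \<and>
        smooth_Rn (mdim X) V (\<lambda>y. f (inv_into D c y))"
    then obtain V where V: "openin (Rn_top (mdim X)) V" "c p \<in> V" "V \<subseteq> c ` D"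
        "smooth_Rn (mdim X) V (\<lambda>y. f (inv_into D c y))" by auto
    let ?V = "V \<inter> c ` (D \<inter> W)"
    have "openin (Rn_top (mdim X)) ?V"
      using V(1) openin_chart_image[OF X D(1) W(1)] by auto
    then show "\<exists>V. openin (Rn_top (mdim X)) V \<and> c p \<in> V \<and> V \<subseteq> c ` (D \<inter> W) \<and>
        smooth_Rn (mdim X) V (\<lambda>y. f (inv_into (D \<inter> W) c y))"
      using V(2) pD smooth_Rn_subset[OF V(4), of ?V] eq[of ?V] by (intro exI[of _ ?V]) auto
  qed
qed

lemma smooth_at_open_mfd_dom:
  "smooth_atlas X \<Longrightarrow> openin (mtop X) W \<Longrightarrow> p \<in> W \<Longrightarrow>
    smooth_at (open_mfd X W) Y f p \<longleftrightarrow> smooth_at X Y f p"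
  using openin_mtop_subset[of X W] by (auto simp: smooth_at_def smooth_near_open_mfd pts_open_mfd)

lemma smooth_at_open_mfd_cod:
  "smooth_atlas Y \<Longrightarrow> openin (mtop Y) W \<Longrightarrow> f p \<in> W \<Longrightarrow>
    smooth_at X (open_mfd Y W) f p \<longleftrightarrow> smooth_at X Y f p"
  using openin_mtop_subset[of Y W] by (auto simp: smooth_at_def smooth_near_open_mfd pts_open_mfd)

lemma smooth_map_open_mfd_iff:
  "smooth_atlas X \<Longrightarrow> smooth_atlas Y \<Longrightarrow> openin (mtop X) W \<Longrightarrow>
    smooth_map (open_mfd X W) Y f \<longleftrightarrow> (\<forall>p \<in> W. smooth_at X Y f p)"
  by (simp add: smooth_map_iff smooth_atlas_open_mfd pts_open_mfd' smooth_at_open_mfd_dom)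

section \<open>Transport of structure along an injection\<close>

lemma mdim_image_mfd [simp]: "mdim (image_mfd h X) = mdim X"
  by (simp add: image_mfd_def)

lemma pts_image_mfd: "pts (image_mfd h X) = h ` pts X"
  by (force simp: pts_def image_mfd_def)

lemma charts_image_mfdE:
  assumes "(D, c) \<in> charts (image_mfd h X)"
  obtains D' c' where "(D', c') \<in> charts X" "D = h ` D'" "c = (\<lambda>y. c' (inv_into (pts X) h y))"
  using assms by (auto simp: image_mfd_def)

lemma charts_image_mfdI:
  "(D, c) \<in> charts X \<Longrightarrow> (h ` D, \<lambda>y. c (inv_into (pts X) h y)) \<in> charts (image_mfd h X)"
  by (force simp: image_mfd_def)

lemma image_chart_image:
  assumes "inj_on h (pts X)" "A \<subseteq> pts X"
  shows "(\<lambda>y. c (inv_into (pts X) h y)) ` h ` A = c ` A"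
  using assms by (force simp: inv_into_f_f image_iff)

lemma image_chart_inv:
  assumes X: "smooth_atlas X" and D: "(D, c) \<in> charts X" and h: "inj_on h (pts X)" and y: "y \<in> c ` D"
  shows "inv_into (h ` D) (\<lambda>y. c (inv_into (pts X) h y)) y = h (inv_into D c y)"
proof -
  obtain p where p: "p \<in> D" "y = c p" using y by auto
  have pp: "q \<in> pts X" if "q \<in> D" for q using ptsI[OF D that] .
  have "inj_on (\<lambda>y. c (inv_into (pts X) h y)) (h ` D)"
    using chart_inj[OF X D] h pp by (auto simp: inj_on_def inv_into_f_f[OF h])
  then show ?thesis
    using p pp h chart_inv[OF X D p(1)] by (intro inv_into_f_eq) (auto simp: inv_into_f_f[OF h])
qed

lemma smooth_atlas_image_mfd:
  assumes X: "smooth_atlas X" and h: "inj_on h (pts X)"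
  shows "smooth_atlas (image_mfd h X)"
proof (rule smooth_atlasI)
  fix D c E e i
  assume *: "(D, c) \<in> charts (image_mfd h X)" "(E, e) \<in> charts (image_mfd h X)"
  obtain D' c' where D: "(D', c') \<in> charts X" "D = h ` D'"
      "c = (\<lambda>y. c' (inv_into (pts X) h y))"
    by (rule charts_image_mfdE[OF *(1)])
  obtain E' e' where E: "(E', e') \<in> charts X" "E = h ` E'" "e = (\<lambda>y. e' (inv_into (pts X) h y))"
    by (rule charts_image_mfdE[OF *(2)])
  have sub: "D' \<subseteq> pts X" "E' \<subseteq> pts X" by (rule chart_subset_pts[OF D(1)], rule chart_subset_pts[OF E(1)])
  have DE: "D \<inter> E = h ` (D' \<inter> E')"
    using h sub by (simp add: D(2) E(2) inj_on_image_Int)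
  have im: "c ` (D \<inter> E) = c' ` (D' \<inter> E')"
    unfolding DE D(3) by (rule image_chart_image[OF h]) (use sub in auto)
  show "openin (Rn_top (mdim (image_mfd h X))) (c ` (D \<inter> E))"
    using transition_open[OF X D(1) E(1)] by (simp add: im)
  have "e (inv_into D c y) i = e' (inv_into D' c' y) i" if "y \<in> c' ` (D' \<inter> E')" for y
    using that image_chart_inv[OF X D(1) h, of y] chart_inv[OF X D(1)] sub
    by (auto simp: D E inv_into_f_f[OF h] subset_iff)
  then show "smooth_Rn (mdim (image_mfd h X)) (c ` (D \<inter> E)) (\<lambda>y. e (inv_into D c y) i)"
    if "i < mdim (image_mfd h X)"
    using that transition_open[OF X D(1) E(1)] transition_smooth[OF X D(1) E(1)]
    by (subst smooth_Rn_cong[where g = "\<lambda>y. e' (inv_into D' c' y) i"]) (auto simp: im)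
next
  fix D c assume "(D, c) \<in> charts (image_mfd h X)"
  then obtain D' c' where D: "(D', c') \<in> charts X" "D = h ` D'"
      "c = (\<lambda>y. c' (inv_into (pts X) h y))" by (rule charts_image_mfdE)
  have sub: "D' \<subseteq> pts X" by (rule chart_subset_pts[OF D(1)])
  show "inj_on c D"
    using chart_inj[OF X D(1)] sub by (auto simp: D inj_on_def inv_into_f_f[OF h] subset_iff)
  show "openin (Rn_top (mdim (image_mfd h X))) (c ` D)"
    using chart_open[OF X D(1)] image_chart_image[OF h sub, of c'] by (simp add: D)
qed

text \<open>By construction h becomes a diffeomorphism: a transported chart undoes h before it
  applies the old chart.\<close>

lemma smooth_near_image_mfd:
  assumes X: "smooth_atlas X" and h: "inj_on h (pts X)" and p: "p \<in> pts X"
  shows "f \<in> smooth_near (image_mfd h X) (h p) \<longleftrightarrow> (\<lambda>q. f (h q)) \<in> smooth_near X p"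
proof -
  obtain D c where D: "(D, c) \<in> charts X" "p \<in> D" using p by (rule ptsE)
  have im: "(\<lambda>y. c (inv_into (pts X) h y)) ` h ` D = c ` D"
    by (rule image_chart_image[OF h]) (rule chart_subset_pts[OF D(1)])
  have "smooth_Rn (mdim X) V (\<lambda>y. f (inv_into (h ` D) (\<lambda>y. c (inv_into (pts X) h y)) y)) \<longleftrightarrow>
      smooth_Rn (mdim X) V (\<lambda>y. f (h (inv_into D c y)))"
    if "openin (Rn_top (mdim X)) V" "V \<subseteq> c ` D" for V
    using that image_chart_inv[OF X D(1) h] by (intro smooth_Rn_cong) auto
  then show ?thesis
    using smooth_near_chart[OF smooth_atlas_image_mfd[OF X h] charts_image_mfdI[OF D(1)],
        where p = "h p" and f = f]
      smooth_near_chart[OF X D, of "\<lambda>q. f (h q)"] D(2) p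
    by (auto simp: im inv_into_f_f[OF h])
qed

lemma smooth_at_image_mfd:
  "smooth_atlas X \<Longrightarrow> inj_on h (pts X) \<Longrightarrow> p \<in> pts X \<Longrightarrow> smooth_at X (image_mfd h X) h p"
  by (simp add: smooth_at_def pts_image_mfd smooth_near_image_mfd)

lemma smooth_at_image_mfd_dom:
  "smooth_atlas X \<Longrightarrow> inj_on h (pts X) \<Longrightarrow> p \<in> pts X \<Longrightarrow>
    smooth_at (image_mfd h X) Y f (h p) \<longleftrightarrow> smooth_at X Y (\<lambda>q. f (h q)) p"
  by (auto simp: smooth_at_def pts_image_mfd smooth_near_image_mfd)

section \<open>Products\<close>

text \<open>\<open>glue m\<close>, \<open>prj1 m\<close> and \<open>prj2 m\<close> identify
  \<open>Rn m \<times> Rn n\<close> with \<open>Rn (m + n)\<close> as the charts of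
  \<open>prod_mfd\<close> do; the second block starts at index m.\<close>

definition glue :: "nat \<Rightarrow> (nat \<Rightarrow> real) \<Rightarrow> (nat \<Rightarrow> real) \<Rightarrow> nat \<Rightarrow> real" where
  "glue m x y = (\<lambda>i. if i < m then x i else y (i - m))"

definition prj1 :: "nat \<Rightarrow> (nat \<Rightarrow> real) \<Rightarrow> nat \<Rightarrow> real" where
  "prj1 m y = (\<lambda>i. if i < m then y i else 0)"

definition prj2 :: "nat \<Rightarrow> (nat \<Rightarrow> real) \<Rightarrow> nat \<Rightarrow> real" where
  "prj2 m y = (\<lambda>i. y (i + m))"

lemma glue_in_Rn: "y \<in> Rn n \<Longrightarrow> glue m x y \<in> Rn (m + n)"
  by (auto simp: glue_def Rn_def)

lemma prj1_in_Rn: "prj1 m y \<in> Rn m"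
  by (auto simp: prj1_def Rn_def)

lemma prj2_in_Rn: "y \<in> Rn (m + n) \<Longrightarrow> prj2 m y \<in> Rn n"
  by (auto simp: prj2_def Rn_def)

lemma prj1_glue: "x \<in> Rn m \<Longrightarrow> prj1 m (glue m x y) = x"
  by (auto simp: prj1_def glue_def Rn_def fun_eq_iff)

lemma prj2_glue: "prj2 m (glue m x y) = y"
  by (auto simp: prj2_def glue_def fun_eq_iff)

lemma glue_prj: "glue m (prj1 m y) (prj2 m y) = y"
  by (auto simp: prj1_def prj2_def glue_def fun_eq_iff)

lemma smooth_Rn_prj: "smooth_Rn k V (\<lambda>y. prj1 m y i)" "smooth_Rn k V (\<lambda>y. prj2 m y i)"
  by (cases "i < m") (simp_all add: prj1_def prj2_def smooth_Rn_coord smooth_Rn_const)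

lemma continuous_on_prj: "continuous_on V (prj1 m)" "continuous_on V (prj2 m)"
  by (rule continuous_on_coordinatewise_then_product, rule smooth_Rn_continuous, rule smooth_Rn_prj)+

lemma openin_glue:
  assumes "openin (Rn_top m) A" "openin (Rn_top n) B"
  shows "openin (Rn_top (m + n)) {y \<in> Rn (m + n). prj1 m y \<in> A \<and> prj2 m y \<in> B}"
proof -
  have 1: "openin (Rn_top (m + n)) {y \<in> Rn (m + n). prj1 m y \<in> A}"
    by (rule openin_preimage_Rn[OF openin_Rn continuous_on_prj(1) assms(1) prj1_in_Rn])
  have "openin (Rn_top (m + n)) {y \<in> {y \<in> Rn (m + n). prj1 m y \<in> A}. prj2 m y \<in> B}"
    by (rule openin_preimage_Rn[OF 1 continuous_on_prj(2) assms(2)]) (auto intro: prj2_in_Rn)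
  moreover have "{y \<in> {y \<in> Rn (m + n). prj1 m y \<in> A}. prj2 m y \<in> B} =
      {y \<in> Rn (m + n). prj1 m y \<in> A \<and> prj2 m y \<in> B}" by auto
  ultimately show ?thesis by simp
qed

definition prod_chart :: "nat \<Rightarrow> ('a \<Rightarrow> nat \<Rightarrow> real) \<Rightarrow> ('b \<Rightarrow> nat \<Rightarrow> real) \<Rightarrow> 'a \<times> 'b \<Rightarrow> nat \<Rightarrow> real"
  where "prod_chart m c e = (\<lambda>z. glue m (c (fst z)) (e (snd z)))"

lemma mdim_prod_mfd [simp]: "mdim (prod_mfd X Y) = mdim X + mdim Y"
  by (simp add: prod_mfd_def)

lemma charts_prod_mfd: "charts (prod_mfd X Y) =
    {(D \<times> E, prod_chart (mdim X) c e) | D c E e. (D, c) \<in> charts X \<and> (E, e) \<in> charts Y}"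
  by (simp add: prod_mfd_def prod_chart_def glue_def case_prod_unfold)

lemma charts_prod_mfdI: "(D, c) \<in> charts X \<Longrightarrow> (E, e) \<in> charts Y \<Longrightarrow>
    (D \<times> E, prod_chart (mdim X) c e) \<in> charts (prod_mfd X Y)"
  by (auto simp: charts_prod_mfd)

lemma pts_prod_mfd: "pts (prod_mfd X Y) = pts X \<times> pts Y"
  by (force simp: pts_def charts_prod_mfd)

lemma prod_chart_image:
  assumes "c ` A \<subseteq> Rn m" "e ` B \<subseteq> Rn n"
  shows "prod_chart m c e ` (A \<times> B) = {y \<in> Rn (m + n). prj1 m y \<in> c ` A \<and> prj2 m y \<in> e ` B}"
proof
  show "prod_chart m c e ` (A \<times> B) \<subseteq> {y \<in> Rn (m + n). prj1 m y \<in> c ` A \<and> prj2 m y \<in> e ` B}"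
    using assms by (auto simp: prod_chart_def prj1_glue prj2_glue image_subset_iff intro!: glue_in_Rn)
  show "{y \<in> Rn (m + n). prj1 m y \<in> c ` A \<and> prj2 m y \<in> e ` B} \<subseteq> prod_chart m c e ` (A \<times> B)"
  proof
    fix y assume "y \<in> {y \<in> Rn (m + n). prj1 m y \<in> c ` A \<and> prj2 m y \<in> e ` B}"
    then obtain p q where "p \<in> A" "q \<in> B" "prj1 m y = c p" "prj2 m y = e q" by auto
    then have "y = prod_chart m c e (p, q)" using glue_prj[of m y] by (simp add: prod_chart_def)
    then show "y \<in> prod_chart m c e ` (A \<times> B)" using \<open>p \<in> A\<close> \<open>q \<in> B\<close> by blast
  qed
qed

lemma prod_chart_left_inverse:
  assumes c: "inj_on c A" "c ` A \<subseteq> Rn m" and e: "inj_on e B" and z: "z \<in> A \<times> B"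
  shows "(inv_into A c (prj1 m (prod_chart m c e z)), inv_into B e (prj2 m (prod_chart m c e z))) = z"
proof -
  obtain p q where pq: "z = (p, q)" "p \<in> A" "q \<in> B" using z by auto
  have "c p \<in> Rn m" using c(2) pq by auto
  then show ?thesis using pq c(1) e by (simp add: prod_chart_def prj1_glue prj2_glue)
qed

lemma prod_chart_inj:
  "inj_on c A \<Longrightarrow> c ` A \<subseteq> Rn m \<Longrightarrow> inj_on e B \<Longrightarrow> inj_on (prod_chart m c e) (A \<times> B)"
  by (rule inj_on_inverseI[where g = "\<lambda>y. (inv_into A c (prj1 m y), inv_into B e (prj2 m y))"])
    (rule prod_chart_left_inverse)

lemma prod_chart_inv:
  assumes c: "inj_on c A" "c ` A \<subseteq> Rn m" and e: "inj_on e B"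
    and y: "y \<in> prod_chart m c e ` (A \<times> B)"
  shows "inv_into (A \<times> B) (prod_chart m c e) y = (inv_into A c (prj1 m y), inv_into B e (prj2 m y))"
proof -
  from y obtain z where z: "z \<in> A \<times> B" "y = prod_chart m c e z" by (rule imageE)
  show ?thesis
    unfolding z(2) prod_chart_left_inverse[OF c e z(1)]
    by (rule inv_into_f_f[OF prod_chart_inj[OF c e] z(1)])
qed

lemma smooth_atlas_prod_mfd:
  assumes X: "smooth_atlas X" and Y: "smooth_atlas Y"
  shows "smooth_atlas (prod_mfd X Y)"
proof (rule smooth_atlasI)
  fix A a B b i
  assume A: "(A, a) \<in> charts (prod_mfd X Y)" "(B, b) \<in> charts (prod_mfd X Y)"
  obtain D c E e where D: "(D, c) \<in> charts X" "(E, e) \<in> charts Y" "A = D \<times> E"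
    "a = prod_chart (mdim X) c e" using A(1) by (auto simp: charts_prod_mfd)
  obtain D' c' E' e' where D': "(D', c') \<in> charts X" "(E', e') \<in> charts Y" "B = D' \<times> E'"
    "b = prod_chart (mdim X) c' e'" using A(2) by (auto simp: charts_prod_mfd)
  have AB: "A \<inter> B = (D \<inter> D') \<times> (E \<inter> E')" by (auto simp: D D')
  have im: "a ` (A \<inter> B) = {y \<in> Rn (mdim X + mdim Y). prj1 (mdim X) y \<in> c ` (D \<inter> D') \<and>
      prj2 (mdim X) y \<in> e ` (E \<inter> E')}" unfolding AB D(4)
    using chart_in_Rn[OF X D(1)] chart_in_Rn[OF Y D(2)] by (intro prod_chart_image) auto
  show op: "openin (Rn_top (mdim (prod_mfd X Y))) (a ` (A \<inter> B))"
    using openin_glue[OF transition_open[OF X D(1) D'(1)] transition_open[OF Y D(2) D'(2)]]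
    by (simp add: im)
  assume i: "i < mdim (prod_mfd X Y)"
  let ?f = "if i < mdim X then (\<lambda>y. c' (inv_into D c (prj1 (mdim X) y)) i)
    else (\<lambda>y. e' (inv_into E e (prj2 (mdim X) y)) (i - mdim X))"
  have "b (inv_into A a y) i = ?f y" if "y \<in> a ` (A \<inter> B)" for y
  proof -
    have "inv_into A a y = (inv_into D c (prj1 (mdim X) y), inv_into E e (prj2 (mdim X) y))"
      unfolding D using that chart_inj[OF X D(1)] chart_inj[OF Y D(2)] chart_in_Rn[OF X D(1)]
      by (intro prod_chart_inv) (auto simp: D)
    then show ?thesis by (simp add: D' prod_chart_def glue_def)
  qed
  moreover have "smooth_Rn (mdim (prod_mfd X Y)) (a ` (A \<inter> B)) ?f"
  proof (cases "i < mdim X")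
    case True
    have "smooth_Rn (mdim (prod_mfd X Y)) (a ` (A \<inter> B)) (\<lambda>y. c' (inv_into D c (prj1 (mdim X) y)) i)"
      by (rule smooth_Rn_compose[where F = "prj1 (mdim X)" and g = "\<lambda>y. c' (inv_into D c y) i",
            OF transition_open[OF X D(1) D'(1)] op transition_smooth[OF X D(1) D'(1) True]])
        (auto simp: im intro: smooth_Rn_prj)
    then show ?thesis using True by simp
  next
    case False
    then have i': "i - mdim X < mdim Y" using i by auto
    have "smooth_Rn (mdim (prod_mfd X Y)) (a ` (A \<inter> B))
        (\<lambda>y. e' (inv_into E e (prj2 (mdim X) y)) (i - mdim X))"
      by (rule smooth_Rn_compose[where F = "prj2 (mdim X)" and
            g = "\<lambda>y. e' (inv_into E e y) (i - mdim X)",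
            OF transition_open[OF Y D(2) D'(2)] op transition_smooth[OF Y D(2) D'(2) i']])
        (auto simp: im intro: smooth_Rn_prj)
    then show ?thesis using False by simp
  qed
  ultimately show "smooth_Rn (mdim (prod_mfd X Y)) (a ` (A \<inter> B)) (\<lambda>y. b (inv_into A a y) i)"
    by (subst smooth_Rn_cong[OF op, where g = ?f]) auto
next
  fix A a assume A: "(A, a) \<in> charts (prod_mfd X Y)"
  obtain D c E e where D: "(D, c) \<in> charts X" "(E, e) \<in> charts Y" "A = D \<times> E"
    "a = prod_chart (mdim X) c e" using A(1) by (auto simp: charts_prod_mfd)
  have cR: "c ` D \<subseteq> Rn (mdim X)" "e ` E \<subseteq> Rn (mdim Y)"
    using chart_in_Rn[OF X D(1)] chart_in_Rn[OF Y D(2)] by auto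
  show "openin (Rn_top (mdim (prod_mfd X Y))) (a ` A)"
    using openin_glue[OF chart_open[OF X D(1)] chart_open[OF Y D(2)]] prod_chart_image[OF cR]
    by (simp add: D)
  show "inj_on a A"
    unfolding D by (rule prod_chart_inj[OF chart_inj[OF X D(1)] cR(1) chart_inj[OF Y D(2)]])
qed

lemma
  assumes X: "smooth_atlas X" and Y: "smooth_atlas Y" and p: "z \<in> pts (prod_mfd X Y)"
  shows smooth_at_fst: "smooth_at (prod_mfd X Y) X fst z"
    and smooth_at_snd: "smooth_at (prod_mfd X Y) Y snd z"
proof -
  note XY = smooth_atlas_prod_mfd[OF X Y]
  obtain D c E e where D: "(D, c) \<in> charts X" "fst z \<in> D" and E: "(E, e) \<in> charts Y" "snd z \<in> E"
    using p by (auto simp: pts_prod_mfd elim!: ptsE)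
  note C = charts_prod_mfdI[OF D(1) E(1)]
  have z: "z \<in> D \<times> E" using D E by (simp add: mem_Times_iff)
  have coord: "(\<lambda>w. prod_chart (mdim X) c e w i) \<in> smooth_near (prod_mfd X Y) z" for i
    by (rule chart_coord_smooth[OF XY C z])
  show "smooth_at (prod_mfd X Y) X fst z"
  proof (rule smooth_at_chartI[OF XY X D(1) openin_chart_domain[OF XY C] z])
    show "(\<lambda>w. c (fst w) i) \<in> smooth_near (prod_mfd X Y) z" if "i < mdim X" for i
      using coord[of i] that by (simp add: prod_chart_def glue_def)
  qed auto
  show "smooth_at (prod_mfd X Y) Y snd z"
  proof (rule smooth_at_chartI[OF XY Y E(1) openin_chart_domain[OF XY C] z])
    show "(\<lambda>w. e (snd w) i) \<in> smooth_near (prod_mfd X Y) z" if "i < mdim Y" for i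
      using coord[of "i + mdim X"] that by (simp add: prod_chart_def glue_def)
  qed auto
qed

lemma smooth_at_Pair:
  assumes X: "smooth_atlas X" and Y: "smooth_atlas Y" and Z: "smooth_atlas Z"
    and f: "smooth_at Z X f p" and g: "smooth_at Z Y g p"
  shows "smooth_at Z (prod_mfd X Y) (\<lambda>q. (f q, g q)) p"
proof -
  obtain D c E e where D: "(D, c) \<in> charts X" "f p \<in> D" and E: "(E, e) \<in> charts Y" "g p \<in> E"
    using smooth_at_pts(2)[OF f] smooth_at_pts(2)[OF g] by (auto elim!: ptsE)
  obtain W1 where W1: "openin (mtop Z) W1" "p \<in> W1" "f ` W1 \<subseteq> D"
    by (rule smooth_at_openin[OF Z X f openin_chart_domain[OF X D(1)] D(2)])
  obtain W2 where W2: "openin (mtop Z) W2" "p \<in> W2" "g ` W2 \<subseteq> E"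
    by (rule smooth_at_openin[OF Z Y g openin_chart_domain[OF Y E(1)] E(2)])
  show ?thesis
  proof (rule smooth_at_chartI[OF Z smooth_atlas_prod_mfd[OF X Y] charts_prod_mfdI[OF D(1) E(1)]])
    show "openin (mtop Z) (W1 \<inter> W2)" "p \<in> W1 \<inter> W2" "(\<lambda>q. (f q, g q)) ` (W1 \<inter> W2) \<subseteq> D \<times> E"
      using W1 W2 by auto
    show "(\<lambda>q. prod_chart (mdim X) c e (f q, g q) i) \<in> smooth_near Z p" for i
      using sm_atD[OF f chart_coord_smooth[OF X D]] sm_atD[OF g chart_coord_smooth[OF Y E]]
      by (cases "i < mdim X") (simp_all add: prod_chart_def glue_def)
  qed
qed

subsection \<open>Submanifolds and diffeomorphisms onto open sets\<close>

text \<open>\<open>sub_mfd\<close> asks for one neighbourhood on which all d coordinates extend;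
  neighbourhoods for the single coordinates can be intersected, being finite in number.\<close>

lemma smooth_near_Int:
  assumes X: "smooth_atlas X" and "finite I" "p \<in> pts X"
    and "\<And>i. i \<in> I \<Longrightarrow> \<exists>W. openin (mtop X) W \<and> p \<in> W \<and> P i W"
    and "\<And>i W W'. P i W \<Longrightarrow> W' \<subseteq> W \<Longrightarrow> P i W'"
  shows "\<exists>W. openin (mtop X) W \<and> p \<in> W \<and> (\<forall>i\<in>I. P i W)"
  using assms(2,4)
proof (induction I)
  case empty
  then show ?case using openin_pts[OF X] assms(3) by auto
next
  case (insert i I)
  then obtain W' where "openin (mtop X) W'" "p \<in> W'" "\<forall>j\<in>I. P j W'" by auto
  moreover obtain W where "openin (mtop X) W" "p \<in> W" "P i W" using insert.prems by auto
  ultimately show ?case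
    using assms(5)[of i W "W \<inter> W'"] assms(5)[of _ W' "W \<inter> W'"]
    by (intro exI[of _ "W \<inter> W'"]) auto
qed

lemma mdim_sub_mfd [simp]: "mdim (sub_mfd X S d) = d"
  by (simp add: sub_mfd_def)

text \<open>The chart condition in germ form: every coordinate may have its own neighbourhood and
  extension, smooth at p. The original form is recovered by shrinking to where the extensions are
  smooth and intersecting.\<close>

lemma charts_sub_mfd_iff:
  assumes X: "smooth_atlas X"
  shows "(D, c) \<in> charts (sub_mfd X S d) \<longleftrightarrow>
     openin (subtopology (mtop X) S) D \<and> inj_on c D \<and> openin (Rn_top d) (c ` D) \<and>
     (\<forall>y\<in>c ` D. smooth_at (euclidean_mfd d) X (inv_into D c) y) \<and>
     (\<forall>p\<in>D. \<forall>i<d. \<exists>W f. openin (mtop X) W \<and> p \<in> W \<and> f \<in> smooth_near X p \<and>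
        (\<forall>q \<in> W \<inter> D. f q = c q i))" (is "_ \<longleftrightarrow> ?R")
proof -
  let ?P = "\<lambda>p. \<exists>W. p \<in> W \<and> (\<forall>i<d. \<exists>f. smooth_fun X W f \<and> (\<forall>q \<in> W \<inter> D. f q = c q i)) \<and>
        openin (mtop X) W"
  let ?Q = "\<lambda>p. \<forall>i<d. \<exists>W f. openin (mtop X) W \<and> p \<in> W \<and> f \<in> smooth_near X p \<and>
        (\<forall>q \<in> W \<inter> D. f q = c q i)"
  have PQ: "?P p \<longleftrightarrow> ?Q p" if p: "p \<in> pts X" for p
  proof
    assume "?P p"
    then obtain W where W: "p \<in> W" "openin (mtop X) W"
      "\<And>i. i < d \<Longrightarrow> \<exists>f. smooth_fun X W f \<and> (\<forall>q \<in> W \<inter> D. f q = c q i)" by auto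
    show "?Q p"
    proof (intro allI impI)
      fix i assume "i < d"
      then obtain f where "smooth_fun X W f" "\<forall>q \<in> W \<inter> D. f q = c q i" using W(3) by blast
      then show "\<exists>W f. openin (mtop X) W \<and> p \<in> W \<and> f \<in> smooth_near X p \<and> (\<forall>q \<in> W \<inter> D. f q = c q i)"
        using W(1,2) smooth_near_iff[of f X p] by blast
    qed
  next
    assume Q: "?Q p"
    let ?R = "\<lambda>i W. \<exists>f. (\<forall>q\<in>W. f \<in> smooth_near X q) \<and> (\<forall>q \<in> W \<inter> D. f q = c q i)"
    have "\<exists>W. openin (mtop X) W \<and> p \<in> W \<and> (\<forall>i\<in>{..<d}. ?R i W)"
    proof (rule smooth_near_Int[OF X finite_lessThan p])
      fix i assume "i \<in> {..<d}"
      then obtain W f where W: "openin (mtop X) W" "p \<in> W" "f \<in> smooth_near X p"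
        "\<forall>q \<in> W \<inter> D. f q = c q i" using Q by blast
      obtain W' where W': "openin (mtop X) W'" "p \<in> W'" "\<And>q. q \<in> W' \<Longrightarrow> f \<in> smooth_near X q"
        by (rule smooth_near_open[OF X W(3)]) blast
      show "\<exists>W. openin (mtop X) W \<and> p \<in> W \<and> ?R i W"
        using W W' by (intro exI[of _ "W \<inter> W'"]) auto
    next
      fix i W W' assume "?R i W" "W' \<subseteq> W"
      then show "?R i W'" by blast
    qed
    then show "?P p" unfolding smooth_fun_iff_near[OF X] by auto
  qed
  have eq: "(D, c) \<in> charts (sub_mfd X S d) \<longleftrightarrow>
     openin (subtopology (mtop X) S) D \<and> inj_on c D \<and> openin (Rn_top d) (c ` D) \<and>
     smooth_map (open_mfd (euclidean_mfd d) (c ` D)) X (inv_into D c) \<and> (\<forall>p\<in>D. ?P p)"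
    by (simp add: sub_mfd_def)
  have "(\<forall>p\<in>D. ?P p) \<longleftrightarrow> (\<forall>p\<in>D. ?Q p)" if "openin (subtopology (mtop X) S) D"
  proof -
    have "D \<subseteq> pts X"
      using openin_subset[OF that] topspace_mtop[OF X] by auto
    then show ?thesis using PQ by (intro ball_cong refl) (simp add: subset_iff)
  qed
  moreover have "smooth_map (open_mfd (euclidean_mfd d) (c ` D)) X (inv_into D c) \<longleftrightarrow>
      (\<forall>y\<in>c ` D. smooth_at (euclidean_mfd d) X (inv_into D c) y)" if "openin (Rn_top d) (c ` D)"
    using that by (intro smooth_map_open_mfd_iff smooth_atlas_euclidean X)
      (simp add: openin_mtop_euclidean)
  ultimately show ?thesis unfolding eq by blast
qed

lemma sub_mfd_chart:
  assumes X: "smooth_atlas X" and D: "(D, c) \<in> charts (sub_mfd X S d)"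
  obtains Q where "openin (mtop X) Q" "D = Q \<inter> S"
    "inj_on c D" "openin (Rn_top d) (c ` D)"
    "\<And>y. y \<in> c ` D \<Longrightarrow> smooth_at (euclidean_mfd d) X (inv_into D c) y"
    "\<And>p i. p \<in> D \<Longrightarrow> i < d \<Longrightarrow> \<exists>W f. openin (mtop X) W \<and> p \<in> W \<and> f \<in> smooth_near X p \<and>
        (\<forall>q \<in> W \<inter> D. f q = c q i)"
proof -
  note * = D[unfolded charts_sub_mfd_iff[OF X]]
  from *[THEN conjunct1] obtain Q where "openin (mtop X) Q" "D = Q \<inter> S"
    unfolding openin_subtopology by blast
  then show thesis
    by (rule that) (rule *[THEN conjunct2, THEN conjunct1]
        *[THEN conjunct2, THEN conjunct2, THEN conjunct1]
        *[THEN conjunct2, THEN conjunct2, THEN conjunct2, THEN conjunct1, rule_format]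
        *[THEN conjunct2, THEN conjunct2, THEN conjunct2, THEN conjunct2, rule_format]; assumption)+
qed

text \<open>An inclusion is all one gets for arbitrary S and d, since there may be no charts at some
  points of S. Equality for fibre products takes a construction of charts.\<close>

lemma pts_sub_mfd_subset:
  assumes X: "smooth_atlas X"
  shows "pts (sub_mfd X S d) \<subseteq> S \<inter> pts X"
proof
  fix p assume "p \<in> pts (sub_mfd X S d)"
  then obtain D c where D: "(D, c) \<in> charts (sub_mfd X S d)" "p \<in> D" by (rule ptsE)
  show "p \<in> S \<inter> pts X"
    by (rule sub_mfd_chart[OF X D(1)]) (use D(2) openin_mtop_subset[OF X] in blast)
qed

text \<open>A transition map is a local extension of a coordinate of e after an inverse chart, and
  both are smooth by the definition of \<open>sub_mfd\<close>, whatever S is.\<close>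

lemma smooth_atlas_sub_mfd:
  assumes X: "smooth_atlas X"
  shows "smooth_atlas (sub_mfd X S d)"
proof (rule smooth_atlasI)
  fix D c assume D: "(D, c) \<in> charts (sub_mfd X S d)"
  then show "inj_on c D" "openin (Rn_top (mdim (sub_mfd X S d))) (c ` D)"
    by (simp_all add: charts_sub_mfd_iff[OF X])
next
  fix D c E e i
  assume D: "(D, c) \<in> charts (sub_mfd X S d)" and E: "(E, e) \<in> charts (sub_mfd X S d)"
  obtain Q where Q: "openin (mtop X) Q" "D = Q \<inter> S"
    "inj_on c D" "openin (Rn_top d) (c ` D)"
    "\<And>y. y \<in> c ` D \<Longrightarrow> smooth_at (euclidean_mfd d) X (inv_into D c) y"
    by (rule sub_mfd_chart[OF X D]) blast
  obtain Q' where Q': "openin (mtop X) Q'" "E = Q' \<inter> S"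
    "\<And>p i. p \<in> E \<Longrightarrow> i < d \<Longrightarrow> \<exists>W f. openin (mtop X) W \<and> p \<in> W \<and> f \<in> smooth_near X p \<and>
        (\<forall>q \<in> W \<inter> E. f q = e q i)"
    by (rule sub_mfd_chart[OF X E]) blast
  have pre: "openin (Rn_top d) {y \<in> c ` D. inv_into D c y \<in> W}" if "openin (mtop X) W" for W
    using openin_sm_preimage[OF smooth_atlas_euclidean X _ Q(5) that] Q(4)
    by (simp add: openin_mtop_euclidean)
  have "c ` (D \<inter> E) = {y \<in> c ` D. inv_into D c y \<in> Q'}"
    using Q(2,3) Q'(2) by auto
  then show op: "openin (Rn_top (mdim (sub_mfd X S d))) (c ` (D \<inter> E))"
    using pre[OF Q'(1)] by simp
  assume i: "i < mdim (sub_mfd X S d)"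
  show "smooth_Rn (mdim (sub_mfd X S d)) (c ` (D \<inter> E)) (\<lambda>y. e (inv_into D c y) i)"
  proof (rule smooth_Rn_local[OF op])
    fix y assume y: "y \<in> c ` (D \<inter> E)"
    then obtain p where p: "p \<in> D" "p \<in> E" "y = c p" by auto
    then have inv: "inv_into D c y = p" using Q(3) by simp
    obtain W f where W: "openin (mtop X) W" "p \<in> W" "f \<in> smooth_near X p"
      "\<forall>q \<in> W \<inter> E. f q = e q i" using Q'(3)[OF p(2), of i] i by auto
    have yR: "y \<in> Rn d" using openin_Rn_subset[OF Q(4)] y by auto
    have "(\<lambda>y. f (inv_into D c y)) \<in> smooth_near (euclidean_mfd d) y"
      using sm_atD[OF Q(5), of y f] y W(3) inv by auto
    then obtain V where V: "openin (Rn_top d) V" "y \<in> V" "smooth_Rn d V (\<lambda>y. f (inv_into D c y))"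
      using smooth_near_euclidean[OF yR] by auto
    let ?V = "V \<inter> c ` (D \<inter> E) \<inter> {y \<in> c ` D. inv_into D c y \<in> W}"
    have o: "openin (Rn_top d) ?V" using V(1) op pre[OF W(1)] by auto
    have "smooth_Rn d ?V (\<lambda>y. f (inv_into D c y))" using V(3) by (rule smooth_Rn_subset) auto
    then have "smooth_Rn d ?V (\<lambda>y. e (inv_into D c y) i)"
    proof (rule smooth_Rn_cong[OF o, THEN iffD1, rotated])
      fix z assume z: "z \<in> ?V"
      then obtain q where q: "q \<in> D" "q \<in> E" "z = c q" by auto
      then show "f (inv_into D c z) = e (inv_into D c z) i" using z W(4) Q(3) by simp
    qed
    then show "\<exists>W. openin (Rn_top (mdim (sub_mfd X S d))) W \<and> y \<in> W \<and>
        smooth_Rn (mdim (sub_mfd X S d)) W (\<lambda>y. e (inv_into D c y) i)"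
      using o y V(2) inv W(2) by (intro exI[of _ ?V]) auto
  qed
qed

text \<open>Inverse charts of the submanifold are smooth into X, so smooth germs on X restrict to
  smooth germs on it.\<close>

lemma smooth_at_sub_mfd_dom:
  assumes X: "smooth_atlas X" and p: "p \<in> pts (sub_mfd X S d)"
  shows "smooth_at (sub_mfd X S d) X (\<lambda>q. q) p"
  unfolding smooth_at_def
proof (intro conjI ballI)
  show "p \<in> pts X" using p pts_sub_mfd_subset[OF X] by blast
  fix \<phi> assume \<phi>: "\<phi> \<in> smooth_near X p"
  obtain D c where D: "(D, c) \<in> charts (sub_mfd X S d)" "p \<in> D" using p by (rule ptsE)
  obtain Q where Q: "inj_on c D" "openin (Rn_top d) (c ` D)"
    "\<And>y. y \<in> c ` D \<Longrightarrow> smooth_at (euclidean_mfd d) X (inv_into D c) y"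
    by (rule sub_mfd_chart[OF X D(1)]) blast
  have cp: "c p \<in> Rn d" using openin_Rn_subset[OF Q(2)] D(2) by auto
  have "(\<lambda>y. \<phi> (inv_into D c y)) \<in> smooth_near (euclidean_mfd d) (c p)"
    using sm_atD[OF Q(3), of "c p" \<phi>] \<phi> D(2) Q(1) by simp
  then obtain V where V: "openin (Rn_top d) V" "c p \<in> V" "smooth_Rn d V (\<lambda>y. \<phi> (inv_into D c y))"
    using smooth_near_euclidean[OF cp] by auto
  have "openin (Rn_top d) (V \<inter> c ` D)" using V Q by auto
  then show "\<phi> \<in> smooth_near (sub_mfd X S d) p"
    using V D(2) smooth_Rn_subset[OF V(3), of "V \<inter> c ` D"]
    by (subst smooth_near_chart[OF smooth_atlas_sub_mfd[OF X] D])
      (auto intro!: exI[of _ "V \<inter> c ` D"])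
qed (use p in auto)

text \<open>Chart coordinates of the submanifold extend to X near each point, so a smooth map into X
  with values in S near p has smooth coordinates.\<close>

lemma smooth_at_sub_mfd_cod:
  assumes X: "smooth_atlas X" and Z: "smooth_atlas Z" and f: "smooth_at Z X f p"
    and fp: "f p \<in> pts (sub_mfd X S d)"
    and W: "openin (mtop Z) W" "p \<in> W" "f ` W \<subseteq> S"
  shows "smooth_at Z (sub_mfd X S d) f p"
proof -
  obtain D c where D: "(D, c) \<in> charts (sub_mfd X S d)" "f p \<in> D" using fp by (rule ptsE)
  obtain Q where Q: "openin (mtop X) Q" "D = Q \<inter> S"
    "\<And>p i. p \<in> D \<Longrightarrow> i < d \<Longrightarrow> \<exists>W f. openin (mtop X) W \<and> p \<in> W \<and> f \<in> smooth_near X p \<and>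
        (\<forall>q \<in> W \<inter> D. f q = c q i)"
    by (rule sub_mfd_chart[OF X D(1)]) blast
  obtain W' where W': "openin (mtop Z) W'" "p \<in> W'" "f ` W' \<subseteq> Q"
    by (rule smooth_at_openin[OF Z X f Q(1)]) (use D(2) Q(2) in auto)
  show ?thesis
  proof (rule smooth_at_chartI[OF Z smooth_atlas_sub_mfd[OF X] D(1)])
    show "openin (mtop Z) (W \<inter> W')" "p \<in> W \<inter> W'" "f ` (W \<inter> W') \<subseteq> D"
      using W W' Q(2) by auto
    fix i assume "i < mdim (sub_mfd X S d)"
    then have "i < d" by simp
    from Q(3)[OF D(2) this] obtain N \<psi> where N: "openin (mtop X) N" "f p \<in> N"
        "\<psi> \<in> smooth_near X (f p)" "\<forall>q \<in> N \<inter> D. \<psi> q = c q i" by blast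
    obtain W'' where W'': "openin (mtop Z) W''" "p \<in> W''" "f ` W'' \<subseteq> N"
      by (rule smooth_at_openin[OF Z X f N(1,2)])
    show "(\<lambda>q. c (f q) i) \<in> smooth_near Z p"
    proof (rule smooth_near_cong_imp[OF Z _ _ _ sm_atD[OF f N(3)]])
      show "openin (mtop Z) (W \<inter> W' \<inter> W'')" "p \<in> W \<inter> W' \<inter> W''"
        using W W' W'' by auto
      show "\<psi> (f q) = c (f q) i" if "q \<in> W \<inter> W' \<inter> W''" for q
        using that N(4) W W' W'' Q(2) by blast
    qed
  qed
qed

section \<open>Compatible charts and changes of coordinates\<close>

text \<open>The charts of the maximal atlas. Straightened coordinates need not belong to the given
  set \<open>charts X\<close>, so compatibility is expressed by smoothness in both
  directions.\<close>

definition nice_chart :: "'a smfd \<Rightarrow> 'a set \<Rightarrow> ('a \<Rightarrow> nat \<Rightarrow> real) \<Rightarrow> bool" where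
  "nice_chart X D c \<longleftrightarrow> openin (mtop X) D \<and> inj_on c D \<and> openin (Rn_top (mdim X)) (c ` D) \<and>
     (\<forall>p\<in>D. \<forall>i<mdim X. (\<lambda>q. c q i) \<in> smooth_near X p) \<and>
     (\<forall>y\<in>c ` D. smooth_at (euclidean_mfd (mdim X)) X (inv_into D c) y)"

lemma nice_chartD:
  assumes "nice_chart X D c"
  shows "openin (mtop X) D" "inj_on c D" "openin (Rn_top (mdim X)) (c ` D)"
    "\<And>p i. p \<in> D \<Longrightarrow> i < mdim X \<Longrightarrow> (\<lambda>q. c q i) \<in> smooth_near X p"
    "\<And>y. y \<in> c ` D \<Longrightarrow> smooth_at (euclidean_mfd (mdim X)) X (inv_into D c) y"
    "\<And>p. p \<in> D \<Longrightarrow> c p \<in> Rn (mdim X)"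
    "\<And>p. p \<in> D \<Longrightarrow> inv_into D c (c p) = p"
  using assms openin_Rn_subset[of "mdim X" "c ` D"] by (auto simp: nice_chart_def)

lemma nice_chart_chart:
  assumes X: "smooth_atlas X" and D: "(D, c) \<in> charts X"
  shows "nice_chart X D c"
  unfolding nice_chart_def
proof (intro conjI ballI allI impI)
  show "openin (mtop X) D" by (rule openin_chart_domain[OF X D])
  show "inj_on c D" by (rule chart_inj[OF X D])
  show o: "openin (Rn_top (mdim X)) (c ` D)" by (rule chart_open[OF X D])
  show "(\<lambda>q. c q i) \<in> smooth_near X p" if "p \<in> D" for p i by (rule chart_coord_smooth[OF X D that])
  fix y assume y: "y \<in> c ` D"
  then obtain p where p: "p \<in> D" "y = c p" by auto
  have inv: "inv_into D c y = p" using chart_inv[OF X D] p by simp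
  have yR: "y \<in> Rn (mdim X)" using chart_in_Rn[OF X D] p by simp
  have "(\<lambda>y. \<phi> (inv_into D c y)) \<in> smooth_near (euclidean_mfd (mdim X)) y"
    if \<phi>: "\<phi> \<in> smooth_near X p" for \<phi>
  proof -
    obtain V where "openin (Rn_top (mdim X)) V" "c p \<in> V"
      "smooth_Rn (mdim X) V (\<lambda>y. \<phi> (inv_into D c y))"
      using smooth_near_chart[OF X D p(1), THEN iffD1, OF \<phi>] by blast
    then show ?thesis
      by (intro smooth_near_euclidean[OF yR, THEN iffD2] exI[of _ V]) (simp add: p(2))
  qed
  then show "smooth_at (euclidean_mfd (mdim X)) X (inv_into D c) y"
    using yR ptsI[OF D p(1)] by (simp add: smooth_at_def inv pts_euclidean_mfd)
qed

lemma nice_chart_near: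
  assumes X: "smooth_atlas X" and D: "nice_chart X D c" and p: "p \<in> D"
  shows "f \<in> smooth_near X p \<longleftrightarrow> (\<exists>V. openin (Rn_top (mdim X)) V \<and> c p \<in> V \<and> V \<subseteq> c ` D \<and>
    smooth_Rn (mdim X) V (\<lambda>y. f (inv_into D c y)))"
proof
  note d = nice_chartD[OF D]
  assume "f \<in> smooth_near X p"
  then have "(\<lambda>y. f (inv_into D c y)) \<in> smooth_near (euclidean_mfd (mdim X)) (c p)"
    using sm_atD[OF d(5), of "c p" f] d(7)[OF p] p by simp
  then obtain V where V: "openin (Rn_top (mdim X)) V" "c p \<in> V"
    "smooth_Rn (mdim X) V (\<lambda>y. f (inv_into D c y))"
    using smooth_near_euclidean[OF d(6)[OF p]] by auto
  then show "\<exists>V. openin (Rn_top (mdim X)) V \<and> c p \<in> V \<and> V \<subseteq> c ` D \<and>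
    smooth_Rn (mdim X) V (\<lambda>y. f (inv_into D c y))"
    using d(3) p smooth_Rn_subset[OF V(3), of "V \<inter> c ` D"] by (intro exI[of _ "V \<inter> c ` D"]) auto
next
  note d = nice_chartD[OF D]
  assume "\<exists>V. openin (Rn_top (mdim X)) V \<and> c p \<in> V \<and> V \<subseteq> c ` D \<and>
    smooth_Rn (mdim X) V (\<lambda>y. f (inv_into D c y))"
  then obtain V where V: "openin (Rn_top (mdim X)) V" "c p \<in> V"
    "smooth_Rn (mdim X) V (\<lambda>y. f (inv_into D c y))" by auto
  have "(\<lambda>q. f (inv_into D c (c q))) \<in> smooth_near X p"
    by (rule smooth_near_compose[where u = c and g = "\<lambda>y. f (inv_into D c y)",
          OF X d(1) p d(6) d(4)[OF p] V])
  then show "f \<in> smooth_near X p"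
    by (rule smooth_near_cong_imp[OF X d(1) p, rotated]) (simp add: d(7))
qed

lemma nice_chart_image_open:
  assumes X: "smooth_atlas X" and D: "nice_chart X D c" and W: "openin (mtop X) W"
  shows "openin (Rn_top (mdim X)) (c ` (D \<inter> W))"
proof -
  note d = nice_chartD[OF D]
  have "c ` (D \<inter> W) = {y \<in> c ` D. inv_into D c y \<in> W}" using d(7) by auto
  then show ?thesis
    using openin_sm_preimage[OF smooth_atlas_euclidean X _ d(5) W] d(3)
    by (simp add: openin_mtop_euclidean)
qed

lemma smooth_at_into_euclidean:
  assumes X: "smooth_atlas X" and W: "openin (mtop X) W" "p \<in> W" "\<And>q. q \<in> W \<Longrightarrow> F q \<in> Rn n"
    and F: "\<And>i. i < n \<Longrightarrow> (\<lambda>q. F q i) \<in> smooth_near X p"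
  shows "smooth_at X (euclidean_mfd n) F p"
  by (rule smooth_at_chartI[OF X smooth_atlas_euclidean _ W(1,2), where E = "Rn n" and e = "\<lambda>x. x"])
    (use assms in \<open>auto simp: charts_euclidean_mfd\<close>)

lemma smooth_at_euclidean:
  assumes "openin (Rn_top m) V" "x \<in> V" "\<And>y. y \<in> V \<Longrightarrow> F y \<in> Rn n"
    "\<And>i. i < n \<Longrightarrow> smooth_Rn m V (\<lambda>y. F y i)"
  shows "smooth_at (euclidean_mfd m) (euclidean_mfd n) F x"
  by (rule smooth_at_into_euclidean[OF smooth_atlas_euclidean, where W = V])
    (use assms openin_Rn_subset[of m V] in \<open>auto simp: openin_mtop_euclidean smooth_near_euclidean subset_iff\<close>)

text \<open>The left inverse \<Theta> of \<Psi> on V provides both the injectivity of the new chart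
  and the smoothness of its inverse.\<close>

lemma nice_chart_compose:
  assumes X: "smooth_atlas X" and D: "nice_chart X D c" and V: "openin (Rn_top (mdim X)) V" "V \<subseteq> c ` D"
    and o: "openin (Rn_top (mdim X)) (\<Psi> ` V)"
    and s: "\<And>i. i < mdim X \<Longrightarrow> smooth_Rn (mdim X) V (\<lambda>x. \<Psi> x i)"
    and \<Theta>: "\<And>x. x \<in> V \<Longrightarrow> \<Theta> (\<Psi> x) = x"
      "\<And>i. i < mdim X \<Longrightarrow> smooth_Rn (mdim X) (\<Psi> ` V) (\<lambda>x. \<Theta> x i)"
  shows "nice_chart X {p \<in> D. c p \<in> V} (\<lambda>p. \<Psi> (c p))"
  unfolding nice_chart_def
proof (intro conjI ballI allI impI)
  note d = nice_chartD[OF D]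
  let ?D = "{p \<in> D. c p \<in> V}" and ?c = "\<lambda>p. \<Psi> (c p)"
  have "smooth_at X (euclidean_mfd (mdim X)) c p" if "p \<in> D" for p
    by (rule smooth_at_into_euclidean[OF X d(1) that d(6) d(4)[OF that]])
  from openin_sm_preimage[OF X smooth_atlas_euclidean d(1) this]
  show "openin (mtop X) ?D" using V(1) by (simp add: openin_mtop_euclidean)
  have left: "inv_into D c (\<Theta> (?c p)) = p" if "p \<in> ?D" for p
    using that \<Theta>(1) d(7) by auto
  show inj: "inj_on ?c ?D"
    by (rule inj_on_inverseI[where g = "\<lambda>y. inv_into D c (\<Theta> y)"]) (rule left)
  have im: "?c ` ?D = \<Psi> ` V" using V(2) by auto
  show "openin (Rn_top (mdim X)) (?c ` ?D)" unfolding im by (rule o)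
  fix p i assume p: "p \<in> ?D" and i: "i < mdim X"
  show "(\<lambda>q. ?c q i) \<in> smooth_near X p"
    by (rule smooth_near_compose[where u = c and g = "\<lambda>x. \<Psi> x i",
          OF X d(1) _ d(6) d(4) V(1) _ s[OF i]]) (use p in auto)
next
  note d = nice_chartD[OF D]
  let ?D = "{p \<in> D. c p \<in> V}" and ?c = "\<lambda>p. \<Psi> (c p)"
  have left: "inv_into D c (\<Theta> (?c p)) = p" if "p \<in> ?D" for p
    using that \<Theta>(1) d(7) by auto
  have inj: "inj_on ?c ?D"
    by (rule inj_on_inverseI[where g = "\<lambda>y. inv_into D c (\<Theta> y)"]) (rule left)
  fix y assume "y \<in> ?c ` ?D"
  then obtain p where p: "p \<in> ?D" "y = ?c p" by auto
  have y: "y \<in> \<Psi> ` V" using p by auto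
  have \<Theta>R: "\<Theta> z \<in> Rn (mdim X)" if "z \<in> \<Psi> ` V" for z
    using that \<Theta>(1) openin_Rn_subset[OF V(1)] by auto
  have "smooth_at (euclidean_mfd (mdim X)) (euclidean_mfd (mdim X)) \<Theta> y"
    by (rule smooth_at_euclidean[OF o y \<Theta>R \<Theta>(2)])
  moreover have "\<Theta> y \<in> c ` D" using p \<Theta>(1) by auto
  ultimately have "smooth_at (euclidean_mfd (mdim X)) X (\<lambda>y. inv_into D c (\<Theta> y)) y"
    using d(5) by (intro smooth_at_compose[where f = \<Theta> and g = "inv_into D c"])
  then show "smooth_at (euclidean_mfd (mdim X)) X (inv_into ?D ?c) y"
  proof (rule smooth_at_cong[OF smooth_atlas_euclidean _ y, rotated 2])
    show "inv_into D c (\<Theta> z) = inv_into ?D ?c z" if "z \<in> \<Psi> ` V" for z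
    proof -
      from that V(2) obtain q where q: "q \<in> ?D" "z = ?c q" by auto
      show ?thesis unfolding q(2) left[OF q(1)] using inv_into_f_f[OF inj q(1)] by simp
    qed
  qed (use o in \<open>simp add: openin_mtop_euclidean\<close>)
qed

lemma nice_chart_restrict:
  assumes X: "smooth_atlas X" and D: "nice_chart X D c" and W: "openin (mtop X) W"
  shows "nice_chart X (D \<inter> W) c"
proof -
  note d = nice_chartD[OF D]
  have "{p \<in> D. c p \<in> c ` (D \<inter> W)} = D \<inter> W" using d(2) by (auto simp: inj_on_def)
  then show ?thesis
    using nice_chart_compose[OF X D nice_chart_image_open[OF X D W], of "\<lambda>x. x" "\<lambda>x. x"]
      nice_chart_image_open[OF X D W] by (auto simp: smooth_Rn_coord)
qed

text \<open>\<open>exchange_coordinate\<close> in chart form: the new coordinate is \<phi> itself,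
  and the inverse restores the old one through G.\<close>

lemma nice_chart_exchange:
  assumes X: "smooth_atlas X" and D: "nice_chart X D c" "p \<in> D" and \<phi>: "\<phi> \<in> smooth_near X p"
    and i: "i < mdim X" and nz: "partial i (\<lambda>y. \<phi> (inv_into D c y)) (c p) \<noteq> 0"
  obtains D' c' where "nice_chart X D' c'" "p \<in> D'" "D' \<subseteq> D" "\<And>q. q \<in> D' \<Longrightarrow> c' q = (c q)(i := \<phi> q)"
proof -
  note d = nice_chartD[OF D(1)]
  let ?f = "\<lambda>y. \<phi> (inv_into D c y)"
  obtain V where V: "openin (Rn_top (mdim X)) V" "c p \<in> V" "V \<subseteq> c ` D" "smooth_Rn (mdim X) V ?f"
    using \<phi> unfolding nice_chart_near[OF X D] by blast
  let ?\<Psi> = "\<lambda>x. x(i := ?f x)"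
  obtain B G where B: "openin (Rn_top (mdim X)) B" "c p \<in> B" "B \<subseteq> V" "inj_on ?\<Psi> B"
    "openin (Rn_top (mdim X)) (?\<Psi> ` B)" "smooth_Rn (mdim X) (?\<Psi> ` B) G"
    "\<And>x. x \<in> B \<Longrightarrow> G (?\<Psi> x) = x i"
    by (rule exchange_coordinate[OF V(1,2,4) i nz]) blast
  have "nice_chart X {p \<in> D. c p \<in> B} (\<lambda>p. ?\<Psi> (c p))"
  proof (rule nice_chart_compose[where \<Theta> = "\<lambda>y. y(i := G y)", OF X D(1) B(1) _ B(5)])
    show "B \<subseteq> c ` D" using B(3) V(3) by auto
    show "smooth_Rn (mdim X) B (\<lambda>x. ?\<Psi> x j)" for j
      using smooth_Rn_subset[OF V(4) B(3)] by (cases "j = i") (auto intro: smooth_Rn_coord)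
    show "smooth_Rn (mdim X) (?\<Psi> ` B) (\<lambda>y. (y(i := G y)) j)" for j
      using B(6) by (cases "j = i") (auto intro: smooth_Rn_coord)
    show "(?\<Psi> x)(i := G (?\<Psi> x)) = x" if "x \<in> B" for x
      using B(7)[OF that] by simp
  qed
  then show thesis
    by (rule that) (use B(2) D(2) d(7) in auto)
qed

text \<open>This moves an exchanged coordinate into the next slot of the normal form; a
  transposition is its own inverse.\<close>

lemma nice_chart_transpose:
  assumes X: "smooth_atlas X" and D: "nice_chart X D c" and ij: "i < mdim X" "j < mdim X"
  shows "nice_chart X D (\<lambda>q. c q \<circ> Transposition.transpose i j)"
proof -
  note d = nice_chartD[OF D]
  let ?\<Psi> = "\<lambda>x :: nat \<Rightarrow> real. x \<circ> Transposition.transpose i j"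
  have inv: "?\<Psi> (?\<Psi> x) = x" for x by (auto simp: fun_eq_iff)
  have lt: "Transposition.transpose i j k < mdim X \<longleftrightarrow> k < mdim X" for k
    using ij by (auto simp: Transposition.transpose_def)
  have R: "?\<Psi> x \<in> Rn (mdim X)" if "x \<in> Rn (mdim X)" for x
    using that lt by (force simp: Rn_def not_less[symmetric])
  have s: "smooth_Rn (mdim X) V (\<lambda>x. ?\<Psi> x k)" for V k by (simp add: smooth_Rn_coord)
  have "?\<Psi> ` c ` D = {y \<in> Rn (mdim X). ?\<Psi> y \<in> c ` D}"
  proof (rule subset_antisym)
    show "?\<Psi> ` c ` D \<subseteq> {y \<in> Rn (mdim X). ?\<Psi> y \<in> c ` D}" using inv R d(6) by auto
    show "{y \<in> Rn (mdim X). ?\<Psi> y \<in> c ` D} \<subseteq> ?\<Psi> ` c ` D"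
    proof
      fix y assume "y \<in> {y \<in> Rn (mdim X). ?\<Psi> y \<in> c ` D}"
      then have "?\<Psi> (?\<Psi> y) \<in> ?\<Psi> ` c ` D" by blast
      then show "y \<in> ?\<Psi> ` c ` D" by (simp only: inv)
    qed
  qed
  moreover have "openin (Rn_top (mdim X)) {y \<in> Rn (mdim X). ?\<Psi> y \<in> c ` D}"
    by (rule openin_preimage_Rn[OF openin_Rn _ d(3) R])
      (auto intro!: continuous_on_into_Rn R smooth_Rn_continuous[OF s])
  ultimately have "openin (Rn_top (mdim X)) (?\<Psi> ` c ` D)" by simp
  from nice_chart_compose[OF X D d(3) subset_refl this s inv s]
  have "nice_chart X {p \<in> D. c p \<in> c ` D} (\<lambda>p. ?\<Psi> (c p))" .
  moreover have "{p \<in> D. c p \<in> c ` D} = D" by auto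
  ultimately show ?thesis by simp
qed

subsection \<open>Derivations and the normal form of submersions\<close>

lemma
  assumes v: "v \<in> tangent X p" and f: "f \<in> smooth_near X p" "g \<in> smooth_near X p"
  shows tangent_linear: "v (\<lambda>q. a * f q + b * g q) = a * v f + b * v g"
    and tangent_mult: "v (\<lambda>q. f q * g q) = f p * v g + g p * v f"
    and tangent_germ: "openin (mtop X) W \<Longrightarrow> p \<in> W \<Longrightarrow> (\<And>q. q \<in> W \<Longrightarrow> f q = g q) \<Longrightarrow> v f = v g"
  using assms unfolding tangent_def by blast+

lemma tangent_not_smooth: "v \<in> tangent X p \<Longrightarrow> f \<notin> smooth_near X p \<Longrightarrow> v f = 0"
  by (simp add: tangent_def)

lemma tangent_add:
  assumes "v \<in> tangent X p" "f \<in> smooth_near X p" "g \<in> smooth_near X p"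
  shows "v (\<lambda>q. f q + g q) = v f + v g"
  using tangent_linear[OF assms, of 1 1] by simp

lemma tangent_const:
  assumes X: "smooth_atlas X" and p: "p \<in> pts X" and v: "v \<in> tangent X p"
  shows "v (\<lambda>q. a) = 0"
proof -
  note c = smooth_near_const[OF X p]
  have "v (\<lambda>q. 1) = 0" using tangent_mult[OF v c c, of 1 1] by simp
  then show ?thesis using tangent_linear[OF v c c, of a 1 0 0] by simp
qed

lemma tangent_sum:
  assumes X: "smooth_atlas X" and p: "p \<in> pts X" and v: "v \<in> tangent X p" and J: "finite J"
    and f: "\<And>j. j \<in> J \<Longrightarrow> f j \<in> smooth_near X p"
  shows "v (\<lambda>q. \<Sum>j\<in>J. f j q) = (\<Sum>j\<in>J. v (f j))"
  using J f
proof (induction J)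
  case empty
  then show ?case using tangent_const[OF X p v] by simp
next
  case (insert j J)
  have "(\<lambda>q. \<Sum>j\<in>J. f j q) \<in> smooth_near X p"
    by (rule smooth_near_sum[OF X p]) (use insert in auto)
  then have "v (\<lambda>q. f j q + (\<Sum>j\<in>J. f j q)) = v (f j) + v (\<lambda>q. \<Sum>j\<in>J. f j q)"
    using tangent_add[OF v] insert.prems by simp
  then show ?case using insert by simp
qed

text \<open>Hadamard's expansion splits \<phi> near p into a constant and products of
  \<open>c q i - a i\<close> with \<open>h i (c q)\<close>. The first factor vanishes at p, so the
  product rule leaves the value of \<open>h i\<close> at a, which is the i-th partial
  derivative.\<close>

lemma tangent_expansion:
  assumes X: "smooth_atlas X" and D: "nice_chart X D c" "p \<in> D" and v: "v \<in> tangent X p"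
    and \<phi>: "\<phi> \<in> smooth_near X p"
  shows "v \<phi> = (\<Sum>i<mdim X. partial i (\<lambda>y. \<phi> (inv_into D c y)) (c p) * v (\<lambda>q. c q i))"
proof -
  note d = nice_chartD[OF D(1)]
  let ?n = "mdim X" and ?f = "\<lambda>y. \<phi> (inv_into D c y)"
  define a where "a = c p"
  have a: "a \<in> Rn ?n" using d(6) D(2) by (simp add: a_def)
  have p: "p \<in> pts X" using smooth_near_pts[OF X \<phi>] .
  obtain V where V: "openin (Rn_top ?n) V" "a \<in> V" "V \<subseteq> c ` D" "smooth_Rn ?n V ?f"
    using nice_chart_near[OF X D, THEN iffD1, OF \<phi>] unfolding a_def by blast
  obtain e where e: "e > 0" "Rn_box ?n a e \<subseteq> V" using V(1,2) unfolding openin_Rn_iff by blast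
  have f: "smooth_Rn ?n (Rn_box ?n a e) ?f" by (rule smooth_Rn_subset[OF V(4) e(2)])
  define h where "h i = hadamard_integral i a 0 (partial i ?f)" for i
  have h: "smooth_Rn ?n (Rn_box ?n a e) (h i)" if "i < ?n" for i
    unfolding h_def by (rule smooth_Rn_hadamard_integral[OF smooth_Rn_partial[OF openin_Rn_box f that] a that])
  have aB: "a \<in> Rn_box ?n a e" by (rule center_in_Rn_box[OF a e(1)])
  then have aB': "c p \<in> Rn_box ?n a e" by (simp only: a_def)
  have coord: "(\<lambda>q. c q i) \<in> smooth_near X p" if "i < ?n" for i by (rule d(4)[OF D(2) that])
  have H: "(\<lambda>q. h i (c q)) \<in> smooth_near X p" if "i < ?n" for i
    by (rule smooth_near_compose[where u = c and g = "h i",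
          OF X d(1) D(2) d(6) coord openin_Rn_box aB' h[OF that]])
  have diff: "(\<lambda>q. c q i - a i) \<in> smooth_near X p" if "i < ?n" for i
    using smooth_near_add[OF X coord[OF that] smooth_near_const[OF X p, of "- a i"]] by simp
  have vdiff: "v (\<lambda>q. c q i - a i) = v (\<lambda>q. c q i)" if "i < ?n" for i
    using tangent_add[OF v coord[OF that] smooth_near_const[OF X p, of "- a i"]]
      tangent_const[OF X p v] by simp
  let ?g = "\<lambda>i q. (c q i - a i) * h i (c q)"
  have g: "?g i \<in> smooth_near X p" if "i < ?n" for i
    by (rule smooth_near_mult[OF X diff[OF that] H[OF that]])
  have vg: "v (?g i) = partial i ?f a * v (\<lambda>q. c q i)" if "i < ?n" for i
    using tangent_mult[OF v diff[OF that] H[OF that]] vdiff[OF that]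
    by (simp add: a_def[symmetric] h_def hadamard_integral_center)
  have sum: "(\<lambda>q. \<Sum>i<?n. ?g i q) \<in> smooth_near X p"
    by (rule smooth_near_sum[OF X p]) (use g in auto)
  have W: "openin (mtop X) {q \<in> D. c q \<in> Rn_box ?n a e}"
    by (rule openin_sm_preimage[OF X smooth_atlas_euclidean d(1) smooth_at_into_euclidean[OF X d(1) _ d(6) d(4)]])
      (auto simp: openin_mtop_euclidean openin_Rn_box)
  have "v \<phi> = v (\<lambda>q. \<phi> p + (\<Sum>i<?n. ?g i q))"
  proof (rule tangent_germ[OF v \<phi> smooth_near_add[OF X smooth_near_const[OF X p] sum] W])
    show "p \<in> {q \<in> D. c q \<in> Rn_box ?n a e}" using D(2) aB by (simp add: a_def)
    fix q assume q: "q \<in> {q \<in> D. c q \<in> Rn_box ?n a e}"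
    have "?f (c q) = ?f a + (\<Sum>i<?n. (c q i - a i) * h i (c q))"
      unfolding h_def by (rule hadamard_expansion[OF _ a]) (use f q in \<open>auto simp: smooth_Rn_def\<close>)
    then show "\<phi> q = \<phi> p + (\<Sum>i<?n. ?g i q)" using q d(7) D(2) by (simp add: a_def)
  qed
  also have "\<dots> = (\<Sum>i<?n. v (?g i))"
    using tangent_add[OF v smooth_near_const[OF X p] sum] tangent_const[OF X p v]
      tangent_sum[OF X p v, of "{..<?n}" ?g] g by simp
  finally show ?thesis using vg by (simp add: a_def)
qed

text \<open>The coordinate derivation along the l-th coordinate, cut off to 0 on functions that are
  not smooth at y, as \<open>tangent\<close> demands.\<close>

lemma coordinate_tangent:
  assumes Y: "smooth_atlas Y" and E: "(E, e) \<in> charts Y" "y \<in> E" and l: "l < mdim Y"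
  obtains v where "v \<in> tangent Y y" "\<And>j. v (\<lambda>q. e q j) = (if j = l then 1 else 0)"
proof -
  let ?n = "mdim Y" and ?F = "\<lambda>f x. f (inv_into E e x)"
  define v where "v f = (if f \<in> smooth_near Y y then partial l (?F f) (e y) else 0)" for f
  have y: "?F f (e y) = f y" for f using chart_inv[OF Y E] by simp
  have hp: "has_partial l (?F f) (partial l (?F f) (e y)) (e y)" if f: "f \<in> smooth_near Y y" for f
  proof -
    obtain V where "openin (Rn_top ?n) V" "e y \<in> V" "smooth_Rn ?n V (?F f)"
      using smooth_near_chart[OF Y E, THEN iffD1, OF f] by blast
    then show ?thesis using smooth_Rn_has_partial l by blast
  qed
  have "v \<in> tangent Y y"
    unfolding tangent_def
  proof (intro CollectI conjI ballI allI impI)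
    fix f g assume f: "f \<in> smooth_near Y y" and g: "g \<in> smooth_near Y y"
    show "v f = v g" if W: "openin (mtop Y) W" "y \<in> W" "\<forall>q\<in>W. f q = g q" for W
    proof -
      have "partial l (?F f) (e y) = partial l (?F g) (e y)"
        by (rule partial_cong[OF openin_chart_image[OF Y E(1) W(1)] _ l])
          (use W E chart_inv[OF Y E(1)] in auto)
      then show ?thesis using f g by (simp add: v_def)
    qed
    show "v (\<lambda>q. a * f q + b * g q) = a * v f + b * v g" for a b
    proof -
      have s: "(\<lambda>q. a * f q + b * g q) \<in> smooth_near Y y"
        by (intro smooth_near_add smooth_near_mult smooth_near_const Y smooth_near_pts[OF Y f] f g)
      have "has_partial l (?F (\<lambda>q. a * f q + b * g q)) (a * partial l (?F f) (e y) + b * partial l (?F g) (e y)) (e y)"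
        using DERIV_add[OF DERIV_cmult[OF hp[OF f, unfolded has_partial_def]]
            DERIV_cmult[OF hp[OF g, unfolded has_partial_def]]] by (simp add: has_partial_def)
      then show ?thesis using s f g by (simp add: v_def partial_eq)
    qed
    have s: "(\<lambda>q. f q * g q) \<in> smooth_near Y y" by (rule smooth_near_mult[OF Y f g])
    have "has_partial l (?F (\<lambda>q. f q * g q)) (partial l (?F f) (e y) * g y + partial l (?F g) (e y) * f y) (e y)"
      using DERIV_mult[OF hp[OF f, unfolded has_partial_def] hp[OF g, unfolded has_partial_def]] y[of f] y[of g]
      by (simp add: has_partial_def)
    then show "v (\<lambda>q. f q * g q) = f y * v g + g y * v f"
      using s f g by (simp add: v_def partial_eq)
  qed (simp add: v_def)
  moreover have "v (\<lambda>q. e q j) = (if j = l then 1 else 0)" for j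
  proof -
    have "e y \<in> e ` E" using E(2) by simp
    have "partial l (?F (\<lambda>q. e q j)) (e y) = partial l (\<lambda>x. x j) (e y)"
      by (rule partial_cong[OF chart_open[OF Y E(1)] _ l]) (use E(2) chart_inv[OF Y E(1)] in auto)
    also have "\<dots> = (if j = l then 1 else 0)"
      by (rule partial_eq) (auto simp: has_partial_def)
    finally show ?thesis using chart_coord_smooth[OF Y E] by (simp add: v_def)
  qed
  ultimately show thesis by (rule that)
qed

section \<open>Submersions in normal form\<close>

text \<open>The local normal form of a submersion, for every chart of the target: in compatible
  coordinates the map is the projection to the first \<open>mdim Y\<close> coordinates. The
  inequality of dimensions turns the truncated subtraction in \<open>comp_bisub\<close> into a true
  one.\<close>

definition straight :: "'a smfd \<Rightarrow> 'b smfd \<Rightarrow> ('a \<Rightarrow> 'b) \<Rightarrow> bool" where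
  "straight X Y f \<longleftrightarrow> (\<forall>p \<in> pts X. smooth_at X Y f p \<and>
     (\<forall>(E, e) \<in> charts Y. f p \<in> E \<longrightarrow> (\<exists>D c. nice_chart X D c \<and> p \<in> D \<and> f ` D \<subseteq> E \<and>
        mdim Y \<le> mdim X \<and> (\<forall>q\<in>D. \<forall>i<mdim Y. c q i = e (f q) i))))"

lemma straight_chart:
  assumes "straight X Y f" "p \<in> pts X" "(E, e) \<in> charts Y" "f p \<in> E"
  obtains D c where "nice_chart X D c" "p \<in> D" "f ` D \<subseteq> E" "mdim Y \<le> mdim X"
    "\<And>q i. q \<in> D \<Longrightarrow> i < mdim Y \<Longrightarrow> c q i = e (f q) i"
proof -
  from assms(1,2) have "\<forall>(E, e) \<in> charts Y. f p \<in> E \<longrightarrow> (\<exists>D c. nice_chart X D c \<and> p \<in> D \<and>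
      f ` D \<subseteq> E \<and> mdim Y \<le> mdim X \<and> (\<forall>q\<in>D. \<forall>i<mdim Y. c q i = e (f q) i))"
    by (simp add: straight_def)
  from bspec[OF this assms(3)] assms(4) obtain D c where "nice_chart X D c" "p \<in> D" "f ` D \<subseteq> E"
    "mdim Y \<le> mdim X" "\<forall>q\<in>D. \<forall>i<mdim Y. c q i = e (f q) i" by auto
  then show thesis using that by simp
qed

lemma straight_smooth_at: "straight X Y f \<Longrightarrow> p \<in> pts X \<Longrightarrow> smooth_at X Y f p"
  by (simp add: straight_def)

text \<open>The coordinates of f are put into a chart one slot at a time. Surjectivity of the
  differential gives v dual to the next coordinate of f. It kills the l coordinates already placed,
  so its expansion shows a non-zero partial derivative in some free slot i, where the exchange
  applies.\<close>

lemma submersion_straight: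
  assumes X: "smooth_atlas X" and Y: "smooth_atlas Y" and f: "submersion X Y f"
  shows "straight X Y f"
  unfolding straight_def
proof (intro ballI conjI, safe)
  fix p assume p: "p \<in> pts X"
  show sm: "smooth_at X Y f p"
    using f p smooth_map_iff[OF X Y, of f] by (simp add: submersion_def)
  fix E e assume E: "(E, e) \<in> charts Y" "f p \<in> E"
  have "\<exists>D c. nice_chart X D c \<and> p \<in> D \<and> f ` D \<subseteq> E \<and>
        l \<le> mdim X \<and> (\<forall>q\<in>D. \<forall>i<l. c q i = e (f q) i)" if "l \<le> mdim Y" for l
    using that
  proof (induction l)
    case 0
    obtain W where W: "openin (mtop X) W" "p \<in> W" "f ` W \<subseteq> E"
      by (rule smooth_at_openin[OF X Y sm openin_chart_domain[OF Y E(1)] E(2)])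
    obtain D c where D: "(D, c) \<in> charts X" "p \<in> D" using p by (rule ptsE)
    show ?case
      using nice_chart_restrict[OF X nice_chart_chart[OF X D(1)] W(1)] D(2) W
      by (intro exI[of _ "D \<inter> W"] exI[of _ c]) auto
  next
    case (Suc l)
    then obtain D c where D: "nice_chart X D c" "p \<in> D" and fD: "f ` D \<subseteq> E" "l \<le> mdim X"
      and c: "\<And>q i. q \<in> D \<Longrightarrow> i < l \<Longrightarrow> c q i = e (f q) i" by auto
    note d = nice_chartD[OF D(1)]
    let ?\<phi> = "\<lambda>q. e (f q) l"
    have coordY: "(\<lambda>y. e y j) \<in> smooth_near Y (f p)" for j by (rule chart_coord_smooth[OF Y E])
    have sm\<phi>: "(\<lambda>q. e (f q) j) \<in> smooth_near X p" for j by (rule sm_atD[OF sm coordY])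
    obtain w where w: "w \<in> tangent Y (f p)" "\<And>j. w (\<lambda>y. e y j) = (if j = l then 1 else 0)"
      by (rule coordinate_tangent[OF Y E, of l]) (use Suc.prems in auto)
    have "w \<in> tmap Y f p ` tangent X p" using f p w(1) by (simp add: submersion_def)
    then obtain v where v: "v \<in> tangent X p" "tmap Y f p v = w" by blast
    have ve: "v (\<lambda>q. e (f q) j) = (if j = l then 1 else 0)" for j
      using coordY[of j] w(2)[of j] v(2) by (auto simp: tmap_def comp_def)
    have vc: "v (\<lambda>q. c q i) = 0" if "i < l" for i
    proof -
      have "v (\<lambda>q. c q i) = v (\<lambda>q. e (f q) i)"
        by (rule tangent_germ[OF v(1) d(4)[OF D(2)] sm\<phi> d(1) D(2)]) (use that fD c in auto)
      then show ?thesis using ve that by simp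
    qed
    let ?a = "\<lambda>i. partial i (\<lambda>y. ?\<phi> (inv_into D c y)) (c p)"
    \<comment> \<open>The sum is v applied to the l-th coordinate of f, which is 1.\<close>
    have "(\<Sum>i<mdim X. ?a i * v (\<lambda>q. c q i)) \<noteq> 0"
      using tangent_expansion[OF X D v(1) sm\<phi>[of l]] ve[of l] by simp
    then obtain i where "i < mdim X" "?a i * v (\<lambda>q. c q i) \<noteq> 0"
      by (meson lessThan_iff sum.not_neutral_contains_not_neutral)
    \<comment> \<open>As i is at least l, neither the exchange nor the swap of i with l touches the
      slots below l; moreover l < \<open>mdim X\<close> follows.\<close>
    then have i: "i < mdim X" "?a i \<noteq> 0" "l \<le> i" using vc[of i] by (auto simp: not_less[symmetric])
    obtain D' c' where D': "nice_chart X D' c'" "p \<in> D'" "D' \<subseteq> D"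
      "\<And>q. q \<in> D' \<Longrightarrow> c' q = (c q)(i := ?\<phi> q)"
      by (rule nice_chart_exchange[OF X D sm\<phi> i(1,2)]) blast
    define c'' where "c'' q = c' q \<circ> Transposition.transpose i l" for q
    have "nice_chart X D' c''" unfolding c''_def[abs_def]
      by (rule nice_chart_transpose[OF X D'(1)]) (use i in auto)
    moreover have "c'' q j = e (f q) j" if "q \<in> D'" "j < Suc l" for q j
    proof (cases "j = l")
      case True
      then show ?thesis using D'(4)[OF that(1)] by (simp add: c''_def)
    next
      case False
      then have "j < l" using that by simp
      then show ?thesis using D'(3,4) that(1) c[of q j] i(3) by (auto simp: c''_def)
    qed
    moreover have "f ` D' \<subseteq> E" using D'(3) fD(1) by blast
    ultimately show ?case using D'(2) i(1,3) by (intro exI[of _ D'] exI[of _ c'']) simp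
  qed
  from this[of "mdim Y"] show "\<exists>D c. nice_chart X D c \<and> p \<in> D \<and> f ` D \<subseteq> E \<and>
        mdim Y \<le> mdim X \<and> (\<forall>q\<in>D. \<forall>i<mdim Y. c q i = e (f q) i)" by simp
qed

abbreviation fibre_product :: "'u smfd \<Rightarrow> ('u \<Rightarrow> 'a) \<Rightarrow> 'v smfd \<Rightarrow> ('v \<Rightarrow> 'a) \<Rightarrow> ('u \<times> 'v) set" where
  "fibre_product U f V g \<equiv> {(u, v). u \<in> pts U \<and> v \<in> pts V \<and> f u = g v}"

text \<open>The first \<open>mdim X\<close> coordinates of u in \<alpha> are those of f u = g v, so
  a point (u, v) is determined by v and the remaining coordinates of u. \<Gamma> rebuilds the
  coordinates of u, and \<Lambda> the point. The coordinates of v come first so that a normal form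
  on V passes to the fibre product.\<close>

lemma fibre_product_chart:
  fixes U :: "'u smfd" and V :: "'v smfd" and X :: "'a smfd"
  assumes U: "smooth_atlas U" and V: "smooth_atlas V" and X: "smooth_atlas X"
    and A: "nice_chart U A \<alpha>" and B: "nice_chart V B \<beta>" and E: "(E, e) \<in> charts X"
    and fA: "f ` A \<subseteq> E" and m: "mdim X \<le> mdim U"
    and \<alpha>: "\<And>q i. q \<in> A \<Longrightarrow> i < mdim X \<Longrightarrow> \<alpha> q i = e (f q) i"
    and g: "\<And>v. v \<in> B \<Longrightarrow> smooth_at V X g v"
  shows "({z \<in> fibre_product U f V g. fst z \<in> A \<and> snd z \<in> B},
      \<lambda>z. glue (mdim V) (\<beta> (snd z)) (prj2 (mdim X) (\<alpha> (fst z))))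
    \<in> charts (sub_mfd (prod_mfd U V) (fibre_product U f V g) (mdim U + mdim V - mdim X))"
proof -
  note UV = smooth_atlas_prod_mfd[OF U V] and a = nice_chartD[OF A] and b = nice_chartD[OF B]
  note eu = smooth_atlas_euclidean
  define k where "k = mdim U - mdim X"
  define S where "S = fibre_product U f V g"
  define D where "D = {z \<in> S. fst z \<in> A \<and> snd z \<in> B}"
  define c where "c z = glue (mdim V) (\<beta> (snd z)) (prj2 (mdim X) (\<alpha> (fst z)))" for z
  \<comment> \<open>By \<open>mdim X \<le> mdim U\<close> the subtraction of dimensions is not
    truncated.\<close>
  have dU: "mdim U = mdim X + k" and d: "mdim U + mdim V - mdim X = mdim V + k"
    using m by (auto simp: k_def)
  let ?d = "mdim V + k"
  have Apts: "A \<subseteq> pts U" "B \<subseteq> pts V"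
    using openin_mtop_subset[OF U a(1)] openin_mtop_subset[OF V b(1)] by auto
  \<comment> \<open>The coordinates e of g v make sense only inside E. Restricting v to B0 loses no
    point of D, because f maps A into E.\<close>
  define B0 where "B0 = {v \<in> B. g v \<in> E}"
  have B0: "openin (mtop V) B0" unfolding B0_def
    by (rule openin_sm_preimage[OF V X b(1) g openin_chart_domain[OF X E]])
  have "openin (Rn_top (mdim V)) (\<beta> ` (B \<inter> B0))" by (rule nice_chart_image_open[OF V B B0])
  moreover have "B \<inter> B0 = B0" by (auto simp: B0_def)
  ultimately have \<beta>B0: "openin (Rn_top (mdim V)) (\<beta> ` B0)" by simp
  define O1 where "O1 = {w \<in> Rn ?d. prj1 (mdim V) w \<in> \<beta> ` B0}"
  have O1: "openin (Rn_top ?d) O1" unfolding O1_def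
    by (rule openin_preimage_Rn[OF openin_Rn continuous_on_prj(1) \<beta>B0 prj1_in_Rn])
  have O1R: "O1 \<subseteq> Rn ?d" by (auto simp: O1_def)
  let ?v = "\<lambda>w. inv_into B \<beta> (prj1 (mdim V) w)"
  have v_in: "?v w \<in> B0" "\<beta> (?v w) = prj1 (mdim V) w" if "w \<in> O1" for w
  proof -
    from that obtain v where v: "v \<in> B0" "prj1 (mdim V) w = \<beta> v" by (auto simp: O1_def)
    then have "v \<in> B" by (simp add: B0_def)
    then show "?v w \<in> B0" "\<beta> (?v w) = prj1 (mdim V) w" using v b(7) by auto
  qed
  have sm_v: "smooth_at (euclidean_mfd ?d) V ?v w" if w: "w \<in> O1" for w
  proof (rule smooth_at_compose[where f = "prj1 (mdim V)" and g = "inv_into B \<beta>"])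
    show "smooth_at (euclidean_mfd ?d) (euclidean_mfd (mdim V)) (prj1 (mdim V)) w"
      by (rule smooth_at_euclidean[OF O1 w prj1_in_Rn smooth_Rn_prj(1)])
    show "smooth_at (euclidean_mfd (mdim V)) V (inv_into B \<beta>) (prj1 (mdim V) w)"
      by (rule b(5)) (use w in \<open>auto simp: O1_def B0_def\<close>)
  qed
  have sm_g: "smooth_at (euclidean_mfd ?d) X (\<lambda>w. g (?v w)) w" if w: "w \<in> O1" for w
    by (rule smooth_at_compose[where f = ?v and g = g, OF sm_v[OF w] g])
      (use v_in(1)[OF w] in \<open>simp add: B0_def\<close>)
  define \<Gamma> where "\<Gamma> w = glue (mdim X) (e (g (?v w))) (prj2 (mdim V) w)" for w
  have \<Gamma>R: "\<Gamma> w \<in> Rn (mdim U)" if "w \<in> O1" for w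
    unfolding \<Gamma>_def dU by (rule glue_in_Rn, rule prj2_in_Rn) (use that O1R in auto)
  have sm_\<Gamma>: "smooth_at (euclidean_mfd ?d) (euclidean_mfd (mdim U)) \<Gamma> w" if w: "w \<in> O1" for w
  proof (rule smooth_at_into_euclidean[OF eu, where W = O1])
    show "openin (mtop (euclidean_mfd ?d)) O1" using O1 by (simp add: openin_mtop_euclidean)
    fix i
    show "(\<lambda>w. \<Gamma> w i) \<in> smooth_near (euclidean_mfd ?d) w"
    proof (cases "i < mdim X")
      case True
      have "(\<lambda>w. e (g (?v w)) i) \<in> smooth_near (euclidean_mfd ?d) w"
        by (rule sm_atD[OF sm_g[OF w] chart_coord_smooth[OF X E]])
          (use v_in(1)[OF w] in \<open>simp add: B0_def\<close>)
      then show ?thesis using True by (simp add: \<Gamma>_def glue_def)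
    next
      case False
      have "w \<in> Rn ?d" using w O1R by auto
      then show ?thesis using False O1 w smooth_Rn_prj(2)[of ?d O1 "mdim V" "i - mdim X"]
        by (auto simp: \<Gamma>_def glue_def smooth_near_euclidean)
    qed
  qed (use w \<Gamma>R in auto)
  \<comment> \<open>This is the image of the chart: the rebuilt coordinates of u have to lie in the
    range of \<alpha>.\<close>
  define O2 where "O2 = {w \<in> O1. \<Gamma> w \<in> \<alpha> ` A}"
  have O2: "openin (Rn_top ?d) O2"
    using openin_sm_preimage[OF eu eu _ sm_\<Gamma>, of O1 "\<alpha> ` A"] O1 a(3)
    by (simp add: openin_mtop_euclidean O2_def)
  define \<Lambda> where "\<Lambda> w = (inv_into A \<alpha> (\<Gamma> w), ?v w)" for w
  have sm_\<Lambda>: "smooth_at (euclidean_mfd ?d) (prod_mfd U V) \<Lambda> w" if w: "w \<in> O2" for w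
    unfolding \<Lambda>_def
  proof (rule smooth_at_Pair[OF U V eu])
    show "smooth_at (euclidean_mfd ?d) U (\<lambda>w. inv_into A \<alpha> (\<Gamma> w)) w"
      by (rule smooth_at_compose[where f = \<Gamma> and g = "inv_into A \<alpha>"])
        (use w sm_\<Gamma> a(5) in \<open>auto simp: O2_def\<close>)
    show "smooth_at (euclidean_mfd ?d) V ?v w" using w by (intro sm_v) (simp add: O2_def)
  qed
  have E_prj1: "prj1 (mdim X) (\<alpha> u) = e (f u)" if "u \<in> A" for u
  proof
    fix i
    have "e (f u) \<in> Rn (mdim X)" using chart_in_Rn[OF X E] fA that by auto
    then show "prj1 (mdim X) (\<alpha> u) i = e (f u) i"
      using \<alpha>[OF that] by (auto simp: prj1_def Rn_def)
  qed
  have \<Lambda>c: "\<Lambda> (c z) = z" "c z \<in> O2" if z: "z \<in> D" for z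
  proof -
    have z': "fst z \<in> A" "snd z \<in> B" "f (fst z) = g (snd z)"
      using z by (auto simp: D_def S_def)
    have p1: "prj1 (mdim V) (c z) = \<beta> (snd z)" using b(6)[OF z'(2)] by (simp add: c_def prj1_glue)
    have vz: "?v (c z) = snd z" using b(7)[OF z'(2)] p1 by simp
    have \<Gamma>z: "\<Gamma> (c z) = \<alpha> (fst z)"
      using E_prj1[OF z'(1)] z'(3) glue_prj[of "mdim X" "\<alpha> (fst z)"]
      by (simp add: \<Gamma>_def vz) (simp add: c_def prj2_glue)
    show "\<Lambda> (c z) = z" by (simp add: \<Lambda>_def vz \<Gamma>z a(7)[OF z'(1)])
    have "prj2 (mdim X) (\<alpha> (fst z)) \<in> Rn k"
      by (rule prj2_in_Rn) (use a(6)[OF z'(1)] dU in simp)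
    then have "c z \<in> Rn ?d" unfolding c_def by (rule glue_in_Rn)
    moreover have "snd z \<in> B0" using z' fA by (auto simp: B0_def)
    ultimately show "c z \<in> O2" using p1 \<Gamma>z z'(1) by (auto simp: O2_def O1_def)
  qed
  have c\<Lambda>: "\<Lambda> w \<in> D" "c (\<Lambda> w) = w" if w: "w \<in> O2" for w
  proof -
    have w1: "w \<in> O1" using w by (simp add: O2_def)
    from w obtain u where u: "u \<in> A" "\<Gamma> w = \<alpha> u" by (auto simp: O2_def)
    have \<Lambda>w: "\<Lambda> w = (u, ?v w)" using a(7) u by (simp add: \<Lambda>_def)
    have gE: "g (?v w) \<in> E" "?v w \<in> B" using v_in(1)[OF w1] by (auto simp: B0_def)
    have "e (f u) = e (g (?v w))"
      using E_prj1[OF u(1)] chart_in_Rn[OF X E gE(1)] unfolding u(2)[symmetric]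
      by (simp add: \<Gamma>_def prj1_glue)
    then have "f u = g (?v w)"
      using chart_inj[OF X E] fA u(1) gE(1) by (auto simp: inj_on_def)
    then show "\<Lambda> w \<in> D" using u(1) gE Apts by (auto simp: \<Lambda>w D_def S_def)
    have "prj2 (mdim X) (\<alpha> u) = prj2 (mdim V) w"
      unfolding u(2)[symmetric] by (simp add: \<Gamma>_def prj2_glue)
    then show "c (\<Lambda> w) = w"
      using v_in(2)[OF w1] glue_prj by (simp add: c_def \<Lambda>w)
  qed
  have im: "c ` D = O2"
  proof
    show "c ` D \<subseteq> O2" using \<Lambda>c(2) by auto
    show "O2 \<subseteq> c ` D" using c\<Lambda> by (metis image_eqI subsetI)
  qed
  have inj: "inj_on c D" by (rule inj_on_inverseI[where g = \<Lambda>]) (rule \<Lambda>c(1))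
  have inv: "inv_into D c w = \<Lambda> w" if "w \<in> O2" for w
    by (rule inv_into_f_eq[OF inj c\<Lambda>[OF that]])
  have "(D, c) \<in> charts (sub_mfd (prod_mfd U V) S ?d)"
    unfolding charts_sub_mfd_iff[OF UV]
  proof (intro conjI ballI allI impI)
    have "openin (mtop (prod_mfd U V)) {z \<in> pts (prod_mfd U V). fst z \<in> A}"
      by (rule openin_sm_preimage[OF UV U openin_pts[OF UV] smooth_at_fst[OF U V] a(1)])
    moreover have "openin (mtop (prod_mfd U V)) {z \<in> pts (prod_mfd U V). snd z \<in> B}"
      by (rule openin_sm_preimage[OF UV V openin_pts[OF UV] smooth_at_snd[OF U V] b(1)])
    ultimately have AB: "openin (mtop (prod_mfd U V)) ({z \<in> pts (prod_mfd U V). fst z \<in> A} \<inter>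
        {z \<in> pts (prod_mfd U V). snd z \<in> B})" by (rule openin_Int)
    moreover have "D = ({z \<in> pts (prod_mfd U V). fst z \<in> A} \<inter>
        {z \<in> pts (prod_mfd U V). snd z \<in> B}) \<inter> S"
      by (auto simp: D_def S_def pts_prod_mfd)
    ultimately show "openin (subtopology (mtop (prod_mfd U V)) S) D"
      by (auto simp: openin_subtopology)
    show "inj_on c D" by (rule inj)
    show "openin (Rn_top ?d) (c ` D)" unfolding im by (rule O2)
    show "smooth_at (euclidean_mfd ?d) (prod_mfd U V) (inv_into D c) y" if "y \<in> c ` D" for y
    proof (rule smooth_at_cong[OF eu _ _ _ sm_\<Lambda>])
      show "openin (mtop (euclidean_mfd ?d)) O2" using O2 by (simp add: openin_mtop_euclidean)
    qed (use that im inv in auto)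
    fix z i assume z: "z \<in> D" and i: "i < ?d"
    then have z': "fst z \<in> A" "snd z \<in> B" by (auto simp: D_def)
    have zp: "z \<in> pts (prod_mfd U V)" using z' Apts by (auto simp: pts_prod_mfd mem_Times_iff)
    have "(\<lambda>z. c z i) \<in> smooth_near (prod_mfd U V) z"
    proof (cases "i < mdim V")
      case True
      then show ?thesis using sm_atD[OF smooth_at_snd[OF U V zp] b(4)[OF z'(2) True]]
        by (simp add: c_def glue_def)
    next
      case False
      then have "i - mdim V + mdim X < mdim U" using i dU by auto
      from sm_atD[OF smooth_at_fst[OF U V zp] a(4)[OF z'(1) this]] False show ?thesis
        by (simp add: c_def glue_def prj2_def)
    qed
    then show "\<exists>W f. openin (mtop (prod_mfd U V)) W \<and> z \<in> W \<and> f \<in> smooth_near (prod_mfd U V) z \<and>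
        (\<forall>q\<in>W \<inter> D. f q = c q i)"
      using openin_pts[OF UV] zp by blast
  qed
  then show ?thesis by (simp add: D_def S_def c_def[abs_def] d)
qed

subsection \<open>Fibre products and germ classes\<close>

text \<open>\<open>fibre_product_chart\<close> supplies a chart at every composable pair. Thus a
  pair with matching ends is a point of the composition, which the definition of
  \<open>sub_mfd\<close> does not give by itself.\<close>

lemma pts_fibre_product:
  fixes U :: "'u smfd" and V :: "'v smfd" and X :: "'a smfd"
  assumes U: "smooth_atlas U" and V: "smooth_atlas V" and X: "smooth_atlas X"
    and f: "straight U X f" and g: "\<And>v. v \<in> pts V \<Longrightarrow> smooth_at V X g v"
  shows "pts (sub_mfd (prod_mfd U V) (fibre_product U f V g) (mdim U + mdim V - mdim X)) =
    fibre_product U f V g"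
proof
  show "pts (sub_mfd (prod_mfd U V) (fibre_product U f V g) (mdim U + mdim V - mdim X)) \<subseteq>
    fibre_product U f V g"
    using pts_sub_mfd_subset[OF smooth_atlas_prod_mfd[OF U V]] by blast
  show "fibre_product U f V g \<subseteq>
      pts (sub_mfd (prod_mfd U V) (fibre_product U f V g) (mdim U + mdim V - mdim X))"
  proof
    fix z assume z: "z \<in> fibre_product U f V g"
    then have z': "fst z \<in> pts U" "snd z \<in> pts V" by auto
    obtain E e where E: "(E, e) \<in> charts X" "f (fst z) \<in> E"
      by (rule ptsE[OF smooth_at_pts(2)[OF straight_smooth_at[OF f z'(1)]]])
    obtain A \<alpha> where A: "nice_chart U A \<alpha>" "fst z \<in> A" "f ` A \<subseteq> E" "mdim X \<le> mdim U"
      "\<And>q i. q \<in> A \<Longrightarrow> i < mdim X \<Longrightarrow> \<alpha> q i = e (f q) i"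
      by (rule straight_chart[OF f z'(1) E]) blast
    obtain B \<beta> where B: "(B, \<beta>) \<in> charts V" "snd z \<in> B" using z'(2) by (rule ptsE)
    have "\<And>v. v \<in> B \<Longrightarrow> smooth_at V X g v" using g chart_subset_pts[OF B(1)] by blast
    from fibre_product_chart[where f = f and g = g,
        OF U V X A(1) nice_chart_chart[OF V B(1)] E(1) A(3,4,5) this]
    show "z \<in> pts (sub_mfd (prod_mfd U V) (fibre_product U f V g) (mdim U + mdim V - mdim X))"
      by (rule ptsI) (use z A(2) B(2) in auto)
  qed
qed

text \<open>The chart of \<open>fibre_product_chart\<close> begins with \<beta>, so a \<beta> that
  is straight for k makes it straight for k after the projection to V.\<close>

lemma straight_fibre_product:
  fixes U :: "'u smfd" and V :: "'v smfd" and X :: "'a smfd"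
  assumes U: "smooth_atlas U" and V: "smooth_atlas V" and X: "smooth_atlas X"
    and f: "straight U X f" and g: "\<And>v. v \<in> pts V \<Longrightarrow> smooth_at V X g v" and k: "straight V X k"
  shows "straight (sub_mfd (prod_mfd U V) (fibre_product U f V g) (mdim U + mdim V - mdim X)) X
    (\<lambda>z. k (snd z))" (is "straight ?Z X _")
  unfolding straight_def
proof (intro ballI conjI, safe)
  note UV = smooth_atlas_prod_mfd[OF U V]
  fix u v assume z: "(u, v) \<in> pts ?Z"
  have "pts ?Z = fibre_product U f V g" by (rule pts_fibre_product[OF U V X f g])
  then have z': "(u, v) \<in> fibre_product U f V g" using z by simp
  then have uv: "u \<in> pts U" "v \<in> pts V" "(u, v) \<in> pts (prod_mfd U V)"
    by (auto simp: pts_prod_mfd)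
  have "smooth_at ?Z V snd (u, v)"
    by (rule smooth_at_compose[where f = "\<lambda>q. q" and g = snd, OF smooth_at_sub_mfd_dom[OF UV z]
          smooth_at_snd[OF U V uv(3)]])
  then show "smooth_at ?Z X (\<lambda>z. k (snd z)) (u, v)"
    by (rule smooth_at_compose[where f = snd and g = k]) (use straight_smooth_at[OF k uv(2)] in simp)
  fix E' e' assume E': "(E', e') \<in> charts X" "k (snd (u, v)) \<in> E'"
  obtain E e where E: "(E, e) \<in> charts X" "f u \<in> E"
    by (rule ptsE[OF smooth_at_pts(2)[OF straight_smooth_at[OF f uv(1)]]])
  obtain A \<alpha> where A: "nice_chart U A \<alpha>" "u \<in> A" "f ` A \<subseteq> E" "mdim X \<le> mdim U"
    "\<And>q i. q \<in> A \<Longrightarrow> i < mdim X \<Longrightarrow> \<alpha> q i = e (f q) i"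
    by (rule straight_chart[OF f uv(1) E]) blast
  have "k v \<in> E'" using E'(2) by simp
  then obtain B \<beta> where B: "nice_chart V B \<beta>" "v \<in> B" "k ` B \<subseteq> E'" "mdim X \<le> mdim V"
    "\<And>q i. q \<in> B \<Longrightarrow> i < mdim X \<Longrightarrow> \<beta> q i = e' (k q) i"
    by (rule straight_chart[OF k uv(2) E'(1)]) blast
  have "\<And>v. v \<in> B \<Longrightarrow> smooth_at V X g v"
    using g openin_mtop_subset[OF V nice_chartD(1)[OF B(1)]] by blast
  note C = fibre_product_chart[where f = f and g = g, OF U V X A(1) B(1) E(1) A(3,4,5) this]
  let ?D = "{z \<in> fibre_product U f V g. fst z \<in> A \<and> snd z \<in> B}"
  let ?c = "\<lambda>z. glue (mdim V) (\<beta> (snd z)) (prj2 (mdim X) (\<alpha> (fst z)))"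
  have "nice_chart ?Z ?D ?c" by (rule nice_chart_chart[OF smooth_atlas_sub_mfd[OF UV] C])
  moreover have "(u, v) \<in> ?D" using z' A(2) B(2) by simp
  moreover have "(\<lambda>z. k (snd z)) ` ?D \<subseteq> E'" using B(3) by auto
  moreover have "\<forall>q\<in>?D. \<forall>i<mdim X. ?c q i = e' (k (snd q)) i"
    using B(4,5) by (auto simp: glue_def)
  moreover have "mdim X \<le> mdim ?Z" using A(4) B(4) by simp
  ultimately show "\<exists>D c. nice_chart ?Z D c \<and> (u, v) \<in> D \<and> (\<lambda>z. k (snd z)) ` D \<subseteq> E' \<and>
      mdim X \<le> mdim ?Z \<and> (\<forall>q\<in>D. \<forall>i<mdim X. c q i = e' (k (snd q)) i)"
    by (intro exI[of _ ?D] exI[of _ ?c] conjI)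
qed

lemma nice_chart_image_mfd:
  assumes X: "smooth_atlas X" and h: "inj_on h (pts X)" and D: "nice_chart X D c"
  shows "nice_chart (image_mfd h X) (h ` D) (\<lambda>y. c (inv_into (pts X) h y))"
  unfolding nice_chart_def mdim_image_mfd
proof (intro conjI ballI allI impI)
  note d = nice_chartD[OF D] and Y = smooth_atlas_image_mfd[OF X h]
  have sub: "D \<subseteq> pts X" by (rule openin_mtop_subset[OF X d(1)])
  have hi: "inv_into (pts X) h (h p) = p" if "p \<in> pts X" for p using h that by simp
  have im: "(\<lambda>y. c (inv_into (pts X) h y)) ` h ` D = c ` D" by (rule image_chart_image[OF h sub])
  have smi: "smooth_at (image_mfd h X) X (inv_into (pts X) h) (h p)" if "p \<in> pts X" for p
    unfolding smooth_at_image_mfd_dom[OF X h that]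
    by (rule smooth_at_cong[OF X openin_pts[OF X] that _ smooth_at_id[OF that]]) (simp add: hi)
  have "openin (mtop (image_mfd h X)) {y \<in> pts (image_mfd h X). inv_into (pts X) h y \<in> D}"
    by (rule openin_sm_preimage[OF Y X openin_pts[OF Y] _ d(1)]) (use smi in \<open>auto simp: pts_image_mfd\<close>)
  moreover have "{y \<in> pts (image_mfd h X). inv_into (pts X) h y \<in> D} = h ` D"
    using sub hi by (auto simp: pts_image_mfd)
  ultimately show "openin (mtop (image_mfd h X)) (h ` D)" by simp
  show inj: "inj_on (\<lambda>y. c (inv_into (pts X) h y)) (h ` D)"
    using d(2) hi sub by (auto simp: inj_on_def subset_iff)
  show "openin (Rn_top (mdim X)) ((\<lambda>y. c (inv_into (pts X) h y)) ` h ` D)"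
    unfolding im by (rule d(3))
  show "(\<lambda>y. c (inv_into (pts X) h y) i) \<in> smooth_near (image_mfd h X) y"
    if y: "y \<in> h ` D" and i: "i < mdim X" for y i
  proof -
    from y obtain p where p: "p \<in> D" "y = h p" by auto
    then have pp: "p \<in> pts X" using sub by auto
    show ?thesis unfolding p(2)
      by (rule sm_atD[OF smi[OF pp], of "\<lambda>q. c q i"]) (simp add: hi[OF pp] d(4)[OF p(1) i])
  qed
  fix y assume "y \<in> (\<lambda>y. c (inv_into (pts X) h y)) ` h ` D"
  then have y: "y \<in> c ` D" unfolding im .
  show "smooth_at (euclidean_mfd (mdim X)) (image_mfd h X)
      (inv_into (h ` D) (\<lambda>y. c (inv_into (pts X) h y))) y"
  proof (rule smooth_at_cong[OF smooth_atlas_euclidean _ y])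
    show "openin (mtop (euclidean_mfd (mdim X))) (c ` D)" using d(3) by (simp add: openin_mtop_euclidean)
    show "smooth_at (euclidean_mfd (mdim X)) (image_mfd h X) (\<lambda>y. h (inv_into D c y)) y"
      by (rule smooth_at_compose[where f = "inv_into D c" and g = h, OF d(5)[OF y] smooth_at_image_mfd[OF X h]])
        (use y sub d(7) in auto)
    show "h (inv_into D c z) = inv_into (h ` D) (\<lambda>y. c (inv_into (pts X) h y)) z" if "z \<in> c ` D" for z
    proof -
      from that obtain p where p: "p \<in> D" "z = c p" by auto
      then have "p \<in> pts X" using sub by auto
      then show ?thesis using inv_into_f_f[OF inj, of "h p"] p d(7)[OF p(1)] hi by simp
    qed
  qed
qed

lemma straight_image_mfd:
  assumes X: "smooth_atlas X" and h: "inj_on h (pts X)" and f: "straight X Y (\<lambda>q. f (h q))"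
  shows "straight (image_mfd h X) Y f"
  unfolding straight_def
proof (intro ballI conjI, safe)
  fix y assume "y \<in> pts (image_mfd h X)"
  then obtain p where p: "p \<in> pts X" "y = h p" by (auto simp: pts_image_mfd)
  show "smooth_at (image_mfd h X) Y f y"
    unfolding p(2) smooth_at_image_mfd_dom[OF X h p(1)] by (rule straight_smooth_at[OF f p(1)])
  fix E e assume E: "(E, e) \<in> charts Y" "f y \<in> E"
  obtain D c where D: "nice_chart X D c" "p \<in> D" "(\<lambda>q. f (h q)) ` D \<subseteq> E" "mdim Y \<le> mdim X"
    "\<And>q i. q \<in> D \<Longrightarrow> i < mdim Y \<Longrightarrow> c q i = e (f (h q)) i"
    by (rule straight_chart[OF f p(1) E(1)]) (use E(2) p(2) in auto)
  have sub: "D \<subseteq> pts X" by (rule openin_mtop_subset[OF X nice_chartD(1)[OF D(1)]])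
  show "\<exists>D c. nice_chart (image_mfd h X) D c \<and> y \<in> D \<and> f ` D \<subseteq> E \<and>
      mdim Y \<le> mdim (image_mfd h X) \<and> (\<forall>q\<in>D. \<forall>i<mdim Y. c q i = e (f q) i)"
    using nice_chart_image_mfd[OF X h D(1)] D(2-5) sub p(2)
    by (intro exI[of _ "h ` D"] exI[of _ "\<lambda>y. c (inv_into (pts X) h y)"])
      (auto simp: subset_iff inv_into_f_f[OF h])
qed

section \<open>Regular bisubmersions and their compositions\<close>

text \<open>The invariant of the induction over an atlas. A composition of U with V uses the normal
  form of the source of U and the smoothness of the target of V; its own source inherits the normal
  form from V.\<close>

definition regular :: "'a smfd \<Rightarrow> ('u, 'a) bisub \<Rightarrow> bool" where
  "regular X U \<longleftrightarrow> smooth_atlas (total_mfd U) \<and> straight (total_mfd U) X (src U) \<and>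
     (\<forall>u \<in> pts (total_mfd U). smooth_at (total_mfd U) X (tgt U) u)"

lemma regularD:
  assumes "regular X U"
  shows "smooth_atlas (total_mfd U)" "straight (total_mfd U) X (src U)"
    "\<And>u. u \<in> pts (total_mfd U) \<Longrightarrow> smooth_at (total_mfd U) X (tgt U) u"
    "\<And>u. u \<in> pts (total_mfd U) \<Longrightarrow> smooth_at (total_mfd U) X (src U) u"
  using assms straight_smooth_at[of "total_mfd U" X "src U"] by (auto simp: regular_def)

text \<open>Both structure maps are submersions, so exchanging them preserves the normal form of the
  source.\<close>

lemma bisubmersion_regular:
  assumes X: "smooth_atlas X" and U: "bisubmersion X F U"
  shows "regular X U" "regular X (inverse_bisub U)"
proof -
  have T: "smooth_atlas (total_mfd U)" using U by (simp add: bisubmersion_def smooth_manifold_iff)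
  have s: "straight (total_mfd U) X (src U)" "straight (total_mfd U) X (tgt U)"
    using U submersion_straight[OF T X] by (auto simp: bisubmersion_def)
  then show "regular X U" "regular X (inverse_bisub U)"
    using T straight_smooth_at by (auto simp: regular_def inverse_bisub_def)
qed

lemma inj_Comp: "inj_on (\<lambda>(u, v). Comp u v) A"
  by (auto simp: inj_on_def)

abbreviation "comp_base X U V \<equiv> sub_mfd (prod_mfd (total_mfd U) (total_mfd V))
    (fibre_product (total_mfd U) (src U) (total_mfd V) (tgt V))
    (mdim (total_mfd U) + mdim (total_mfd V) - mdim X)"

lemma comp_bisub_simps:
  "total_mfd (comp_bisub X U V) = image_mfd (\<lambda>(u, v). Comp u v) (comp_base X U V)"
  "tgt (comp_bisub X U V) = (\<lambda>w. tgt U (lft w))" "src (comp_bisub X U V) = (\<lambda>w. src V (rgt w))"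
  by (simp_all add: comp_bisub_def)

context
  fixes X :: "'a smfd" and U V :: "('p hpt, 'a) bisub"
  assumes X: "smooth_atlas X" and U: "regular X U" and V: "regular X V"
begin

lemma pts_comp_base: "pts (comp_base X U V) = fibre_product (total_mfd U) (src U) (total_mfd V) (tgt V)"
  by (rule pts_fibre_product[OF regularD(1)[OF U] regularD(1)[OF V] X regularD(2)[OF U] regularD(3)[OF V]])

lemma pts_comp_bisub: "pts (total_mfd (comp_bisub X U V)) =
    {Comp u v | u v. u \<in> pts (total_mfd U) \<and> v \<in> pts (total_mfd V) \<and> src U u = tgt V v}"
  unfolding comp_bisub_simps pts_image_mfd pts_comp_base by auto

lemma smooth_atlas_comp_base: "smooth_atlas (comp_base X U V)"
  by (intro smooth_atlas_sub_mfd smooth_atlas_prod_mfd regularD(1)[OF U] regularD(1)[OF V])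

lemma
  assumes w: "w \<in> pts (total_mfd (comp_bisub X U V))"
  shows smooth_at_lft: "smooth_at (total_mfd (comp_bisub X U V)) (total_mfd U) lft w"
    and smooth_at_rgt: "smooth_at (total_mfd (comp_bisub X U V)) (total_mfd V) rgt w"
proof -
  note UV = regularD(1)[OF U] regularD(1)[OF V]
  from w obtain u v where z: "(u, v) \<in> pts (comp_base X U V)" "w = (\<lambda>(u, v). Comp u v) (u, v)"
    unfolding comp_bisub_simps pts_image_mfd by auto
  then have "(u, v) \<in> pts (prod_mfd (total_mfd U) (total_mfd V))"
    unfolding pts_comp_base by (auto simp: pts_prod_mfd)
  note p = smooth_at_fst[OF UV this] smooth_at_snd[OF UV this]
  note i = smooth_at_sub_mfd_dom[OF smooth_atlas_prod_mfd[OF UV] z(1)]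
  have eq: "(\<lambda>q. lft ((\<lambda>(u, v). Comp u v) q)) = fst" "(\<lambda>q. rgt ((\<lambda>(u, v). Comp u v) q)) = snd"
    by (auto simp: fun_eq_iff)
  note d = smooth_at_image_mfd_dom[OF smooth_atlas_comp_base inj_Comp z(1)]
  show "smooth_at (total_mfd (comp_bisub X U V)) (total_mfd U) lft w"
    unfolding z(2) comp_bisub_simps d eq
    by (rule smooth_at_compose[where f = "\<lambda>q. q" and g = fst, OF i p(1)])
  show "smooth_at (total_mfd (comp_bisub X U V)) (total_mfd V) rgt w"
    unfolding z(2) comp_bisub_simps d eq
    by (rule smooth_at_compose[where f = "\<lambda>q. q" and g = snd, OF i p(2)])
qed

text \<open>The universal property of the fibre product in germ form, from which all morphisms into
  compositions are built.\<close>

lemma smooth_at_Comp: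
  assumes Z: "smooth_atlas Z" and f: "smooth_at Z (total_mfd U) f p" and g: "smooth_at Z (total_mfd V) g p"
    and W: "openin (mtop Z) W" "p \<in> W" "\<And>q. q \<in> W \<Longrightarrow> src U (f q) = tgt V (g q)"
  shows "smooth_at Z (total_mfd (comp_bisub X U V)) (\<lambda>q. Comp (f q) (g q)) p"
proof -
  note UV = regularD(1)[OF U] regularD(1)[OF V]
  note fg = smooth_at_Pair[OF UV Z f g]
  let ?S = "fibre_product (total_mfd U) (src U) (total_mfd V) (tgt V)"
  obtain W1 where W1: "openin (mtop Z) W1" "p \<in> W1" "f ` W1 \<subseteq> pts (total_mfd U)"
    by (rule smooth_at_openin[OF Z UV(1) f openin_pts[OF UV(1)] smooth_at_pts(2)[OF f]])
  obtain W2 where W2: "openin (mtop Z) W2" "p \<in> W2" "g ` W2 \<subseteq> pts (total_mfd V)"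
    by (rule smooth_at_openin[OF Z UV(2) g openin_pts[OF UV(2)] smooth_at_pts(2)[OF g]])
  have W': "openin (mtop Z) (W \<inter> W1 \<inter> W2)" "p \<in> W \<inter> W1 \<inter> W2"
    "(\<lambda>q. (f q, g q)) ` (W \<inter> W1 \<inter> W2) \<subseteq> ?S"
    using W W1 W2 by auto
  then have "(f p, g p) \<in> ?S" by blast
  then have base: "(f p, g p) \<in> pts (comp_base X U V)" unfolding pts_comp_base .
  have "smooth_at Z (comp_base X U V) (\<lambda>q. (f q, g q)) p"
    by (rule smooth_at_sub_mfd_cod[OF smooth_atlas_prod_mfd[OF UV] Z fg base W'])
  from smooth_at_compose[where g = "\<lambda>(u, v). Comp u v", OF this
      smooth_at_image_mfd[OF smooth_atlas_comp_base inj_Comp base]]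
  show ?thesis by (simp add: comp_bisub_simps)
qed

text \<open>The source factors through the projection to V, so its normal form comes from
  \<open>straight_fibre_product\<close>.\<close>

lemma regular_comp: "regular X (comp_bisub X U V)"
  unfolding regular_def
proof (intro conjI ballI)
  note UV = regularD(1)[OF U] regularD(1)[OF V]
  show "smooth_atlas (total_mfd (comp_bisub X U V))"
    unfolding comp_bisub_simps by (rule smooth_atlas_image_mfd[OF smooth_atlas_comp_base inj_Comp])
  have "straight (comp_base X U V) X (\<lambda>z. src V (snd z))"
    by (rule straight_fibre_product[OF UV X regularD(2)[OF U] regularD(3)[OF V] regularD(2)[OF V]])
  moreover have "(\<lambda>q. src V (rgt ((\<lambda>(u, v). Comp u v) q))) = (\<lambda>z. src V (snd z))"
    by (auto simp: fun_eq_iff)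
  ultimately show "straight (total_mfd (comp_bisub X U V)) X (src (comp_bisub X U V))"
    unfolding comp_bisub_simps
    by (intro straight_image_mfd[OF smooth_atlas_comp_base inj_Comp]) simp
  fix w assume w: "w \<in> pts (total_mfd (comp_bisub X U V))"
  have "lft w \<in> pts (total_mfd U)" using smooth_at_pts(2)[OF smooth_at_lft[OF w]] .
  from smooth_at_compose[where g = "tgt U", OF smooth_at_lft[OF w] regularD(3)[OF U this]]
  show "smooth_at (total_mfd (comp_bisub X U V)) X (tgt (comp_bisub X U V)) w"
    by (simp add: comp_bisub_simps)
qed

end

lemma generated_atlas_regular:
  assumes X: "smooth_atlas X" and S: "\<And>U. U \<in> S \<Longrightarrow> regular X U \<and> regular X (inverse_bisub U)"
    and U: "U \<in> generated_atlas X S"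
  shows "regular X U"
  using U by induction (use S regular_comp[OF X] in auto)

lemma path_holonomy_atlas_regular:
  assumes P: "smooth_atlas P" and U: "U \<in> path_holonomy_atlas P F"
  shows "regular P U"
  by (rule generated_atlas_regular[OF P _ U[unfolded path_holonomy_atlas_def]])
    (use bisubmersion_regular[OF P] in \<open>auto simp: path_holonomy_bisub_def\<close>)

section \<open>Local morphisms and germ classes\<close>

lemma local_morphism_iff:
  assumes "smooth_atlas (total_mfd U)" "smooth_atlas (total_mfd V)"
  shows "local_morphism U u V v \<longleftrightarrow> (\<exists>W f. openin (mtop (total_mfd U)) W \<and> u \<in> W \<and>
     (\<forall>w\<in>W. smooth_at (total_mfd U) (total_mfd V) f w) \<and> f u = v \<and>
     (\<forall>w\<in>W. src V (f w) = src U w \<and> tgt V (f w) = tgt U w))"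
  unfolding local_morphism_def using smooth_map_open_mfd_iff[OF assms] by blast

lemma local_morphismI:
  assumes "smooth_atlas (total_mfd U)" "smooth_atlas (total_mfd V)"
    "openin (mtop (total_mfd U)) W" "u \<in> W"
    "\<And>w. w \<in> W \<Longrightarrow> smooth_at (total_mfd U) (total_mfd V) f w" "f u = v"
    "\<And>w. w \<in> W \<Longrightarrow> src V (f w) = src U w" "\<And>w. w \<in> W \<Longrightarrow> tgt V (f w) = tgt U w"
  shows "local_morphism U u V v"
  unfolding local_morphism_iff[OF assms(1,2)] using assms(3-8) by (intro exI[of _ W] exI[of _ f]) simp

lemma local_morphismE:
  assumes "local_morphism U u V v" "smooth_atlas (total_mfd U)" "smooth_atlas (total_mfd V)"
  obtains W f where "openin (mtop (total_mfd U)) W" "u \<in> W"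
    "\<And>w. w \<in> W \<Longrightarrow> smooth_at (total_mfd U) (total_mfd V) f w" "f u = v"
    "\<And>w. w \<in> W \<Longrightarrow> src V (f w) = src U w" "\<And>w. w \<in> W \<Longrightarrow> tgt V (f w) = tgt U w"
proof -
  from assms(1)[unfolded local_morphism_iff[OF assms(2,3)]]
  obtain W f where "openin (mtop (total_mfd U)) W" "u \<in> W"
    "\<forall>w\<in>W. smooth_at (total_mfd U) (total_mfd V) f w" "f u = v"
    "\<forall>w\<in>W. src V (f w) = src U w \<and> tgt V (f w) = tgt U w" by auto
  then show thesis by (intro that[of W f]) simp_all
qed

lemma local_morphism_ends:
  "local_morphism U u V v \<Longrightarrow> src V v = src U u \<and> tgt V v = tgt U u"
  unfolding local_morphism_def by blast

lemma local_morphism_compose: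
  assumes "local_morphism U u V v" "local_morphism V v W w"
    and A: "smooth_atlas (total_mfd U)" "smooth_atlas (total_mfd V)" "smooth_atlas (total_mfd W)"
  shows "local_morphism U u W w"
proof -
  obtain N f where f: "openin (mtop (total_mfd U)) N" "u \<in> N"
    "\<And>w. w \<in> N \<Longrightarrow> smooth_at (total_mfd U) (total_mfd V) f w" "f u = v"
    "\<And>w. w \<in> N \<Longrightarrow> src V (f w) = src U w" "\<And>w. w \<in> N \<Longrightarrow> tgt V (f w) = tgt U w"
    by (rule local_morphismE[OF assms(1) A(1,2)]) blast
  obtain N' g where g: "openin (mtop (total_mfd V)) N'" "v \<in> N'"
    "\<And>w. w \<in> N' \<Longrightarrow> smooth_at (total_mfd V) (total_mfd W) g w" "g v = w"
    "\<And>w. w \<in> N' \<Longrightarrow> src W (g w) = src V w" "\<And>w. w \<in> N' \<Longrightarrow> tgt W (g w) = tgt V w"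
    by (rule local_morphismE[OF assms(2) A(2,3)]) blast
  show ?thesis
  proof (rule local_morphismI[OF A(1,3)])
    show "openin (mtop (total_mfd U)) {w \<in> N. f w \<in> N'}"
      by (rule openin_sm_preimage[OF A(1,2) f(1,3) g(1)])
    show "smooth_at (total_mfd U) (total_mfd W) (\<lambda>w. g (f w)) w" if "w \<in> {w \<in> N. f w \<in> N'}" for w
      by (rule smooth_at_compose[where f = f and g = g]) (use that f g in auto)
  qed (use f g in auto)
qed

lemma equiv_point_equiv: "equiv (atlas_points A) (point_equiv A)"
proof (rule equivI)
  show "point_equiv A \<subseteq> atlas_points A \<times> atlas_points A" by (auto simp: point_equiv_def)
  show "refl_on (atlas_points A) (point_equiv A)"
    by (auto simp: refl_on_def point_equiv_def)
  show "sym (point_equiv A)"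
    by (auto simp: sym_def point_equiv_def intro: equivclp_sym)
  show "trans (point_equiv A)"
    unfolding trans_def point_equiv_def by (auto intro: equivclp_trans)
qed

text \<open>Because the equivalence is a generated one, a morphism in a single direction is
  enough.\<close>

lemma germ_class_step:
  assumes "(U, u) \<in> atlas_points A" "(V, v) \<in> atlas_points A" "local_morphism U u V v"
  shows "germ_class A U u = germ_class A V v"
proof -
  have "((U, u), (V, v)) \<in> point_equiv A"
    using assms by (auto simp: point_equiv_def intro!: r_into_equivclp)
  then show ?thesis unfolding germ_class_def by (rule equiv_class_eq[OF equiv_point_equiv])
qed

lemma germ_class_eq:
  "(V, v) \<in> germ_class A U u \<Longrightarrow> germ_class A V v = germ_class A U u"
  unfolding germ_class_def using equiv_class_eq[OF equiv_point_equiv, of "(U, u)" "(V, v)"] by auto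

lemma germ_class_self: "(U, u) \<in> atlas_points A \<Longrightarrow> (U, u) \<in> germ_class A U u"
  unfolding germ_class_def by (rule equiv_class_self[OF equiv_point_equiv])

lemma germ_class_points: "(V, v) \<in> germ_class A U u \<Longrightarrow> (V, v) \<in> atlas_points A"
  by (auto simp: germ_class_def point_equiv_def)

lemma germ_class_in_groupoid: "(U, u) \<in> atlas_points A \<Longrightarrow> germ_class A U u \<in> atlas_groupoid A"
  unfolding germ_class_def atlas_groupoid_def by (rule quotientI)

lemma atlas_groupoidE:
  assumes "\<xi> \<in> atlas_groupoid A"
  obtains U u where "(U, u) \<in> atlas_points A" "\<xi> = germ_class A U u"
  using assms unfolding atlas_groupoid_def germ_class_def by (auto elim!: quotientE)

lemma atlas_groupoid_class:
  assumes "\<xi> \<in> atlas_groupoid A" "(V, v) \<in> \<xi>"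
  shows "(V, v) \<in> atlas_points A" "\<xi> = germ_class A V v"
proof -
  obtain U u where U: "(U, u) \<in> atlas_points A" "\<xi> = germ_class A U u"
    using assms(1) by (rule atlas_groupoidE)
  show "(V, v) \<in> atlas_points A" "\<xi> = germ_class A V v"
    using germ_class_points germ_class_eq assms(2) unfolding U(2) by metis+
qed

text \<open>Invariance along a single morphism can be read in both directions, so it passes along
  the generated chain, whichever way its morphisms point.\<close>

lemma germ_class_invariant:
  assumes step: "\<And>U u V v. (U, u) \<in> atlas_points A \<Longrightarrow> (V, v) \<in> atlas_points A \<Longrightarrow>
      local_morphism U u V v \<Longrightarrow> \<Phi> U u = \<Phi> V v"
    and "(V, v) \<in> germ_class A U u"
  shows "\<Phi> V v = \<Phi> U u"
proof -
  have "equivclp (\<lambda>a b. a \<in> atlas_points A \<and> b \<in> atlas_points A \<and>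
        local_morphism (fst a) (snd a) (fst b) (snd b)) (U, u) (V, v)"
    using assms(2) by (auto simp: germ_class_def point_equiv_def)
  then have "\<Phi> (fst (V, v)) (snd (V, v)) = \<Phi> (fst (U, u)) (snd (U, u))"
  proof (induction rule: equivclp_induct)
    case (step y z)
    then show ?case using assms(1)[of "fst y" "snd y" "fst z" "snd z"]
        assms(1)[of "fst z" "snd z" "fst y" "snd y"] by auto
  qed simp
  then show ?thesis by simp
qed

text \<open>\<open>the_elem\<close> is specified only on singletons; invariance makes the image of a
  class one.\<close>

lemma the_elem_germ_class:
  assumes "(U, u) \<in> atlas_points A"
    and "\<And>U u V v. (U, u) \<in> atlas_points A \<Longrightarrow> (V, v) \<in> atlas_points A \<Longrightarrow>
      local_morphism U u V v \<Longrightarrow> \<Phi> U u = \<Phi> V v"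
  shows "the_elem ((\<lambda>(U, u). \<Phi> U u) ` germ_class A U u) = \<Phi> U u"
proof -
  have "the_elem ((\<lambda>(U, u). \<Phi> U u) ` germ_class A U u) = (\<lambda>(U, u). \<Phi> U u) (U, u)"
  proof (rule the_elem_image_unique)
    show "germ_class A U u \<noteq> {}" using germ_class_self[OF assms(1)] by auto
    fix y assume "y \<in> germ_class A U u"
    then show "(\<lambda>(U, u). \<Phi> U u) y = (\<lambda>(U, u). \<Phi> U u) (U, u)"
      using germ_class_invariant[of A \<Phi>, OF assms(2)] by (cases y) auto
  qed
  then show ?thesis by simp
qed

lemma hol_src_germ_class: "(U, u) \<in> atlas_points A \<Longrightarrow> hol_src (germ_class A U u) = src U u"
  unfolding hol_src_def by (rule the_elem_germ_class) (auto dest: local_morphism_ends)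

lemma hol_tgt_germ_class: "(U, u) \<in> atlas_points A \<Longrightarrow> hol_tgt (germ_class A U u) = tgt U u"
  unfolding hol_tgt_def by (rule the_elem_germ_class) (auto dest: local_morphism_ends)

subsection \<open>Transport along diffeomorphisms\<close>

lemma tmap_in_tangent:
  assumes X: "smooth_atlas X" and Y: "smooth_atlas Y" and f: "smooth_at X Y f p" and v: "v \<in> tangent X p"
  shows "tmap Y f p v \<in> tangent Y (f p)"
  unfolding tangent_def
proof (intro CollectI conjI ballI allI impI)
  fix \<phi> \<psi> assume \<phi>: "\<phi> \<in> smooth_near Y (f p)" and \<psi>: "\<psi> \<in> smooth_near Y (f p)"
  note s = sm_atD[OF f \<phi>] sm_atD[OF f \<psi>]
  show "tmap Y f p v \<phi> = tmap Y f p v \<psi>"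
    if W: "openin (mtop Y) W" "f p \<in> W" "\<forall>q\<in>W. \<phi> q = \<psi> q" for W
  proof -
    obtain N where N: "openin (mtop X) N" "p \<in> N" "f ` N \<subseteq> W"
      by (rule smooth_at_openin[OF X Y f W(1,2)])
    have "v (\<lambda>q. \<phi> (f q)) = v (\<lambda>q. \<psi> (f q))"
      by (rule tangent_germ[OF v s N(1,2)]) (use N(3) W(3) in auto)
    then show ?thesis using \<phi> \<psi> by (simp add: tmap_def comp_def)
  qed
  show "tmap Y f p v (\<lambda>q. a * \<phi> q + b * \<psi> q) = a * tmap Y f p v \<phi> + b * tmap Y f p v \<psi>" for a b
  proof -
    have "(\<lambda>q. a * \<phi> q + b * \<psi> q) \<in> smooth_near Y (f p)"
      by (intro smooth_near_add smooth_near_mult smooth_near_const Y smooth_near_pts[OF Y \<phi>] \<phi> \<psi>)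
    then show ?thesis using \<phi> \<psi> tangent_linear[OF v s] by (simp add: tmap_def comp_def)
  qed
  show "tmap Y f p v (\<lambda>q. \<phi> q * \<psi> q) = \<phi> (f p) * tmap Y f p v \<psi> + \<psi> (f p) * tmap Y f p v \<phi>"
    using \<phi> \<psi> smooth_near_mult[OF Y \<phi> \<psi>] tangent_mult[OF v s] by (simp add: tmap_def comp_def)
qed (simp add: tmap_def)

lemma tmap_compose:
  assumes "smooth_at Y Z g (f p)"
  shows "tmap Z g (f p) (tmap Y f p v) = tmap Z (\<lambda>q. g (f q)) p v"
  using sm_atD[OF assms] by (auto simp: tmap_def comp_def fun_eq_iff)

lemma tmap_cong:
  assumes X: "smooth_atlas X" and v: "v \<in> tangent X p" and f: "smooth_at X Y f p"
    and W: "openin (mtop X) W" "p \<in> W" "\<And>q. q \<in> W \<Longrightarrow> f q = g q"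
  shows "tmap Y f p v = tmap Y g p v"
proof
  fix \<phi>
  have fg: "f p = g p" using W by auto
  have "smooth_at X Y g p" by (rule smooth_at_cong[OF X W f])
  then have "v (\<lambda>q. \<phi> (f q)) = v (\<lambda>q. \<phi> (g q))" if "\<phi> \<in> smooth_near Y (f p)"
    using that fg W(3) by (intro tangent_germ[OF v _ _ W(1,2)] sm_atD[OF f]) (auto intro: sm_atD)
  then show "tmap Y f p v \<phi> = tmap Y g p v \<phi>" using fg by (simp add: tmap_def comp_def)
qed

lemma tmap_id: "v \<in> tangent X p \<Longrightarrow> tmap X (\<lambda>q. q) p v = v"
  using tangent_not_smooth[of v X p] by (auto simp: tmap_def comp_def fun_eq_iff)

lemma tmap_zero: "tmap Y f p (\<lambda>\<phi>. 0) = (\<lambda>\<phi>. 0)"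
  by (simp add: tmap_def fun_eq_iff)

lemma tmap_lincomb:
  "tmap Y f p (\<lambda>\<phi>. \<Sum>i<n. a i * w i \<phi>) = (\<lambda>\<phi>. \<Sum>i<(n::nat). a i * tmap Y f p (w i) \<phi>)"
  by (simp add: tmap_def fun_eq_iff)

text \<open>The inverse is part of the data because push-forwards are written with it; the equations
  are asked on \<open>pts\<close> only.\<close>

definition diffeo :: "'a smfd \<Rightarrow> 'b smfd \<Rightarrow> ('a \<Rightarrow> 'b) \<Rightarrow> ('b \<Rightarrow> 'a) \<Rightarrow> bool" where
  "diffeo X Y f g \<longleftrightarrow> (\<forall>p \<in> pts X. smooth_at X Y f p \<and> g (f p) = p) \<and>
     (\<forall>q \<in> pts Y. smooth_at Y X g q \<and> f (g q) = q)"

lemma diffeoD: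
  assumes "diffeo X Y f g"
  shows "\<And>p. p \<in> pts X \<Longrightarrow> smooth_at X Y f p" "\<And>p. p \<in> pts X \<Longrightarrow> g (f p) = p"
    "\<And>p. p \<in> pts X \<Longrightarrow> f p \<in> pts Y"
    "\<And>q. q \<in> pts Y \<Longrightarrow> smooth_at Y X g q" "\<And>q. q \<in> pts Y \<Longrightarrow> f (g q) = q"
    "\<And>q. q \<in> pts Y \<Longrightarrow> g q \<in> pts X"
  using assms by (auto simp: diffeo_def dest: smooth_at_pts)

lemma diffeo_sym: "diffeo X Y f g \<Longrightarrow> diffeo Y X g f"
  by (simp add: diffeo_def)

lemma diffeo_homeomorphic_maps:
  assumes X: "smooth_atlas X" and Y: "smooth_atlas Y" and d: "diffeo X Y f g"
  shows "homeomorphic_maps (mtop X) (mtop Y) f g"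
proof -
  have "smooth_map X Y f" "smooth_map Y X g"
    using diffeoD[OF d] by (simp_all add: smooth_map_iff X Y)
  then show ?thesis
    using diffeoD[OF d] by (simp add: homeomorphic_maps_def smooth_map_def topspace_mtop X Y)
qed

lemma diffeo_smooth_manifold:
  assumes X: "smooth_manifold X" and Y: "smooth_atlas Y" and d: "diffeo X Y f g"
  shows "smooth_manifold Y"
proof -
  have "mtop X homeomorphic_space mtop Y"
    using diffeo_homeomorphic_maps[OF smooth_manifold_atlas[OF X] Y d]
    unfolding homeomorphic_space_def by blast
  then show ?thesis
    using X Y homeomorphic_Hausdorff_space homeomorphic_space_second_countability
    unfolding smooth_manifold_iff by blast
qed

lemma tmap_diffeo:
  assumes X: "smooth_atlas X" and Y: "smooth_atlas Y" and d: "diffeo X Y f g" and p: "p \<in> pts X"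
    and v: "v \<in> tangent X p"
  shows "tmap X g (f p) (tmap Y f p v) = v"
proof -
  note D = diffeoD[OF d]
  have "tmap X g (f p) (tmap Y f p v) = tmap X (\<lambda>q. g (f q)) p v"
    by (rule tmap_compose[where f = f and g = g, OF D(4)[OF D(3)[OF p]]])
  also have "\<dots> = tmap X (\<lambda>q. q) p v"
  proof (rule tmap_cong[OF X v _ openin_pts[OF X] p D(2)])
    show "smooth_at X X (\<lambda>q. g (f q)) p"
      by (rule smooth_at_compose[where f = f and g = g, OF D(1)[OF p] D(4)[OF D(3)[OF p]]])
  qed
  finally show ?thesis using tmap_id[OF v] by simp
qed

text \<open>Off \<open>pts Y\<close> the push-forward is 0, the convention of
  \<open>vfields\<close>, so that equations between fields hold on the whole type.\<close>

definition push_field :: "'b smfd \<Rightarrow> ('a \<Rightarrow> 'b) \<Rightarrow> ('b \<Rightarrow> 'a) \<Rightarrow> 'a vfield \<Rightarrow> 'b vfield" where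
  "push_field Y f g Z = (\<lambda>q. if q \<in> pts Y then tmap Y f (g q) (Z (g q)) else (\<lambda>\<phi>. 0))"

lemma vfieldsD:
  assumes "Z \<in> vfields X U"
  shows "p \<in> U \<Longrightarrow> Z p \<in> tangent X p" "p \<notin> U \<Longrightarrow> Z p = (\<lambda>f. 0)"
    "W \<subseteq> U \<Longrightarrow> smooth_fun X W f \<Longrightarrow> smooth_fun X W (\<lambda>p. Z p f)"
  using assms by (simp_all add: vfields_def)

lemma push_field_lincomb:
  "push_field Y f g (lincomb n a Z) = lincomb n (\<lambda>i q. a i (g q)) (\<lambda>i. push_field Y f g (Z i))"
  by (auto simp: push_field_def lincomb_def tmap_def fun_eq_iff)

lemma push_field_add:
  "push_field Y f g (\<lambda>p \<phi>. A p \<phi> + B p \<phi>) =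
    (\<lambda>p \<phi>. push_field Y f g A p \<phi> + push_field Y f g B p \<phi>)"
  by (auto simp: push_field_def tmap_def fun_eq_iff)

lemma push_field_diff:
  "push_field Y f g (\<lambda>p \<phi>. A p \<phi> - B p \<phi>) =
    (\<lambda>p \<phi>. push_field Y f g A p \<phi> - push_field Y f g B p \<phi>)"
  by (auto simp: push_field_def tmap_def fun_eq_iff)

context
  fixes X :: "'a smfd" and Y :: "'b smfd" and f :: "'a \<Rightarrow> 'b" and g :: "'b \<Rightarrow> 'a"
  assumes X: "smooth_atlas X" and Y: "smooth_atlas Y" and d: "diffeo X Y f g"
begin

lemmas push_diffeo = diffeoD[OF d]

lemma smooth_fun_push:
  assumes W: "openin (mtop Y) W" and h: "\<And>q. q \<in> W \<Longrightarrow> h \<in> smooth_near X (g q)"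
  shows "smooth_fun Y W (\<lambda>q. h (g q))"
  unfolding smooth_fun_iff_near[OF Y]
proof (intro conjI W ballI)
  fix q assume q: "q \<in> W"
  then have "q \<in> pts Y" using openin_mtop_subset[OF Y W] by auto
  then show "(\<lambda>q. h (g q)) \<in> smooth_near Y q" by (rule sm_atD[OF push_diffeo(4) h[OF q]])
qed

text \<open>The pushed field applied to \<phi> is Z applied to \<phi> \<circ> f, read through g;
  smoothness is inherited from this.\<close>

lemma push_field_vfields:
  assumes Z: "Z \<in> vfields X (pts X)"
  shows "push_field Y f g Z \<in> vfields Y (pts Y)"
  unfolding vfields_def
proof (intro CollectI conjI ballI allI impI)
  fix q assume q: "q \<in> pts Y"
  have "tmap Y f (g q) (Z (g q)) \<in> tangent Y (f (g q))"
    by (rule tmap_in_tangent[OF X Y push_diffeo(1)[OF push_diffeo(6)[OF q]] vfieldsD(1)[OF Z push_diffeo(6)[OF q]]])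
  then show "push_field Y f g Z q \<in> tangent Y q" using q push_diffeo(5) by (simp add: push_field_def)
next
  fix q assume "q \<notin> pts Y"
  then show "push_field Y f g Z q = (\<lambda>f. 0)" by (simp add: push_field_def)
next
  fix W \<phi> assume W: "W \<subseteq> pts Y" and \<phi>: "smooth_fun Y W \<phi>"
  have o: "openin (mtop Y) W" using \<phi> by (simp add: smooth_fun_iff_near[OF Y])
  let ?W = "{p \<in> pts X. f p \<in> W}" and ?h = "\<lambda>p. Z p (\<lambda>q. \<phi> (f q))"
  have "openin (mtop X) ?W" by (rule openin_sm_preimage[OF X Y openin_pts[OF X] push_diffeo(1) o])
  then have "smooth_fun X ?W (\<lambda>p. \<phi> (f p))"
    using \<phi> sm_atD[OF push_diffeo(1)] by (simp add: smooth_fun_iff_near X Y)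
  then have "smooth_fun X ?W ?h" by (intro vfieldsD(3)[OF Z]) auto
  then have s: "smooth_fun Y W (\<lambda>q. ?h (g q))"
    by (intro smooth_fun_push[OF o]) (use W push_diffeo in \<open>auto simp: smooth_fun_iff_near X\<close>)
  have eq: "?h (g q) = push_field Y f g Z q \<phi>" if "q \<in> W" for q
    using that W push_diffeo(5) \<phi> by (auto simp: push_field_def tmap_def comp_def smooth_fun_iff_near Y)
  show "smooth_fun Y W (\<lambda>q. push_field Y f g Z q \<phi>)"
    unfolding smooth_fun_iff_near[OF Y]
  proof (intro conjI o ballI)
    fix q assume q: "q \<in> W"
    then have h: "(\<lambda>q. ?h (g q)) \<in> smooth_near Y q" using s by (simp add: smooth_fun_iff_near[OF Y])
    show "(\<lambda>q. push_field Y f g Z q \<phi>) \<in> smooth_near Y q"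
      by (rule smooth_near_cong_imp[OF Y o q _ h]) (rule eq)
  qed
qed

lemma push_field_inverse:
  assumes Z: "Z \<in> vfields X (pts X)"
  shows "push_field X g f (push_field Y f g Z) = Z"
proof
  fix p
  show "push_field X g f (push_field Y f g Z) p = Z p"
  proof (cases "p \<in> pts X")
    case True
    then show ?thesis
      using tmap_diffeo[OF X Y d True vfieldsD(1)[OF Z True]] push_diffeo(2,3) by (simp add: push_field_def)
  qed (simp add: push_field_def vfieldsD(2)[OF Z])
qed

lemma closure_of_push:
  assumes "A \<subseteq> pts X"
  shows "mtop Y closure_of (f ` A) = f ` (mtop X closure_of A)"
  using homeomorphic_map_closure_of[OF homeomorphic_maps_imp_map[OF diffeo_homeomorphic_maps[OF X Y d]]]
    assms by (simp add: topspace_mtop X)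

lemma compactin_push:
  assumes "compactin (mtop X) K"
  shows "compactin (mtop Y) (f ` K)"
proof -
  have "continuous_map (mtop X) (mtop Y) f"
    using diffeo_homeomorphic_maps[OF X Y d] by (simp add: homeomorphic_maps_def)
  then show ?thesis by (rule image_compactin[OF assms])
qed

text \<open>The support of the push-forward is closed and contained in the image of the support of
  Z, which is compact.\<close>

lemma push_field_vfields_c:
  assumes Z: "Z \<in> vfields_c X"
  shows "push_field Y f g Z \<in> vfields_c Y"
proof -
  have Zv: "Z \<in> vfields X (pts X)" and K: "compactin (mtop X) (vsupp X Z)"
    using Z by (simp_all add: vfields_c_def)
  have "{q \<in> pts Y. push_field Y f g Z q \<noteq> (\<lambda>f. 0)} \<subseteq> f ` {p \<in> pts X. Z p \<noteq> (\<lambda>f. 0)}"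
  proof
    fix q assume q: "q \<in> {q \<in> pts Y. push_field Y f g Z q \<noteq> (\<lambda>f. 0)}"
    then have "Z (g q) \<noteq> (\<lambda>f. 0)" by (auto simp: push_field_def tmap_zero)
    then show "q \<in> f ` {p \<in> pts X. Z p \<noteq> (\<lambda>f. 0)}"
      using q push_diffeo(5,6) by (intro image_eqI[of _ _ "g q"]) auto
  qed
  then have "vsupp Y (push_field Y f g Z) \<subseteq> f ` vsupp X Z"
    using closure_of_mono closure_of_push[of "{p \<in> pts X. Z p \<noteq> (\<lambda>f. 0)}"]
    unfolding vsupp_def by fastforce
  then have "compactin (mtop Y) (vsupp Y (push_field Y f g Z))"
    by (rule closed_compactin[OF compactin_push[OF K]]) (simp add: vsupp_def)
  then show ?thesis using push_field_vfields[OF Zv] by (simp add: vfields_c_def)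
qed

lemma Cc_push:
  assumes a: "a \<in> Cc X (pts X)"
  shows "(\<lambda>q. a (g q)) \<in> Cc Y (pts Y)"
proof -
  have s: "smooth_fun X (pts X) a" and K: "compactin (mtop X) (fsupp X a)"
    using a by (simp_all add: Cc_def)
  have "smooth_fun Y (pts Y) (\<lambda>q. a (g q))"
    by (rule smooth_fun_push[OF openin_pts[OF Y]]) (use s push_diffeo(6) in \<open>auto simp: smooth_fun_iff_near X\<close>)
  moreover have "{q \<in> pts Y. a (g q) \<noteq> 0} \<subseteq> f ` {p \<in> pts X. a p \<noteq> 0}"
    using push_diffeo(5,6) by force
  then have "fsupp Y (\<lambda>q. a (g q)) \<subseteq> f ` fsupp X a"
    using closure_of_mono closure_of_push[of "{p \<in> pts X. a p \<noteq> 0}"]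
    unfolding fsupp_def by fastforce
  then have "compactin (mtop Y) (fsupp Y (\<lambda>q. a (g q)))"
    by (rule closed_compactin[OF compactin_push[OF K]]) (simp add: fsupp_def)
  moreover have "fsupp Y (\<lambda>q. a (g q)) \<subseteq> pts Y"
    using closure_of_subset_topspace[of "mtop Y"] by (simp add: fsupp_def topspace_mtop Y)
  ultimately show ?thesis by (simp add: Cc_def)
qed

end

section \<open>Diffeomorphisms that preserve a foliation\<close>

lemma foliation_vfields: "singular_foliation P F \<Longrightarrow> V \<in> F \<Longrightarrow> V \<in> vfields P (pts P)"
  by (auto simp: singular_foliation_def vfields_c_def)

lemma foliation_lincomb:
  assumes F: "singular_foliation P F"
    and "\<And>i. i < n \<Longrightarrow> smooth_fun P (pts P) (b i)" "\<And>i. i < n \<Longrightarrow> V i \<in> F"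
  shows "lincomb n b V \<in> F"
  using assms(2,3)
proof (induction n)
  case 0
  then show ?case using F by (simp add: lincomb_def singular_foliation_def)
next
  case (Suc n)
  have "lincomb n b V \<in> F" using Suc by simp
  moreover have "(\<lambda>p \<phi>. b n p * V n p \<phi>) \<in> F"
    using F Suc.prems by (simp add: singular_foliation_def)
  moreover have add: "\<forall>Y\<in>F. \<forall>Z\<in>F. (\<lambda>p \<phi>. Y p \<phi> + Z p \<phi>) \<in> F"
    using F by (simp add: singular_foliation_def)
  ultimately have "(\<lambda>p \<phi>. lincomb n b V p \<phi> + b n p * V n p \<phi>) \<in> F"
    using bspec[OF bspec[OF add]] by blast
  then show ?case by (simp add: lincomb_def)
qed

text \<open>\<open>pullback\<close> writes the differential of \<theta> applied to Z as a
  combination of fields of F along \<theta>; reading its coefficients through \<theta>' gives a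
  combination in F itself.\<close>

lemma foliation_push:
  assumes P: "smooth_atlas P" and F: "singular_foliation P F" and d: "diffeo P P \<theta> \<theta>'"
    and pb: "pullback P P \<theta> F = F" and Z: "Z \<in> F"
  shows "push_field P \<theta> \<theta>' Z \<in> F"
proof -
  note D = diffeoD[OF d]
  have "Z \<in> pullback P P \<theta> F" using Z by (simp only: pb)
  then obtain n :: nat and a V where aV: "\<And>i. i < n \<Longrightarrow> a i \<in> Cc P (pts P) \<and> V i \<in> F"
    "\<And>p. p \<in> pts P \<Longrightarrow> tmap P \<theta> p (Z p) = (\<lambda>\<phi>. \<Sum>i<n. a i p * V i (\<theta> p) \<phi>)"
    unfolding pullback_def by blast
  have "push_field P \<theta> \<theta>' Z q = lincomb n (\<lambda>i q. a i (\<theta>' q)) V q" for q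
  proof (cases "q \<in> pts P")
    case True
    then show ?thesis using aV(2)[OF D(6)[OF True]] D(5)[OF True]
      by (simp add: push_field_def lincomb_def)
  next
    \<comment> \<open>Outside \<open>pts P\<close> both sides are 0, because the members of F vanish
      there.\<close>
    case False
    have "V i q = (\<lambda>\<phi>. 0)" if "i < n" for i
      by (rule vfieldsD(2)[OF foliation_vfields[OF F] False]) (use aV(1)[OF that] in simp)
    then show ?thesis using False by (simp add: push_field_def lincomb_def)
  qed
  then have "push_field P \<theta> \<theta>' Z = lincomb n (\<lambda>i q. a i (\<theta>' q)) V" by (rule ext)
  moreover have "smooth_fun P (pts P) (\<lambda>q. a i (\<theta>' q))" if "i < n" for i
    using Cc_push[OF P P d] aV(1)[OF that] by (simp add: Cc_def)
  ultimately show ?thesis using foliation_lincomb[OF F] aV(1) by simp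
qed

section \<open>Transport of bisubmersions\<close>

text \<open>f stands for one structure map of a bisubmersion and f' for its translate. The locale is
  used for the source and for the target with the same \<Psi>, and for both in the reverse
  direction.\<close>

locale equivariant_diffeo =
  fixes U :: "'u smfd" and U' :: "'w smfd" and P :: "'p smfd" and \<Psi> :: "'u \<Rightarrow> 'w" and \<Psi>' :: "'w \<Rightarrow> 'u"
    and \<theta> \<theta>' :: "'p \<Rightarrow> 'p" and f :: "'u \<Rightarrow> 'p" and f' :: "'w \<Rightarrow> 'p"
  assumes U: "smooth_atlas U" and U': "smooth_atlas U'" and P: "smooth_atlas P"
    and \<Psi>: "diffeo U U' \<Psi> \<Psi>'" and \<theta>: "diffeo P P \<theta> \<theta>'"
    and f: "\<And>u. u \<in> pts U \<Longrightarrow> smooth_at U P f u"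
    and equivariant: "\<And>u. u \<in> pts U \<Longrightarrow> f' (\<Psi> u) = \<theta> (f u)"
begin

lemmas D\<Psi> = diffeoD[OF \<Psi>] and D\<theta> = diffeoD[OF \<theta>]

lemma f_pts: "u \<in> pts U \<Longrightarrow> f u \<in> pts P"
  using smooth_at_pts(2)[OF f] .

lemma f'_eq: "w \<in> pts U' \<Longrightarrow> f' w = \<theta> (f (\<Psi>' w))"
  using equivariant[OF D\<Psi>(6)] D\<Psi>(5) by simp

lemma sm_f': "w \<in> pts U' \<Longrightarrow> smooth_at U' P f' w"
proof -
  assume w: "w \<in> pts U'"
  have "smooth_at U' P (\<lambda>w. f (\<Psi>' w)) w"
    by (rule smooth_at_compose[where f = \<Psi>' and g = f, OF D\<Psi>(4)[OF w] f[OF D\<Psi>(6)[OF w]]])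
  from smooth_at_compose[where g = \<theta>, OF this D\<theta>(1)[OF f_pts[OF D\<Psi>(6)[OF w]]]]
  show "smooth_at U' P f' w"
    by (rule smooth_at_cong[OF U' openin_pts[OF U'] w, rotated]) (simp add: f'_eq)
qed

lemma inverse: "equivariant_diffeo U' U P \<Psi>' \<Psi> \<theta>' \<theta> f' f"
  by unfold_locales
    (use U U' P diffeo_sym[OF \<Psi>] diffeo_sym[OF \<theta>] sm_f' f'_eq D\<theta>(2) f_pts D\<Psi>(6) in auto)

text \<open>The chain rule applied to both sides of f' \<circ> \<Psi> = \<theta> \<circ> f.\<close>

lemma tmap_equivariant:
  assumes u: "u \<in> pts U" and v: "v \<in> tangent U u"
  shows "tmap P f' (\<Psi> u) (tmap U' \<Psi> u v) = tmap P \<theta> (f u) (tmap P f u v)"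
proof -
  have "tmap P f' (\<Psi> u) (tmap U' \<Psi> u v) = tmap P (\<lambda>u. f' (\<Psi> u)) u v"
    by (rule tmap_compose[where f = \<Psi> and g = f', OF sm_f'[OF D\<Psi>(3)[OF u]]])
  also have "\<dots> = tmap P (\<lambda>u. \<theta> (f u)) u v"
    by (rule tmap_cong[OF U v _ openin_pts[OF U] u equivariant])
      (rule smooth_at_compose[where f = \<Psi> and g = f', OF D\<Psi>(1)[OF u] sm_f'[OF D\<Psi>(3)[OF u]]])
  also have "\<dots> = tmap P \<theta> (f u) (tmap P f u v)"
    by (rule tmap_compose[where f = f and g = \<theta>, OF D\<theta>(1)[OF f_pts[OF u]], symmetric])
  finally show ?thesis .
qed

lemma tmap_push_field:
  assumes Z: "Z \<in> vfields U (pts U)" and w: "w \<in> pts U'"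
  shows "tmap P f' w (push_field U' \<Psi> \<Psi>' Z w) =
    tmap P \<theta> (f (\<Psi>' w)) (tmap P f (\<Psi>' w) (Z (\<Psi>' w)))"
  using tmap_equivariant[OF D\<Psi>(6)[OF w] vfieldsD(1)[OF Z D\<Psi>(6)[OF w]]] w
  by (simp add: push_field_def D\<Psi>(5))

lemma vertical_push:
  assumes Z: "Z \<in> vertical_c U P f"
  shows "push_field U' \<Psi> \<Psi>' Z \<in> vertical_c U' P f'"
proof -
  have Zc: "Z \<in> vfields_c U" and 0: "\<And>p. p \<in> pts U \<Longrightarrow> tmap P f p (Z p) = (\<lambda>\<phi>. 0)"
    using Z by (simp_all add: vertical_c_def)
  have Zv: "Z \<in> vfields U (pts U)" using Zc by (simp add: vfields_c_def)
  show ?thesis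
    using push_field_vfields_c[OF U U' \<Psi> Zc] tmap_push_field[OF Zv] 0 D\<Psi>(6)
    by (simp add: vertical_c_def tmap_zero)
qed

lemma pullback_push:
  assumes F: "\<And>V. V \<in> F \<Longrightarrow> push_field P \<theta> \<theta>' V \<in> F" and Z: "Z \<in> pullback U P f F"
  shows "push_field U' \<Psi> \<Psi>' Z \<in> pullback U' P f' F"
proof -
  from Z obtain n :: nat and a V where Zc: "Z \<in> vfields_c U"
    and aV: "\<And>i. i < n \<Longrightarrow> a i \<in> Cc U (pts U) \<and> V i \<in> F"
      "\<And>p. p \<in> pts U \<Longrightarrow> tmap P f p (Z p) = (\<lambda>\<phi>. \<Sum>i<n. a i p * V i (f p) \<phi>)"
    unfolding pullback_def by blast
  have Zv: "Z \<in> vfields U (pts U)" using Zc by (simp add: vfields_c_def)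
  have "tmap P f' w (push_field U' \<Psi> \<Psi>' Z w) =
      (\<lambda>\<phi>. \<Sum>i<n. a i (\<Psi>' w) * push_field P \<theta> \<theta>' (V i) (f' w) \<phi>)" if w: "w \<in> pts U'" for w
  proof -
    have p: "f (\<Psi>' w) \<in> pts P" by (rule f_pts[OF D\<Psi>(6)[OF w]])
    have "push_field P \<theta> \<theta>' (V i) (f' w) = tmap P \<theta> (f (\<Psi>' w)) (V i (f (\<Psi>' w)))" for i
      using D\<theta>(2,3)[OF p] by (simp add: push_field_def f'_eq[OF w])
    then show ?thesis
      by (simp add: tmap_push_field[OF Zv w] aV(2)[OF D\<Psi>(6)[OF w]] tmap_lincomb)
  qed
  moreover have "(\<lambda>w. a i (\<Psi>' w)) \<in> Cc U' (pts U') \<and> push_field P \<theta> \<theta>' (V i) \<in> F" if "i < n" for i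
    using Cc_push[OF U U' \<Psi>] F aV(1)[OF that] by blast
  ultimately show ?thesis
    using push_field_vfields_c[OF U U' \<Psi> Zc] unfolding pullback_def
    by (intro CollectI conjI exI[of _ n] exI[of _ "\<lambda>i w. a i (\<Psi>' w)"]
        exI[of _ "\<lambda>i. push_field P \<theta> \<theta>' (V i)"]) auto
qed

text \<open>A tangent vector at f' w is carried back by \<theta>', lifted there by the hypothesis on
  f, and the lift is pushed by \<Psi>.\<close>

lemma submersion_push:
  assumes sub: "submersion U P f"
  shows "submersion U' P f'"
  unfolding submersion_def
proof (intro conjI ballI)
  show "smooth_map U' P f'" using sm_f' by (simp add: smooth_map_iff U' P)
  fix w assume w: "w \<in> pts U'"
  note u = D\<Psi>(6)[OF w]
  show "tmap P f' w ` tangent U' w = tangent P (f' w)"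
  proof
    show "tmap P f' w ` tangent U' w \<subseteq> tangent P (f' w)"
      using tmap_in_tangent[OF U' P sm_f'[OF w]] by auto
    show "tangent P (f' w) \<subseteq> tmap P f' w ` tangent U' w"
    proof
      fix y assume y: "y \<in> tangent P (f' w)"
      have fw: "f' w \<in> pts P" using smooth_at_pts(2)[OF sm_f'[OF w]] .
      have inv: "\<theta>' (f' w) = f (\<Psi>' w)" using D\<theta>(2)[OF f_pts[OF u]] by (simp add: f'_eq[OF w])
      have y': "tmap P \<theta>' (f' w) y \<in> tangent P (f (\<Psi>' w))"
        using tmap_in_tangent[OF P P D\<theta>(4)[OF fw] y] by (simp add: inv)
      then have "tmap P \<theta>' (f' w) y \<in> tmap P f (\<Psi>' w) ` tangent U (\<Psi>' w)"
        using sub u by (simp add: submersion_def)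
      then obtain v where v: "v \<in> tangent U (\<Psi>' w)" "tmap P \<theta>' (f' w) y = tmap P f (\<Psi>' w) v"
        by blast
      have "tmap P f' (\<Psi> (\<Psi>' w)) (tmap U' \<Psi> (\<Psi>' w) v) = tmap P \<theta> (f (\<Psi>' w)) (tmap P \<theta>' (f' w) y)"
        using tmap_equivariant[OF u v(1)] v(2) by simp
      also have "\<dots> = y"
        using tmap_diffeo[OF P P diffeo_sym[OF \<theta>] fw y] by (simp add: inv)
      finally have "y = tmap P f' w (tmap U' \<Psi> (\<Psi>' w) v)" by (simp add: D\<Psi>(5)[OF w])
      moreover have "tmap U' \<Psi> (\<Psi>' w) v \<in> tangent U' w"
        using tmap_in_tangent[OF U U' D\<Psi>(1)[OF u] v(1)] by (simp add: D\<Psi>(5)[OF w])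
      ultimately show "y \<in> tmap P f' w ` tangent U' w" by blast
    qed
  qed
qed

end

lemma vsum_push:
  assumes "\<And>Z. Z \<in> A \<Longrightarrow> push_field Y f g Z \<in> A'" "\<And>Z. Z \<in> B \<Longrightarrow> push_field Y f g Z \<in> B'"
    and "Z \<in> vsum A B"
  shows "push_field Y f g Z \<in> vsum A' B'"
proof -
  from assms(3) obtain V W where VW: "V \<in> A" "W \<in> B" "Z = (\<lambda>p \<phi>. V p \<phi> + W p \<phi>)"
    unfolding vsum_def by blast
  then have "push_field Y f g Z = (\<lambda>p \<phi>. push_field Y f g V p \<phi> + push_field Y f g W p \<phi>)"
    by (simp only: push_field_add)
  then show ?thesis
    using assms(1)[OF VW(1)] assms(2)[OF VW(2)] unfolding vsum_def by blast
qed

text \<open>An inclusion is transported by pulling a member of B' back into B, using B \<subseteq> A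
  and pushing forward; no push-forward of a whole set of fields has to be computed.\<close>

lemma push_transfer_subset:
  assumes "\<And>Z. Z \<in> A \<Longrightarrow> push_field Y f g Z \<in> A'" "\<And>Z. Z \<in> B' \<Longrightarrow> push_field X g f Z \<in> B"
    and "B \<subseteq> A" "\<And>Z. Z \<in> B' \<Longrightarrow> push_field Y f g (push_field X g f Z) = Z"
  shows "B' \<subseteq> A'"
proof
  fix Z assume Z: "Z \<in> B'"
  then have "push_field X g f Z \<in> A" using assms(2,3) by blast
  from assms(1)[OF this] show "Z \<in> A'" by (simp only: assms(4)[OF Z])
qed

lemma vsum_push_inverse:
  assumes "\<And>Z. Z \<in> A \<Longrightarrow> push_field Y f g (push_field X g f Z) = Z"
    and "\<And>Z. Z \<in> B \<Longrightarrow> push_field Y f g (push_field X g f Z) = Z"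
    and "Z \<in> vsum A B"
  shows "push_field Y f g (push_field X g f Z) = Z"
proof -
  from assms(3) obtain V W where VW: "V \<in> A" "W \<in> B" "Z = (\<lambda>p \<phi>. V p \<phi> + W p \<phi>)"
    unfolding vsum_def by blast
  then show ?thesis by (simp only: push_field_add assms(1)[OF VW(1)] assms(2)[OF VW(2)])
qed

text \<open>Each of the two equalities of modules of fields in \<open>bisubmersion\<close> is
  transported as two inclusions. Push and pull undo each other on compactly supported fields, and on
  sums of such.\<close>

lemma bisubmersion_push:
  assumes T: "smooth_atlas (total_mfd U')" and P: "smooth_atlas P"
    and \<Psi>: "diffeo (total_mfd U) (total_mfd U') \<Psi> \<Psi>'" and \<theta>: "diffeo P P \<theta> \<theta>'"
    and src: "\<And>u. u \<in> pts (total_mfd U) \<Longrightarrow> src U' (\<Psi> u) = \<theta> (src U u)"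
    and tgt: "\<And>u. u \<in> pts (total_mfd U) \<Longrightarrow> tgt U' (\<Psi> u) = \<theta> (tgt U u)"
    and F: "\<And>V. V \<in> F \<Longrightarrow> push_field P \<theta> \<theta>' V \<in> F" "\<And>V. V \<in> F \<Longrightarrow> push_field P \<theta>' \<theta> V \<in> F"
    and U: "bisubmersion P F U"
  shows "bisubmersion P F U'"
proof -
  let ?T = "total_mfd U" and ?T' = "total_mfd U'"
  have T0: "smooth_manifold ?T" using U by (simp add: bisubmersion_def)
  note R = bisubmersion_regular(1)[OF P U]
  interpret s: equivariant_diffeo ?T ?T' P \<Psi> \<Psi>' \<theta> \<theta>' "src U" "src U'"
    by unfold_locales (fact regularD(1)[OF R] T P \<Psi> \<theta> regularD(4)[OF R] src)+
  interpret t: equivariant_diffeo ?T ?T' P \<Psi> \<Psi>' \<theta> \<theta>' "tgt U" "tgt U'"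
    by unfold_locales (fact regularD(1)[OF R] T P \<Psi> \<theta> regularD(3)[OF R] tgt)+
  note push = s.pullback_push[OF F(1)] t.pullback_push[OF F(1)] s.vertical_push t.vertical_push
  note pull = equivariant_diffeo.pullback_push[OF s.inverse F(2)]
    equivariant_diffeo.pullback_push[OF t.inverse F(2)]
    equivariant_diffeo.vertical_push[OF s.inverse] equivariant_diffeo.vertical_push[OF t.inverse]
  have inv: "push_field ?T' \<Psi> \<Psi>' (push_field ?T \<Psi>' \<Psi> Z) = Z" if "Z \<in> vfields_c ?T'" for Z
    using push_field_inverse[OF T regularD(1)[OF R] diffeo_sym[OF \<Psi>]] that by (simp add: vfields_c_def)
  have invp: "push_field ?T' \<Psi> \<Psi>' (push_field ?T \<Psi>' \<Psi> Z) = Z" if "Z \<in> pullback ?T' P h F" for Z h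
    using that by (intro inv) (simp add: pullback_def)
  have invv: "push_field ?T' \<Psi> \<Psi>' (push_field ?T \<Psi>' \<Psi> Z) = Z" if "Z \<in> vertical_c ?T' P h" for Z h
    using that by (intro inv) (simp add: vertical_c_def)
  have eq: "pullback ?T P (src U) F = pullback ?T P (tgt U) F"
    "pullback ?T P (tgt U) F = vsum (vertical_c ?T P (src U)) (vertical_c ?T P (tgt U))"
    using U by (simp_all add: bisubmersion_def)
  have "pullback ?T' P (src U') F = pullback ?T' P (tgt U') F"
  proof
    show "pullback ?T' P (src U') F \<subseteq> pullback ?T' P (tgt U') F"
      by (rule push_transfer_subset[OF push(2) pull(1) equalityD1[OF eq(1)] invp])
    show "pullback ?T' P (tgt U') F \<subseteq> pullback ?T' P (src U') F"
      by (rule push_transfer_subset[OF push(1) pull(2) equalityD2[OF eq(1)] invp])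
  qed
  moreover have "pullback ?T' P (tgt U') F = vsum (vertical_c ?T' P (src U')) (vertical_c ?T' P (tgt U'))"
  proof
    show "pullback ?T' P (tgt U') F \<subseteq> vsum (vertical_c ?T' P (src U')) (vertical_c ?T' P (tgt U'))"
      by (rule push_transfer_subset[OF vsum_push[OF push(3,4)] pull(2) equalityD1[OF eq(2)] invp])
    show "vsum (vertical_c ?T' P (src U')) (vertical_c ?T' P (tgt U')) \<subseteq> pullback ?T' P (tgt U') F"
      by (rule push_transfer_subset[OF push(2) vsum_push[OF pull(3,4)] equalityD2[OF eq(2)]
          vsum_push_inverse[OF invv invv]])
  qed
  moreover have "submersion ?T' P (tgt U')" "submersion ?T' P (src U')"
    using U s.submersion_push t.submersion_push by (simp_all add: bisubmersion_def)
  ultimately show ?thesis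
    using diffeo_smooth_manifold[OF T0 T \<Psi>] by (simp add: bisubmersion_def)
qed

section \<open>Transport of path holonomy bisubmersions\<close>

text \<open>The image under \<theta> of an integral curve of Z is an integral curve of the pushed
  field.\<close>

lemma time_one_push:
  assumes P: "smooth_atlas P" and \<theta>: "diffeo P P \<theta> \<theta>'" and t: "time_one P Z x y"
  shows "time_one P (push_field P \<theta> \<theta>' Z) (\<theta> x) (\<theta> y)"
proof -
  note D = diffeoD[OF \<theta>]
  from t obtain \<gamma> where \<gamma>: "\<gamma> 0 = x" "\<gamma> 1 = y" "continuous_map (top_of_set {0..1::real}) (mtop P) \<gamma>"
    "\<And>\<tau> f. \<tau> \<in> {0..1} \<Longrightarrow> f \<in> smooth_near P (\<gamma> \<tau>) \<Longrightarrow>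
        ((\<lambda>r. f (\<gamma> r)) has_real_derivative Z (\<gamma> \<tau>) f) (at \<tau> within {0..1})"
    unfolding time_one_def by blast
  have in_pts: "\<gamma> \<tau> \<in> pts P" if "\<tau> \<in> {0..1}" for \<tau>
    using continuous_map_image_subset_topspace[OF \<gamma>(3)] that by (auto simp: topspace_mtop P)
  have "continuous_map (mtop P) (mtop P) \<theta>"
    using diffeo_homeomorphic_maps[OF P P \<theta>] by (simp add: homeomorphic_maps_def)
  from continuous_map_compose[OF \<gamma>(3) this]
  have c: "continuous_map (top_of_set {0..1::real}) (mtop P) (\<lambda>r. \<theta> (\<gamma> r))" by (simp add: comp_def)
  have "((\<lambda>r. f (\<theta> (\<gamma> r))) has_real_derivative push_field P \<theta> \<theta>' Z (\<theta> (\<gamma> \<tau>)) f) (at \<tau> within {0..1})"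
    if \<tau>: "\<tau> \<in> {0..1}" and f: "f \<in> smooth_near P (\<theta> (\<gamma> \<tau>))" for \<tau> f
    using \<gamma>(4)[OF \<tau> sm_atD[OF D(1)[OF in_pts[OF \<tau>]] f]] f D(2,3)[OF in_pts[OF \<tau>]]
    by (simp add: push_field_def tmap_def comp_def)
  then show ?thesis
    unfolding time_one_def using c \<gamma>(1,2) by (intro exI[of _ "\<lambda>r. \<theta> (\<gamma> r)"]) auto
qed

text \<open>A coefficient vanishing at x, read through \<theta>', vanishes at \<theta> x.\<close>

lemma vanishing_mult_push:
  assumes P: "smooth_atlas P" and \<theta>: "diffeo P P \<theta> \<theta>'" and x: "x \<in> pts P"
    and F: "\<And>V. V \<in> F \<Longrightarrow> push_field P \<theta> \<theta>' V \<in> F" and Z: "Z \<in> vanishing_mult P x F"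
  shows "push_field P \<theta> \<theta>' Z \<in> vanishing_mult P (\<theta> x) F"
proof -
  note D = diffeoD[OF \<theta>]
  obtain n f Y where Y: "Z = lincomb n f Y"
    "\<forall>i<n. smooth_fun P (pts P) (f i) \<and> f i x = 0 \<and> Y i \<in> F"
    using Z unfolding vanishing_mult_def by blast
  have "smooth_fun P (pts P) (\<lambda>q. f i (\<theta>' q))" if "i < n" for i
    by (rule smooth_fun_push[OF P P \<theta> openin_pts[OF P]])
      (use Y(2) that D(6) in \<open>auto simp: smooth_fun_iff_near P\<close>)
  then have "\<forall>i<n. smooth_fun P (pts P) (\<lambda>q. f i (\<theta>' q)) \<and> f i (\<theta>' (\<theta> x)) = 0 \<and>
      push_field P \<theta> \<theta>' (Y i) \<in> F"
    using Y(2) F D(2)[OF x] by simp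
  then show ?thesis
    unfolding Y(1) push_field_lincomb vanishing_mult_def by blast
qed

text \<open>\<theta> induces an isomorphism from F modulo \<open>I\<^sub>x F\<close> to the same
  quotient at \<theta> x. Independence is checked after pulling back; for generation a field is
  pulled back, expanded there, and the expansion pushed forward.\<close>

lemma basis_mod_push:
  assumes P: "smooth_atlas P" and F: "singular_foliation P F" and \<theta>: "diffeo P P \<theta> \<theta>'"
    and x: "x \<in> pts P"
    and inv: "\<And>V. V \<in> F \<Longrightarrow> push_field P \<theta> \<theta>' V \<in> F" "\<And>V. V \<in> F \<Longrightarrow> push_field P \<theta>' \<theta> V \<in> F"
    and b: "basis_mod P x F n Y"
  shows "basis_mod P (\<theta> x) F n (\<lambda>i. push_field P \<theta> \<theta>' (Y i))"
  unfolding basis_mod_def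
proof (intro conjI allI ballI impI)
  note D = diffeoD[OF \<theta>] and \<theta>' = diffeo_sym[OF \<theta>]
  have Y: "\<And>i. i < n \<Longrightarrow> Y i \<in> F" using b by (simp add: basis_mod_def)
  show "push_field P \<theta> \<theta>' (Y i) \<in> F" if "i < n" for i using inv(1)[OF Y[OF that]] .
  have lc: "lincomb n (\<lambda>i p. a i) (\<lambda>i. push_field P \<theta> \<theta>' (Y i)) =
      push_field P \<theta> \<theta>' (lincomb n (\<lambda>i p. a i) Y)" for a
    by (simp add: push_field_lincomb)
  have const: "smooth_fun P (pts P) (\<lambda>p. c)" for c
    by (simp add: smooth_fun_iff_near P openin_pts smooth_near_const)
  have lcF: "lincomb n (\<lambda>i p. a i) Y \<in> F" for a
    by (rule foliation_lincomb[OF F const Y])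
  fix a :: "nat \<Rightarrow> real" and i
  assume i: "i < n" and v: "lincomb n (\<lambda>i p. a i) (\<lambda>i. push_field P \<theta> \<theta>' (Y i)) \<in> vanishing_mult P (\<theta> x) F"
  have "push_field P \<theta>' \<theta> (push_field P \<theta> \<theta>' (lincomb n (\<lambda>i p. a i) Y)) \<in> vanishing_mult P (\<theta>' (\<theta> x)) F"
    by (rule vanishing_mult_push[OF P \<theta>' D(3)[OF x] inv(2) v[unfolded lc]])
  then have "lincomb n (\<lambda>i p. a i) Y \<in> vanishing_mult P x F"
    by (simp only: D(2)[OF x] push_field_inverse[OF P P \<theta> foliation_vfields[OF F lcF]])
  then show "a i = 0" using b i unfolding basis_mod_def by blast
next
  note D = diffeoD[OF \<theta>] and \<theta>' = diffeo_sym[OF \<theta>]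
  fix Z assume Z: "Z \<in> F"
  obtain a :: "nat \<Rightarrow> real" where
    "(\<lambda>p \<phi>. push_field P \<theta>' \<theta> Z p \<phi> - lincomb n (\<lambda>i p. a i) Y p \<phi>) \<in> vanishing_mult P x F"
    using b inv(2)[OF Z] unfolding basis_mod_def by blast
  from vanishing_mult_push[OF P \<theta> x inv(1) this]
  have "(\<lambda>p \<phi>. Z p \<phi> - lincomb n (\<lambda>i p. a i) (\<lambda>i. push_field P \<theta> \<theta>' (Y i)) p \<phi>)
      \<in> vanishing_mult P (\<theta> x) F"
    by (simp only: push_field_diff push_field_inverse[OF P P \<theta>' foliation_vfields[OF F Z]]
        push_field_lincomb)
  then show "\<exists>a :: nat \<Rightarrow> real. (\<lambda>p \<phi>. Z p \<phi> - lincomb n (\<lambda>i p. a i) (\<lambda>i. push_field P \<theta> \<theta>' (Y i)) p \<phi>)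
      \<in> vanishing_mult P (\<theta> x) F" by (rule exI[of _ a])
qed

text \<open>The flow parameter is kept and the base point moved. The clause for \<open>Comp\<close>
  is a default: compositions receive their lifts from the factors in
  \<open>lifts_comp\<close>.\<close>

definition hpt_map :: "('p \<Rightarrow> 'p) \<Rightarrow> 'p hpt \<Rightarrow> 'p hpt" where
  "hpt_map \<theta> w = (case w of Path v x \<Rightarrow> Path v (\<theta> x) | Comp u v \<Rightarrow> Comp u v)"

lemma hpt_map_Path [simp]: "hpt_map \<theta> (Path v x) = Path v (\<theta> x)"
  by (simp add: hpt_map_def)

abbreviation path_mfd :: "'p smfd \<Rightarrow> nat \<Rightarrow> ((nat \<Rightarrow> real) \<times> 'p) set \<Rightarrow> 'p hpt smfd" where
  "path_mfd P n N \<equiv> image_mfd (\<lambda>(v, x). Path v x) (open_mfd (prod_mfd (euclidean_mfd n) P) N)"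

lemma inj_Path: "inj_on (\<lambda>(v, x). Path v x) A"
  by (auto simp: inj_on_def)

context
  fixes P :: "'p smfd" and n :: nat
  assumes P: "smooth_atlas P"
begin

lemma smooth_atlas_path_base: "smooth_atlas (prod_mfd (euclidean_mfd n) P)"
  by (intro smooth_atlas_prod_mfd smooth_atlas_euclidean P)

lemma smooth_atlas_path_mfd:
  "openin (mtop (prod_mfd (euclidean_mfd n) P)) N \<Longrightarrow> smooth_atlas (path_mfd P n N)"
  by (intro smooth_atlas_image_mfd smooth_atlas_open_mfd smooth_atlas_path_base inj_Path)

lemma pts_path_mfd:
  "openin (mtop (prod_mfd (euclidean_mfd n) P)) N \<Longrightarrow> pts (path_mfd P n N) = (\<lambda>(v, x). Path v x) ` N"
  by (simp add: pts_image_mfd pts_open_mfd' smooth_atlas_path_base)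

lemma smooth_at_path_base:
  assumes \<theta>: "\<And>x. x \<in> pts P \<Longrightarrow> smooth_at P P \<theta> x" and z: "z \<in> pts (prod_mfd (euclidean_mfd n) P)"
  shows "smooth_at (prod_mfd (euclidean_mfd n) P) (prod_mfd (euclidean_mfd n) P) (\<lambda>z. (fst z, \<theta> (snd z))) z"
proof (rule smooth_at_Pair[OF smooth_atlas_euclidean P smooth_atlas_path_base])
  show "smooth_at (prod_mfd (euclidean_mfd n) P) (euclidean_mfd n) fst z"
    by (rule smooth_at_fst[OF smooth_atlas_euclidean P z])
  show "smooth_at (prod_mfd (euclidean_mfd n) P) P (\<lambda>z. \<theta> (snd z)) z"
    by (rule smooth_at_compose[where f = snd and g = \<theta>, OF smooth_at_snd[OF smooth_atlas_euclidean P z]])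
      (use z in \<open>auto simp: pts_prod_mfd intro: \<theta>\<close>)
qed

lemma smooth_at_hpt_map:
  assumes \<theta>: "\<And>x. x \<in> pts P \<Longrightarrow> smooth_at P P \<theta> x"
    and N: "openin (mtop (prod_mfd (euclidean_mfd n) P)) N"
    and N': "openin (mtop (prod_mfd (euclidean_mfd n) P)) N'"
    and maps: "\<And>v x. (v, x) \<in> N \<Longrightarrow> (v, \<theta> x) \<in> N'" and w: "w \<in> pts (path_mfd P n N)"
  shows "smooth_at (path_mfd P n N) (path_mfd P n N') (hpt_map \<theta>) w"
proof -
  let ?B = "prod_mfd (euclidean_mfd n) P"
  note B = smooth_atlas_path_base
  obtain v x where z: "(v, x) \<in> N" "w = (\<lambda>(v, x). Path v x) (v, x)"
    using w unfolding pts_path_mfd[OF N] by auto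
  have zp: "(v, x) \<in> pts ?B" using z(1) openin_mtop_subset[OF B N] by auto
  have zN: "(v, x) \<in> pts (open_mfd ?B N)" using z(1) by (simp add: pts_open_mfd'[OF B N])
  have z'N: "(v, \<theta> x) \<in> pts (open_mfd ?B N')" using maps[OF z(1)] by (simp add: pts_open_mfd'[OF B N'])
  have "smooth_at (open_mfd ?B N) (open_mfd ?B N') (\<lambda>z. (fst z, \<theta> (snd z))) (v, x)"
    unfolding smooth_at_open_mfd_dom[OF B N z(1)]
    by (subst smooth_at_open_mfd_cod[OF B N']) (use maps[OF z(1)] smooth_at_path_base[OF \<theta> zp] in auto)
  from smooth_at_compose[where g = "\<lambda>(v, x). Path v x", OF this
      smooth_at_image_mfd[OF smooth_atlas_open_mfd[OF B N'] inj_Path]] z'N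
  have "smooth_at (open_mfd ?B N) (path_mfd P n N') (\<lambda>z. Path (fst z) (\<theta> (snd z))) (v, x)" by simp
  moreover have "(\<lambda>q. hpt_map \<theta> ((\<lambda>(v, x). Path v x) q)) = (\<lambda>z. Path (fst z) (\<theta> (snd z)))"
    by (auto simp: fun_eq_iff)
  ultimately show ?thesis
    unfolding z(2) smooth_at_image_mfd_dom[OF smooth_atlas_open_mfd[OF B N] inj_Path zN] by simp
qed

end

text \<open>An isomorphism of \<open>push_bisub \<theta> U\<close> with U', given together with its
  inverse.\<close>

definition lifts :: "('a \<Rightarrow> 'a) \<Rightarrow> ('u, 'a) bisub \<Rightarrow> ('w, 'a) bisub \<Rightarrow> ('u \<Rightarrow> 'w) \<Rightarrow> ('w \<Rightarrow> 'u) \<Rightarrow> bool" where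
  "lifts \<theta> U U' f f' \<longleftrightarrow> diffeo (total_mfd U) (total_mfd U') f f' \<and>
     (\<forall>u \<in> pts (total_mfd U). src U' (f u) = \<theta> (src U u) \<and> tgt U' (f u) = \<theta> (tgt U u))"

text \<open>Flows are natural: the time-one flow of a pushed field is that of the field conjugated
  by \<theta>. So the translate is again a path holonomy bisubmersion, for the pushed basis and with
  unchanged flow parameters.\<close>

lemma path_holonomy_bisub_push:
  assumes P: "smooth_atlas P" and F: "singular_foliation P F" and \<theta>: "diffeo P P \<theta> \<theta>'"
    and inv: "\<And>V. V \<in> F \<Longrightarrow> push_field P \<theta> \<theta>' V \<in> F" "\<And>V. V \<in> F \<Longrightarrow> push_field P \<theta>' \<theta> V \<in> F"
    and U: "path_holonomy_bisub P F x0 U"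
  obtains U' where "path_holonomy_bisub P F (\<theta> x0) U'" "lifts \<theta> U U' (hpt_map \<theta>) (hpt_map \<theta>')"
proof -
  note D = diffeoD[OF \<theta>]
  have x0: "x0 \<in> pts P" and bU: "bisubmersion P F U"
    and conn: "\<And>x. x \<in> pts P \<Longrightarrow>
      connectedin (mtop (total_mfd U)) {u \<in> pts (total_mfd U). src U u = x}"
    using U by (simp_all add: path_holonomy_bisub_def)
  from U obtain n Y N where b: "basis_mod P x0 F n Y"
    and N: "openin (mtop (prod_mfd (euclidean_mfd n) P)) N" "((\<lambda>i. 0), x0) \<in> N"
    and tot: "total_mfd U = path_mfd P n N"
    and flow: "\<And>v x. (v, x) \<in> N \<Longrightarrow> src U (Path v x) = x \<and>
           time_one P (lincomb n (\<lambda>i p. v i) Y) x (tgt U (Path v x))"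
    unfolding path_holonomy_bisub_def by blast
  let ?B = "prod_mfd (euclidean_mfd n) P"
  note B = smooth_atlas_path_base[OF P, of n]
  note R = bisubmersion_regular(1)[OF P bU]
  have Npts: "N \<subseteq> pts ?B" by (rule openin_mtop_subset[OF B N(1)])
  then have xP: "x \<in> pts P" if "(v, x) \<in> N" for v x using that by (auto simp: pts_prod_mfd)
  \<comment> \<open>The translate of N, written as a preimage so that openness is immediate.\<close>
  define N' where "N' = {z \<in> pts ?B. (fst z, \<theta>' (snd z)) \<in> N}"
  have N': "openin (mtop ?B) N'" unfolding N'_def
    by (rule openin_sm_preimage[OF B B openin_pts[OF B] smooth_at_path_base[OF P D(4)] N(1)])
  have maps: "(v, \<theta> x) \<in> N'" if "(v, x) \<in> N" for v x
  proof -
    have "(v, x) \<in> pts ?B" using that Npts by auto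
    then show ?thesis using that D(2,3)[OF xP[OF that]] by (simp add: N'_def pts_prod_mfd)
  qed
  have maps': "(v, \<theta>' x) \<in> N" "x \<in> pts P" if "(v, x) \<in> N'" for v x
    using that by (auto simp: N'_def pts_prod_mfd)
  \<comment> \<open>Conjugating the structure maps makes the source the projection to the base point
    and the target the flow of the pushed fields.\<close>
  define U' where "U' = \<lparr>total_mfd = path_mfd P n N', tgt = (\<lambda>w. \<theta> (tgt U (hpt_map \<theta>' w))),
    src = (\<lambda>w. \<theta> (src U (hpt_map \<theta>' w)))\<rparr>"
  have U': "total_mfd U' = path_mfd P n N'" "\<And>w. tgt U' w = \<theta> (tgt U (hpt_map \<theta>' w))"
    "\<And>w. src U' w = \<theta> (src U (hpt_map \<theta>' w))"
    by (simp_all add: U'_def)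
  have pts_U: "pts (total_mfd U) = (\<lambda>(v, x). Path v x) ` N" unfolding tot by (rule pts_path_mfd[OF P N(1)])
  have pts_U': "pts (total_mfd U') = (\<lambda>(v, x). Path v x) ` N'"
    unfolding U' by (rule pts_path_mfd[OF P N'])
  have T: "smooth_atlas (total_mfd U')" unfolding U' by (rule smooth_atlas_path_mfd[OF P N'])
  have \<Psi>: "diffeo (total_mfd U) (total_mfd U') (hpt_map \<theta>) (hpt_map \<theta>')"
    unfolding diffeo_def
  proof (intro conjI ballI)
    fix w assume w: "w \<in> pts (total_mfd U)"
    show "smooth_at (total_mfd U) (total_mfd U') (hpt_map \<theta>) w"
      unfolding tot U' by (rule smooth_at_hpt_map[OF P D(1) N(1) N' maps]) (use w in \<open>simp_all add: tot\<close>)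
    show "hpt_map \<theta>' (hpt_map \<theta> w) = w" using w D(2) xP unfolding pts_U by auto
  next
    fix w assume w: "w \<in> pts (total_mfd U')"
    show "smooth_at (total_mfd U') (total_mfd U) (hpt_map \<theta>') w"
      unfolding tot U'
      by (rule smooth_at_hpt_map[OF P D(4) N' N(1) maps'(1)]) (use w in \<open>simp_all add: U'\<close>)
    show "hpt_map \<theta> (hpt_map \<theta>' w) = w" using w D(5) maps' unfolding pts_U' by auto
  qed
  have ends: "src U' (hpt_map \<theta> u) = \<theta> (src U u)" "tgt U' (hpt_map \<theta> u) = \<theta> (tgt U u)"
    if "u \<in> pts (total_mfd U)" for u
    using diffeoD(2)[OF \<Psi> that] by (simp_all add: U')
  have lift: "lifts \<theta> U U' (hpt_map \<theta>) (hpt_map \<theta>')"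
    using \<Psi> ends by (simp add: lifts_def)
  have "path_holonomy_bisub P F (\<theta> x0) U'"
    unfolding path_holonomy_bisub_def
  proof (intro conjI ballI)
    show "\<theta> x0 \<in> pts P" by (rule D(3)[OF x0])
    show "bisubmersion P F U'"
      by (rule bisubmersion_push[OF T P \<Psi> \<theta> ends inv bU])
    fix x assume x: "x \<in> pts P"
    \<comment> \<open>Connectedness is inherited: the source fibre over x is the image of the one
      over \<theta>' x.\<close>
    have "{u \<in> pts (total_mfd U'). src U' u = x} =
        hpt_map \<theta> ` {u \<in> pts (total_mfd U). src U u = \<theta>' x}"
    proof (intro subset_antisym subsetI)
      fix w assume w: "w \<in> {u \<in> pts (total_mfd U'). src U' u = x}"
      note u = diffeoD(6)[OF \<Psi>, of w]
      have "src U (hpt_map \<theta>' w) = \<theta>' x"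
        using w D(2)[OF smooth_at_pts(2)[OF regularD(4)[OF R u]]] by (auto simp: U'(3))
      then show "w \<in> hpt_map \<theta> ` {u \<in> pts (total_mfd U). src U u = \<theta>' x}"
        using w u diffeoD(5)[OF \<Psi>, of w] by (intro image_eqI[of _ _ "hpt_map \<theta>' w"]) auto
    qed (use ends D(5)[OF x] diffeoD(3)[OF \<Psi>] in auto)
    moreover have c: "continuous_map (mtop (total_mfd U)) (mtop (total_mfd U')) (hpt_map \<theta>)"
      using diffeo_homeomorphic_maps[OF regularD(1)[OF R] T \<Psi>] by (simp add: homeomorphic_maps_def)
    ultimately show "connectedin (mtop (total_mfd U')) {u \<in> pts (total_mfd U'). src U' u = x}"
      using connectedin_continuous_map_image[OF c conn[OF D(6)[OF x]]] by simp
  next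
    let ?Y = "\<lambda>i. push_field P \<theta> \<theta>' (Y i)"
    have "src U' (Path v y) = y \<and> time_one P (lincomb n (\<lambda>i p. v i) ?Y) y (tgt U' (Path v y))"
      if "(v, y) \<in> N'" for v y
    proof -
      note m = maps'[OF that]
      have "time_one P (push_field P \<theta> \<theta>' (lincomb n (\<lambda>i p. v i) Y)) (\<theta> (\<theta>' y)) (\<theta> (tgt U (Path v (\<theta>' y))))"
        by (rule time_one_push[OF P \<theta>]) (use flow[OF m(1)] in simp)
      then show ?thesis using flow[OF m(1)] D(5)[OF m(2)] by (simp add: U' push_field_lincomb)
    qed
    then show "\<exists>n Y N. basis_mod P (\<theta> x0) F n Y \<and>
        openin (mtop (prod_mfd (euclidean_mfd n) P)) N \<and> ((\<lambda>i. 0), \<theta> x0) \<in> N \<and>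
        total_mfd U' = path_mfd P n N \<and>
        (\<forall>(v, x) \<in> N. src U' (Path v x) = x \<and>
           time_one P (lincomb n (\<lambda>i p. v i) Y) x (tgt U' (Path v x)))"
      using basis_mod_push[OF P F \<theta> x0 inv b] N' maps[OF N(2)] U'(1)
      by (intro exI[of _ n] exI[of _ ?Y] exI[of _ N'] conjI) auto
  qed
  then show thesis using lift by (rule that)
qed

subsection \<open>The actions on the holonomy groupoid\<close>

lemma liftsD:
  assumes "lifts \<theta> U U' f f'"
  shows "diffeo (total_mfd U) (total_mfd U') f f'"
    "\<And>u. u \<in> pts (total_mfd U) \<Longrightarrow> src U' (f u) = \<theta> (src U u)"
    "\<And>u. u \<in> pts (total_mfd U) \<Longrightarrow> tgt U' (f u) = \<theta> (tgt U u)"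
  using assms by (simp_all add: lifts_def)

lemma lifts_inverse_ends:
  assumes l: "lifts \<theta> U U' f f'" and U: "regular P U" and \<theta>: "diffeo P P \<theta> \<theta>'"
    and w: "w \<in> pts (total_mfd U')"
  shows "src U (f' w) = \<theta>' (src U' w)" "tgt U (f' w) = \<theta>' (tgt U' w)"
proof -
  note D = diffeoD[OF liftsD(1)[OF l]]
  note u = D(6)[OF w]
  show "src U (f' w) = \<theta>' (src U' w)"
    using liftsD(2)[OF l u] D(5)[OF w] diffeoD(2)[OF \<theta> smooth_at_pts(2)[OF regularD(4)[OF U u]]] by simp
  show "tgt U (f' w) = \<theta>' (tgt U' w)"
    using liftsD(3)[OF l u] D(5)[OF w] diffeoD(2)[OF \<theta> smooth_at_pts(2)[OF regularD(3)[OF U u]]] by simp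
qed

text \<open>The lifts of the factors act on pairs. They respect the matching condition because both
  intertwine the ends with the same \<theta>.\<close>

lemma lifts_comp:
  assumes P: "smooth_atlas P" and \<theta>: "diffeo P P \<theta> \<theta>'"
    and U: "regular P U" "regular P U'" "lifts \<theta> U U' f f'"
    and V: "regular P V" "regular P V'" "lifts \<theta> V V' g g'"
  shows "lifts \<theta> (comp_bisub P U V) (comp_bisub P U' V')
    (\<lambda>w. Comp (f (lft w)) (g (rgt w))) (\<lambda>w. Comp (f' (lft w)) (g' (rgt w)))"
proof -
  note f = diffeoD[OF liftsD(1)[OF U(3)]] and g = diffeoD[OF liftsD(1)[OF V(3)]]
  note C = regularD(1)[OF regular_comp[OF P U(1) V(1)]]
  note C' = regularD(1)[OF regular_comp[OF P U(2) V(2)]]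
  note fe = liftsD(2,3)[OF U(3)] and ge = liftsD(2,3)[OF V(3)]
  note fe' = lifts_inverse_ends[OF U(3,1) \<theta>] and ge' = lifts_inverse_ends[OF V(3,1) \<theta>]
  have pts: "\<exists>u v. w = Comp u v \<and> u \<in> pts (total_mfd U) \<and> v \<in> pts (total_mfd V) \<and> src U u = tgt V v"
    if "w \<in> pts (total_mfd (comp_bisub P U V))" for w
    using that unfolding pts_comp_bisub[OF P U(1) V(1)] by blast
  have pts': "\<exists>u v. w = Comp u v \<and> u \<in> pts (total_mfd U') \<and> v \<in> pts (total_mfd V') \<and> src U' u = tgt V' v"
    if "w \<in> pts (total_mfd (comp_bisub P U' V'))" for w
    using that unfolding pts_comp_bisub[OF P U(2) V(2)] by blast
  show ?thesis
    unfolding lifts_def diffeo_def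
  proof (intro conjI ballI)
    fix w assume w: "w \<in> pts (total_mfd (comp_bisub P U V))"
    then obtain u v where uv: "w = Comp u v" "u \<in> pts (total_mfd U)" "v \<in> pts (total_mfd V)"
      using pts by blast
    show "smooth_at (total_mfd (comp_bisub P U V)) (total_mfd (comp_bisub P U' V'))
        (\<lambda>w. Comp (f (lft w)) (g (rgt w))) w"
    proof (rule smooth_at_Comp[OF P U(2) V(2) C _ _ openin_pts[OF C] w])
      show "smooth_at (total_mfd (comp_bisub P U V)) (total_mfd U') (\<lambda>w. f (lft w)) w"
        by (rule smooth_at_compose[where f = lft and g = f, OF smooth_at_lft[OF P U(1) V(1) w]])
          (use f(1) uv in simp)
      show "smooth_at (total_mfd (comp_bisub P U V)) (total_mfd V') (\<lambda>w. g (rgt w)) w"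
        by (rule smooth_at_compose[where f = rgt and g = g, OF smooth_at_rgt[OF P U(1) V(1) w]])
          (use g(1) uv in simp)
      show "src U' (f (lft q)) = tgt V' (g (rgt q))" if "q \<in> pts (total_mfd (comp_bisub P U V))" for q
        using pts[OF that] fe(1) ge(2) by auto
    qed
    show "Comp (f' (lft (Comp (f (lft w)) (g (rgt w))))) (g' (rgt (Comp (f (lft w)) (g (rgt w))))) = w"
      using uv f(2) g(2) by simp
    show "src (comp_bisub P U' V') (Comp (f (lft w)) (g (rgt w))) = \<theta> (src (comp_bisub P U V) w)"
      "tgt (comp_bisub P U' V') (Comp (f (lft w)) (g (rgt w))) = \<theta> (tgt (comp_bisub P U V) w)"
      using uv fe(2) ge(1) by (simp_all add: comp_bisub_simps)
  next
    fix w assume w: "w \<in> pts (total_mfd (comp_bisub P U' V'))"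
    then obtain u v where uv: "w = Comp u v" "u \<in> pts (total_mfd U')" "v \<in> pts (total_mfd V')"
      using pts' by blast
    show "smooth_at (total_mfd (comp_bisub P U' V')) (total_mfd (comp_bisub P U V))
        (\<lambda>w. Comp (f' (lft w)) (g' (rgt w))) w"
    proof (rule smooth_at_Comp[OF P U(1) V(1) C' _ _ openin_pts[OF C'] w])
      show "smooth_at (total_mfd (comp_bisub P U' V')) (total_mfd U) (\<lambda>w. f' (lft w)) w"
        by (rule smooth_at_compose[where f = lft and g = f', OF smooth_at_lft[OF P U(2) V(2) w]])
          (use f(4) uv in simp)
      show "smooth_at (total_mfd (comp_bisub P U' V')) (total_mfd V) (\<lambda>w. g' (rgt w)) w"
        by (rule smooth_at_compose[where f = rgt and g = g', OF smooth_at_rgt[OF P U(2) V(2) w]])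
          (use g(4) uv in simp)
      show "src U (f' (lft q)) = tgt V (g' (rgt q))" if "q \<in> pts (total_mfd (comp_bisub P U' V'))" for q
        using pts'[OF that] fe'(1) ge'(2) by auto
    qed
    show "Comp (f (lft (Comp (f' (lft w)) (g' (rgt w))))) (g (rgt (Comp (f' (lft w)) (g' (rgt w))))) = w"
      using uv f(5) g(5) by simp
  qed
qed

text \<open>Induction over the generation of the atlas: an inverse keeps the lift, as the condition
  on it is symmetric in the two ends, and a composition takes the pair of lifts of its
  factors.\<close>

lemma path_holonomy_atlas_lifts:
  assumes P: "smooth_atlas P" and F: "singular_foliation P F" and \<theta>: "diffeo P P \<theta> \<theta>'"
    and inv: "\<And>V. V \<in> F \<Longrightarrow> push_field P \<theta> \<theta>' V \<in> F" "\<And>V. V \<in> F \<Longrightarrow> push_field P \<theta>' \<theta> V \<in> F"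
    and U: "U \<in> path_holonomy_atlas P F"
  shows "\<exists>U' f f'. U' \<in> path_holonomy_atlas P F \<and> lifts \<theta> U U' f f'"
  using U unfolding path_holonomy_atlas_def
proof induction
  case (elem U)
  then obtain x0 where x0: "path_holonomy_bisub P F x0 U" by blast
  obtain U' where "path_holonomy_bisub P F (\<theta> x0) U'" "lifts \<theta> U U' (hpt_map \<theta>) (hpt_map \<theta>')"
    by (rule path_holonomy_bisub_push[OF P F \<theta> inv x0]) blast
  then show ?case by (intro exI[of _ U'] exI conjI generated_atlas.elem) auto
next
  case (inverse U)
  then obtain x0 where x0: "path_holonomy_bisub P F x0 U" by blast
  obtain U' where U': "path_holonomy_bisub P F (\<theta> x0) U'" "lifts \<theta> U U' (hpt_map \<theta>) (hpt_map \<theta>')"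
    by (rule path_holonomy_bisub_push[OF P F \<theta> inv x0]) blast
  from U'(2) have "lifts \<theta> (inverse_bisub U) (inverse_bisub U') (hpt_map \<theta>) (hpt_map \<theta>')"
    by (simp add: lifts_def inverse_bisub_def)
  then show ?case using U'(1)
    by (intro exI[of _ "inverse_bisub U'"] exI conjI generated_atlas.inverse) auto
next
  case (comp U V)
  note reg = path_holonomy_atlas_regular[OF P, unfolded path_holonomy_atlas_def]
  from comp.IH(1) obtain U' f f' where U': "U' \<in> generated_atlas P {U. \<exists>x0. path_holonomy_bisub P F x0 U}"
    "lifts \<theta> U U' f f'" by blast
  from comp.IH(2) obtain V' g g' where V': "V' \<in> generated_atlas P {U. \<exists>x0. path_holonomy_bisub P F x0 U}"
    "lifts \<theta> V V' g g'" by blast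
  show ?case
    using lifts_comp[OF P \<theta> reg[OF comp.hyps(1)] reg[OF U'(1)] U'(2) reg[OF comp.hyps(2)] reg[OF V'(1)] V'(2)]
      generated_atlas.comp[OF U'(1) V'(1)] by blast
qed

lemma atlas_pointsD:
  assumes "(U, u) \<in> atlas_points A"
  shows "U \<in> A" "u \<in> pts (total_mfd U)"
  using assms by (simp_all add: atlas_points_def)

lemma push_bisub_simps [simp]:
  "total_mfd (push_bisub h U) = total_mfd U" "src (push_bisub h U) u = h (src U u)"
  "tgt (push_bisub h U) u = h (tgt U u)"
  by (simp_all add: push_bisub_def)

lemma local_morphism_push:
  "local_morphism U u V v \<Longrightarrow> local_morphism (push_bisub h U) u (push_bisub h V) v"
  unfolding local_morphism_def by simp metis

section \<open>Well-definedness of the operations on germ classes\<close>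

context
  fixes P :: "'p smfd" and F :: "'p vfield set"
  assumes P: "smooth_atlas P"
begin

abbreviation "atlas \<equiv> path_holonomy_atlas P F"

lemma atlas_regular: "(U, u) \<in> atlas_points atlas \<Longrightarrow> regular P U"
  by (rule path_holonomy_atlas_regular[OF P atlas_pointsD(1)])

lemma atlas_smooth: "(U, u) \<in> atlas_points atlas \<Longrightarrow> smooth_atlas (total_mfd U)"
  by (rule regularD(1)[OF atlas_regular])

lemma comp_points:
  assumes "(U, u) \<in> atlas_points atlas" "(V, v) \<in> atlas_points atlas" "src U u = tgt V v"
  shows "(comp_bisub P U V, Comp u v) \<in> atlas_points atlas"
proof -
  have "comp_bisub P U V \<in> atlas"
    using atlas_pointsD(1)[OF assms(1)] atlas_pointsD(1)[OF assms(2)]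
    unfolding path_holonomy_atlas_def by (rule generated_atlas.comp)
  moreover have "Comp u v \<in> pts (total_mfd (comp_bisub P U V))"
    unfolding pts_comp_bisub[OF P atlas_regular[OF assms(1)] atlas_regular[OF assms(2)]]
    using atlas_pointsD(2)[OF assms(1)] atlas_pointsD(2)[OF assms(2)] assms(3) by blast
  ultimately show ?thesis by (simp add: atlas_points_def)
qed

text \<open>Morphisms of the factors act on pairs; they preserve ends, so that pairs stay
  composable.\<close>

lemma local_morphism_comp:
  assumes U: "(U, u) \<in> atlas_points atlas" "(U', u') \<in> atlas_points atlas" "local_morphism U u U' u'"
    and V: "(V, v) \<in> atlas_points atlas" "(V', v') \<in> atlas_points atlas" "local_morphism V v V' v'"
    and uv: "src U u = tgt V v"
  shows "local_morphism (comp_bisub P U V) (Comp u v) (comp_bisub P U' V') (Comp u' v')"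
proof -
  note C = regularD(1)[OF regular_comp[OF P atlas_regular[OF U(1)] atlas_regular[OF V(1)]]]
  note C' = regularD(1)[OF regular_comp[OF P atlas_regular[OF U(2)] atlas_regular[OF V(2)]]]
  let ?C = "total_mfd (comp_bisub P U V)"
  obtain M f where f: "openin (mtop (total_mfd U)) M" "u \<in> M"
    "\<And>w. w \<in> M \<Longrightarrow> smooth_at (total_mfd U) (total_mfd U') f w" "f u = u'"
    "\<And>w. w \<in> M \<Longrightarrow> src U' (f w) = src U w" "\<And>w. w \<in> M \<Longrightarrow> tgt U' (f w) = tgt U w"
    by (rule local_morphismE[OF U(3) atlas_smooth[OF U(1)] atlas_smooth[OF U(2)]]) blast
  obtain N g where g: "openin (mtop (total_mfd V)) N" "v \<in> N"
    "\<And>w. w \<in> N \<Longrightarrow> smooth_at (total_mfd V) (total_mfd V') g w" "g v = v'"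
    "\<And>w. w \<in> N \<Longrightarrow> src V' (g w) = src V w" "\<And>w. w \<in> N \<Longrightarrow> tgt V' (g w) = tgt V w"
    by (rule local_morphismE[OF V(3) atlas_smooth[OF V(1)] atlas_smooth[OF V(2)]]) blast
  let ?W = "{w \<in> pts ?C. lft w \<in> M} \<inter> {w \<in> pts ?C. rgt w \<in> N}"
  have W: "openin (mtop ?C) ?W"
    by (intro openin_Int
        openin_sm_preimage[OF C atlas_smooth[OF U(1)] openin_pts[OF C] smooth_at_lft[OF P atlas_regular[OF U(1)] atlas_regular[OF V(1)]] f(1)]
        openin_sm_preimage[OF C atlas_smooth[OF V(1)] openin_pts[OF C] smooth_at_rgt[OF P atlas_regular[OF U(1)] atlas_regular[OF V(1)]] g(1)])
  have match: "src U (lft q) = tgt V (rgt q)" if "q \<in> pts ?C" for q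
    using that unfolding pts_comp_bisub[OF P atlas_regular[OF U(1)] atlas_regular[OF V(1)]] by auto
  show ?thesis
  proof (rule local_morphismI[OF C C' W, where f = "\<lambda>w. Comp (f (lft w)) (g (rgt w))"])
    show "Comp u v \<in> ?W"
      using atlas_pointsD(2)[OF comp_points[OF U(1) V(1) uv]] f(2) g(2) by simp
    show "smooth_at ?C (total_mfd (comp_bisub P U' V')) (\<lambda>w. Comp (f (lft w)) (g (rgt w))) w" if w: "w \<in> ?W" for w
    proof (rule smooth_at_Comp[OF P atlas_regular[OF U(2)] atlas_regular[OF V(2)] C _ _ W w])
      have wC: "w \<in> pts ?C" using w by simp
      show "smooth_at ?C (total_mfd U') (\<lambda>w. f (lft w)) w"
        by (rule smooth_at_compose[where f = lft and g = f, OF smooth_at_lft[OF P atlas_regular[OF U(1)] atlas_regular[OF V(1)] wC]])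
          (use f(3) w in simp)
      show "smooth_at ?C (total_mfd V') (\<lambda>w. g (rgt w)) w"
        by (rule smooth_at_compose[where f = rgt and g = g, OF smooth_at_rgt[OF P atlas_regular[OF U(1)] atlas_regular[OF V(1)] wC]])
          (use g(3) w in simp)
      show "src U' (f (lft q)) = tgt V' (g (rgt q))" if "q \<in> ?W" for q
        using that match f(5) g(6) by simp
    qed
  qed (use f(4-6) g(4-6) in \<open>simp_all add: comp_bisub_simps\<close>)
qed

lemma local_morphism_refl:
  assumes "(U, u) \<in> atlas_points atlas"
  shows "local_morphism U u U u"
  by (rule local_morphismI[OF atlas_smooth[OF assms] atlas_smooth[OF assms] openin_pts[OF atlas_smooth[OF assms]]
        atlas_pointsD(2)[OF assms] smooth_at_id]) auto

text \<open>Representatives are replaced one factor at a time, the other factor being carried along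
  by the identity morphism.\<close>

lemma hol_comp_germ_class:
  assumes U: "(U, u) \<in> atlas_points atlas" and V: "(V, v) \<in> atlas_points atlas" and uv: "src U u = tgt V v"
  shows "hol_comp P F (germ_class atlas U u) (germ_class atlas V v) = germ_class atlas (comp_bisub P U V) (Comp u v)"
proof -
  let ?c = "\<lambda>U u V v. germ_class atlas (comp_bisub P U V) (Comp u v)"
  have left: "?c U' u' V v = ?c U u V v" if U': "(U', u') \<in> germ_class atlas U u" for U' u'
  proof -
    \<comment> \<open>Invariance is asked on all atlas points, also on those not composable with v.
      There the value is set to \<open>{}\<close>; equality of the sources, itself an invariant,
      then excludes this case.\<close>
    let ?\<Phi> = "\<lambda>U u. if src U u = tgt V v then ?c U u V v else {}"
    have "?\<Phi> U' u' = ?\<Phi> U u"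
    proof (rule germ_class_invariant[of atlas ?\<Phi>, OF _ U'])
      fix U u U' u' assume a: "(U, u) \<in> atlas_points atlas" "(U', u') \<in> atlas_points atlas" "local_morphism U u U' u'"
      show "?\<Phi> U u = ?\<Phi> U' u'"
        using germ_class_step[OF comp_points[OF a(1) V] comp_points[OF a(2) V]
            local_morphism_comp[OF a V V local_morphism_refl[OF V]]] local_morphism_ends[OF a(3)] by auto
    qed
    moreover have "src U' u' = src U u"
      by (rule germ_class_invariant[of atlas src, OF _ U']) (auto dest: local_morphism_ends)
    ultimately show ?thesis using uv by simp
  qed
  have right: "?c U' u' V' v' = ?c U' u' V v"
    if U': "(U', u') \<in> germ_class atlas U u" and V': "(V', v') \<in> germ_class atlas V v" for U' u' V' v'
  proof -
    note Up = germ_class_points[OF U']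
    let ?\<Phi> = "\<lambda>V v. if src U' u' = tgt V v then ?c U' u' V v else {}"
    have "?\<Phi> V' v' = ?\<Phi> V v"
    proof (rule germ_class_invariant[of atlas ?\<Phi>, OF _ V'])
      fix V v V' v' assume a: "(V, v) \<in> atlas_points atlas" "(V', v') \<in> atlas_points atlas" "local_morphism V v V' v'"
      show "?\<Phi> V v = ?\<Phi> V' v'"
        using germ_class_step[OF comp_points[OF Up a(1)] comp_points[OF Up a(2)]
            local_morphism_comp[OF Up Up local_morphism_refl[OF Up] a]] local_morphism_ends[OF a(3)] by auto
    qed
    moreover have "tgt V' v' = tgt V v"
      by (rule germ_class_invariant[of atlas tgt, OF _ V']) (auto dest: local_morphism_ends)
    moreover have "src U' u' = src U u"
      by (rule germ_class_invariant[of atlas src, OF _ U']) (auto dest: local_morphism_ends)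
    ultimately show ?thesis using uv by simp
  qed
  let ?f = "\<lambda>((U, u), (V, v)). ?c U u V v"
  have "the_elem (?f ` (germ_class atlas U u \<times> germ_class atlas V v)) = ?f ((U, u), (V, v))"
  proof (rule the_elem_image_unique)
    show "germ_class atlas U u \<times> germ_class atlas V v \<noteq> {}"
      using germ_class_self[OF U] germ_class_self[OF V] by auto
    fix y assume "y \<in> germ_class atlas U u \<times> germ_class atlas V v"
    then obtain U' u' V' v' where y: "y = ((U', u'), (V', v'))"
      "(U', u') \<in> germ_class atlas U u" "(V', v') \<in> germ_class atlas V v" by auto
    show "?f y = ?f ((U, u), (V, v))" using left[OF y(2)] right[OF y(2,3)] by (simp add: y(1))
  qed
  then show ?thesis by (simp add: hol_comp_def)
qed

lemma quotient_points:
  "(U, u) \<in> atlas_points atlas \<Longrightarrow> (push_bisub h U, u) \<in> atlas_points (quotient_atlas P F M h)"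
  by (auto simp: atlas_points_def quotient_atlas_def intro!: generated_atlas.elem)

text \<open>Composing the ends with h turns every morphism of the atlas into one between the pushed
  bisubmersions, so representatives may be exchanged.\<close>

lemma Xi_germ_class:
  assumes "(U, u) \<in> atlas_points atlas"
  shows "Xi P F M h (germ_class atlas U u) = germ_class (quotient_atlas P F M h) (push_bisub h U) u"
  unfolding Xi_def
  by (rule the_elem_germ_class[OF assms])
    (rule germ_class_step[OF quotient_points quotient_points local_morphism_push])

lemma Xi_eqI:
  assumes "(U, u) \<in> atlas_points atlas" "(V, v) \<in> atlas_points atlas"
    and "local_morphism (push_bisub h U) u (push_bisub h V) v"
  shows "Xi P F M h (germ_class atlas U u) = Xi P F M h (germ_class atlas V v)"
  unfolding Xi_germ_class[OF assms(1)] Xi_germ_class[OF assms(2)]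
  by (rule germ_class_step[OF quotient_points[OF assms(1)] quotient_points[OF assms(2)] assms(3)])

text \<open>Existence for the \<open>THE\<close> comes from a lift of the translation. For
  uniqueness, a competing class \<eta> receives a morphism from some \<open>gW\<close>; preceded by
  the inverse lift it starts in the atlas, and so identifies \<eta> with the lifted class.\<close>

lemma vec_star_germ_class:
  assumes F: "singular_foliation P F" and \<theta>: "diffeo P P (act g) \<theta>'"
    and inv: "\<And>V. V \<in> F \<Longrightarrow> push_field P (act g) \<theta>' V \<in> F" "\<And>V. V \<in> F \<Longrightarrow> push_field P \<theta>' (act g) V \<in> F"
    and U: "(U, u) \<in> atlas_points atlas"
  obtains U' u' where "(U', u') \<in> atlas_points atlas" "local_morphism (push_bisub (act g) U) u U' u'"
    "vec_star P F act g (germ_class atlas U u) = germ_class atlas U' u'"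
proof -
  \<comment> \<open>Lifts are chosen for all members at once, so that the lifted class becomes a
    function of atlas points to which \<open>germ_class_invariant\<close> applies.\<close>
  have "\<forall>U\<in>atlas. \<exists>T. fst T \<in> atlas \<and> lifts (act g) U (fst T) (fst (snd T)) (snd (snd T))"
    using path_holonomy_atlas_lifts[OF P F \<theta> inv] by fastforce
  then obtain T where T: "\<forall>U\<in>atlas. fst (T U) \<in> atlas \<and> lifts (act g) U (fst (T U)) (fst (snd (T U))) (snd (snd (T U)))"
    by (rule bchoice[THEN exE])
  define t f f' where "t U = fst (T U)" and "f U = fst (snd (T U))" and "f' U = snd (snd (T U))" for U
  have t: "t U \<in> atlas" "lifts (act g) U (t U) (f U) (f' U)" if "U \<in> atlas" for U
    using T that by (simp_all add: t_def f_def f'_def)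
  have tp: "(t U, f U u) \<in> atlas_points atlas" if "(U, u) \<in> atlas_points atlas" for U u
    using t[OF atlas_pointsD(1)[OF that]] diffeoD(3)[OF liftsD(1) atlas_pointsD(2)[OF that]]
    by (auto simp: atlas_points_def)
  have up: "local_morphism (push_bisub (act g) U) u (t U) (f U u)" if Up: "(U, u) \<in> atlas_points atlas" for U u
    using diffeoD(1)[OF liftsD(1)] liftsD(2,3) t[OF atlas_pointsD(1)[OF Up]]
    by (intro local_morphismI[of _ _ "pts (total_mfd U)" _ "f U"])
      (simp_all add: atlas_smooth[OF Up] atlas_smooth[OF tp[OF Up]] openin_pts atlas_pointsD(2)[OF Up])
  \<comment> \<open>The inverse lift is a morphism from the lifted member back to \<open>gU\<close>;
    both the independence of representatives and uniqueness rest on it.\<close>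
  have down: "local_morphism (t U) (f U u) (push_bisub (act g) U) u" if Up: "(U, u) \<in> atlas_points atlas" for U u
  proof (rule local_morphismI[where W = "pts (total_mfd (t U))" and f = "f' U"])
    note l = t(2)[OF atlas_pointsD(1)[OF Up]]
    note D = diffeoD[OF liftsD(1)[OF l]]
    show "smooth_atlas (total_mfd (t U))" by (rule atlas_smooth[OF tp[OF Up]])
    then show "openin (mtop (total_mfd (t U))) (pts (total_mfd (t U)))" by (rule openin_pts)
    show "smooth_atlas (total_mfd (push_bisub (act g) U))" using atlas_smooth[OF Up] by simp
    show "f U u \<in> pts (total_mfd (t U))" by (rule atlas_pointsD(2)[OF tp[OF Up]])
    show "f' U (f U u) = u" by (rule D(2)[OF atlas_pointsD(2)[OF Up]])
    fix w assume w: "w \<in> pts (total_mfd (t U))"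
    show "smooth_at (total_mfd (t U)) (total_mfd (push_bisub (act g) U)) (f' U) w" using D(4)[OF w] by simp
    show "src (push_bisub (act g) U) (f' U w) = src (t U) w"
      "tgt (push_bisub (act g) U) (f' U w) = tgt (t U) w"
      using liftsD(2,3)[OF l D(6)[OF w]] D(5)[OF w] by simp_all
  qed
  have tot: "smooth_atlas (total_mfd (push_bisub h U))" if "(U, u) \<in> atlas_points atlas" for U u and h :: "'p \<Rightarrow> 'p"
    using atlas_smooth[OF that] by simp
  \<comment> \<open>The chain is the inverse lift to \<open>gU\<close>, the translate of the given
    morphism, and the lift of V.\<close>
  have step: "germ_class atlas (t U) (f U u) = germ_class atlas (t V) (f V v)"
    if Up: "(U, u) \<in> atlas_points atlas" and Vp: "(V, v) \<in> atlas_points atlas" and l: "local_morphism U u V v" for U u V v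
  proof (rule germ_class_step[OF tp[OF Up] tp[OF Vp]])
    have "local_morphism (push_bisub (act g) U) u (t V) (f V v)"
      by (rule local_morphism_compose[OF local_morphism_push[OF l] up[OF Vp] tot[OF Up] tot[OF Vp] atlas_smooth[OF tp[OF Vp]]])
    with down[OF Up] show "local_morphism (t U) (f U u) (t V) (f V v)"
      by (rule local_morphism_compose[OF _ _ atlas_smooth[OF tp[OF Up]] tot[OF Up] atlas_smooth[OF tp[OF Vp]]])
  qed
  have "vec_star P F act g (germ_class atlas U u) = germ_class atlas (t U) (f U u)"
    unfolding vec_star_def
  proof (rule the_equality)
    show "germ_class atlas (t U) (f U u) \<in> holonomy_groupoid P F \<and>
        (\<exists>(W, v)\<in>germ_class atlas U u. \<exists>(V, w)\<in>germ_class atlas (t U) (f U u).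
          local_morphism (push_bisub (act g) W) v V w)"
      using germ_class_in_groupoid[OF tp[OF U]] germ_class_self[OF U] germ_class_self[OF tp[OF U]] up[OF U]
      unfolding holonomy_groupoid_def by blast
    fix \<eta> assume \<eta>: "\<eta> \<in> holonomy_groupoid P F \<and> (\<exists>(W, v)\<in>germ_class atlas U u. \<exists>(V, w)\<in>\<eta>.
        local_morphism (push_bisub (act g) W) v V w)"
    then obtain W v V w where Wv: "(W, v) \<in> germ_class atlas U u" and Vw: "(V, w) \<in> \<eta>"
      and l: "local_morphism (push_bisub (act g) W) v V w" by blast
    have \<eta>atlas: "\<eta> \<in> atlas_groupoid atlas" using \<eta> by (simp add: holonomy_groupoid_def)
    note Vp = atlas_groupoid_class[OF \<eta>atlas Vw] and Wp = germ_class_points[OF Wv]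
    have "local_morphism (t W) (f W v) V w"
      by (rule local_morphism_compose[OF down[OF Wp] l atlas_smooth[OF tp[OF Wp]] tot[OF Wp] atlas_smooth[OF Vp(1)]])
    from germ_class_step[OF tp[OF Wp] Vp(1) this]
    have "germ_class atlas (t W) (f W v) = \<eta>" using Vp(2) by simp
    moreover have "germ_class atlas (t W) (f W v) = germ_class atlas (t U) (f U u)"
      by (rule germ_class_invariant[of atlas "\<lambda>U u. germ_class atlas (t U) (f U u)", OF step Wv])
    ultimately show "\<eta> = germ_class atlas (t U) (f U u)" by simp
  qed
  with tp[OF U] up[OF U] show thesis by (rule that)
qed

text \<open>The same map serves; its ends agree after k because k absorbs \<theta>.\<close>

lemma local_morphism_push_invariant:
  assumes U: "(U, u) \<in> atlas_points atlas" and V: "(V, v) \<in> atlas_points atlas"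
    and l: "local_morphism (push_bisub \<theta> U) u V v" and k: "\<And>x. x \<in> pts P \<Longrightarrow> k (\<theta> x) = k x"
  shows "local_morphism (push_bisub k U) u (push_bisub k V) v"
proof -
  have T: "smooth_atlas (total_mfd (push_bisub \<theta> U))" using atlas_smooth[OF U] by simp
  obtain W f where f: "openin (mtop (total_mfd (push_bisub \<theta> U))) W" "u \<in> W"
    "\<And>w. w \<in> W \<Longrightarrow> smooth_at (total_mfd (push_bisub \<theta> U)) (total_mfd V) f w" "f u = v"
    "\<And>w. w \<in> W \<Longrightarrow> src V (f w) = src (push_bisub \<theta> U) w"
    "\<And>w. w \<in> W \<Longrightarrow> tgt V (f w) = tgt (push_bisub \<theta> U) w"
    by (rule local_morphismE[OF l T atlas_smooth[OF V]]) blast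
  have in_pts: "w \<in> pts (total_mfd U)" if "w \<in> W" for w
    using openin_mtop_subset[OF atlas_smooth[OF U]] f(1) that by auto
  have ends: "k (\<theta> (src U w)) = k (src U w)" "k (\<theta> (tgt U w)) = k (tgt U w)" if "w \<in> W" for w
    using k smooth_at_pts(2)[OF regularD(4)[OF atlas_regular[OF U] in_pts[OF that]]]
      smooth_at_pts(2)[OF regularD(3)[OF atlas_regular[OF U] in_pts[OF that]]] by simp_all
  show ?thesis
    by (rule local_morphismI[where W = W and f = f]) (use f atlas_smooth[OF U] atlas_smooth[OF V] ends in simp_all)
qed

text \<open>The class given by \<Phi> has a representative carrying the translation, and all its
  representatives have source \<open>tgt V v\<close>; hence this one is composable with v.\<close>

lemma left_star_germ_class:
  assumes \<Phi>: "translation_morphism P F act H \<Phi>" and h: "h \<in> H" and V: "(V, v) \<in> atlas_points atlas"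
  obtains U u where "(U, u) \<in> atlas_points atlas" "src U u = tgt V v" "carries_at P U u (act h)"
    "left_star P F \<Phi> h (germ_class atlas V v) = germ_class atlas (comp_bisub P U V) (Comp u v)"
proof -
  let ?p = "tgt V v"
  have p: "?p \<in> pts P" using smooth_at_pts(2)[OF regularD(3)[OF atlas_regular[OF V] atlas_pointsD(2)[OF V]]] .
  have \<phi>: "\<Phi> h ?p \<in> atlas_groupoid atlas" "hol_src (\<Phi> h ?p) = ?p" "hol_carries P (\<Phi> h ?p) (act h)"
    using \<Phi> h p by (simp_all add: translation_morphism_def holonomy_groupoid_def)
  then obtain U u where U: "(U, u) \<in> \<Phi> h ?p" "carries_at P U u (act h)"
    unfolding hol_carries_def by blast
  note Up = atlas_groupoid_class[OF \<phi>(1) U(1)]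
  have s: "src U u = ?p" using \<phi>(2) hol_src_germ_class[OF Up(1)] Up(2) by simp
  show thesis
  proof (rule that[OF Up(1) s U(2)])
    show "left_star P F \<Phi> h (germ_class atlas V v) = germ_class atlas (comp_bisub P U V) (Comp u v)"
      unfolding left_star_def hol_tgt_germ_class[OF V] Up(2)
      by (rule hol_comp_germ_class[OF Up(1) V s])
  qed
qed

text \<open>Sources agree without k, since a pair has the source of its second member; targets
  differ by \<theta>, which k absorbs.\<close>

lemma local_morphism_translation:
  assumes U: "(U, u) \<in> atlas_points atlas" and V: "(V, v) \<in> atlas_points atlas" and uv: "src U u = tgt V v"
    and c: "carries_at P U u \<theta>" and k: "\<And>x. x \<in> pts P \<Longrightarrow> k (\<theta> x) = k x"
  shows "local_morphism (push_bisub k V) v (push_bisub k (comp_bisub P U V)) (Comp u v)"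
proof -
  note C = atlas_smooth[OF comp_points[OF U V uv]]
  from c obtain W \<sigma> where W: "openin (mtop P) W" "src U u \<in> W"
     and \<sigma>: "smooth_map (open_mfd P W) (total_mfd U) \<sigma>" "\<sigma> (src U u) = u"
     "\<forall>x\<in>W. src U (\<sigma> x) = x \<and> tgt U (\<sigma> x) = \<theta> x"
    unfolding carries_at_def by blast
  have sm: "smooth_at P (total_mfd U) \<sigma> x" if "x \<in> W" for x
    using \<sigma>(1) that smooth_map_open_mfd_iff[OF P atlas_smooth[OF U] W(1)] by blast
  \<comment> \<open>The section exists near \<open>tgt V v\<close> only, so the morphism lives on
    the preimage of its domain.\<close>
  let ?N = "{w \<in> pts (total_mfd V). tgt V w \<in> W}"
  have N: "openin (mtop (total_mfd V)) ?N"
    by (rule openin_sm_preimage[OF atlas_smooth[OF V] P openin_pts[OF atlas_smooth[OF V]] regularD(3)[OF atlas_regular[OF V]] W(1)])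
  show ?thesis
  proof (rule local_morphismI[where W = ?N and f = "\<lambda>w. Comp (\<sigma> (tgt V w)) w"])
    show "v \<in> ?N" using atlas_pointsD(2)[OF V] W(2) uv by simp
    show "Comp (\<sigma> (tgt V v)) v = Comp u v" using \<sigma>(2) uv by simp
    fix w assume w: "w \<in> ?N"
    have "smooth_at (total_mfd V) (total_mfd (comp_bisub P U V)) (\<lambda>w. Comp (\<sigma> (tgt V w)) w) w"
    proof (rule smooth_at_Comp[OF P atlas_regular[OF U] atlas_regular[OF V] atlas_smooth[OF V] _ _ N w])
      show "smooth_at (total_mfd V) (total_mfd U) (\<lambda>w. \<sigma> (tgt V w)) w"
        by (rule smooth_at_compose[where f = "tgt V" and g = \<sigma>, OF regularD(3)[OF atlas_regular[OF V]] sm]) (use w in auto)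
      show "smooth_at (total_mfd V) (total_mfd V) (\<lambda>w. w) w" by (rule smooth_at_id) (use w in auto)
      show "src U (\<sigma> (tgt V q)) = tgt V q" if "q \<in> ?N" for q using \<sigma>(3) that by simp
    qed
    then show "smooth_at (total_mfd (push_bisub k V)) (total_mfd (push_bisub k (comp_bisub P U V)))
        (\<lambda>w. Comp (\<sigma> (tgt V w)) w) w" by simp
    show "src (push_bisub k (comp_bisub P U V)) (Comp (\<sigma> (tgt V w)) w) = src (push_bisub k V) w"
      by (simp add: comp_bisub_simps)
    have "tgt V w \<in> pts P" using w openin_mtop_subset[OF P W(1)] by auto
    then show "tgt (push_bisub k (comp_bisub P U V)) (Comp (\<sigma> (tgt V w)) w) = tgt (push_bisub k V) w"
      using \<sigma>(3) w k by (simp add: comp_bisub_simps)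
  qed (use N atlas_smooth[OF V] C in simp_all)
qed

end

section \<open>Translations by group elements and the conclusion\<close>

text \<open>Right multiplication by a permutes G.\<close>

lemma orbit_action:
  assumes ga: "group_action G E act" and G: "group G" and a: "a \<in> carrier G" and x: "x \<in> E"
  shows "orbit G act (act a x) = orbit G act x"
proof -
  interpret group G by (rule G)
  have 1: "act b (act a x) = act (b \<otimes>\<^bsub>G\<^esub> a) x" if "b \<in> carrier G" for b
    using group_action.composition_rule[OF ga x that a] by simp
  have 2: "act b x = act (b \<otimes>\<^bsub>G\<^esub> inv\<^bsub>G\<^esub> a) (act a x)" if b: "b \<in> carrier G" for b
  proof -
    have "(b \<otimes>\<^bsub>G\<^esub> inv\<^bsub>G\<^esub> a) \<otimes>\<^bsub>G\<^esub> a = b" using a b by (simp add: m_assoc)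
    then show ?thesis using group_action.composition_rule[OF ga x _ a, of "b \<otimes>\<^bsub>G\<^esub> inv\<^bsub>G\<^esub> a"] a b by simp
  qed
  show ?thesis
  proof (intro subset_antisym subsetI)
    fix y assume "y \<in> orbit G act (act a x)"
    then obtain b where "b \<in> carrier G" "y = act b (act a x)" by (auto simp: orbit_def)
    then have "b \<otimes>\<^bsub>G\<^esub> a \<in> carrier G" "y = act (b \<otimes>\<^bsub>G\<^esub> a) x" using 1 a by simp_all
    then show "y \<in> orbit G act x" unfolding orbit_def by blast
  next
    fix y assume "y \<in> orbit G act x"
    then obtain b where b: "b \<in> carrier G" "y = act b x" by (auto simp: orbit_def)
    have "b \<otimes>\<^bsub>G\<^esub> inv\<^bsub>G\<^esub> a \<in> carrier G" using a b by simp
    moreover have "y = act (b \<otimes>\<^bsub>G\<^esub> inv\<^bsub>G\<^esub> a) (act a x)" using b 2 by metis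
    ultimately show "y \<in> orbit G act (act a x)" unfolding orbit_def by blast
  qed
qed

text \<open>A single translation is the smooth action map restricted to a slice, and the inverse
  element supplies the inverse.\<close>

lemma action_diffeo:
  assumes G: "lie_group G GM" and P: "smooth_atlas P" and act: "smooth_action G GM P act"
    and g: "g \<in> carrier G"
  shows "diffeo P P (act g) (act (inv\<^bsub>G\<^esub> g))"
proof -
  have ga: "group_action G (pts P) act" using act by (simp add: smooth_action_def)
  have grp: "group G" and GM: "smooth_atlas GM" and pts: "pts GM = carrier G"
    using G by (simp_all add: lie_group_def smooth_manifold_iff)
  have sm: "smooth_at P P (act a) x" if a: "a \<in> carrier G" and x: "x \<in> pts P" for a x
  proof -
    have "smooth_at P (prod_mfd GM P) (\<lambda>x. (a, x)) x"
      by (rule smooth_at_Pair[OF GM P P smooth_at_const[OF P x] smooth_at_id[OF x]]) (simp add: pts a)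
    moreover have "smooth_at (prod_mfd GM P) P (\<lambda>(g, p). act g p) (a, x)"
      using act a x smooth_map_iff[OF smooth_atlas_prod_mfd[OF GM P] P]
      by (simp add: smooth_action_def pts_prod_mfd pts)
    ultimately show ?thesis
      using smooth_at_compose[where f = "\<lambda>x. (a, x)" and g = "\<lambda>(g, p). act g p"] by fastforce
  qed
  have i: "inv\<^bsub>G\<^esub> g \<in> carrier G" using group.inv_closed[OF grp g] .
  show ?thesis
    unfolding diffeo_def
  proof (intro conjI ballI)
    fix x assume x: "x \<in> pts P"
    show "smooth_at P P (act g) x" "smooth_at P P (act (inv\<^bsub>G\<^esub> g)) x"
      by (rule sm[OF g x], rule sm[OF i x])
    show "act (inv\<^bsub>G\<^esub> g) (act g x) = x" by (rule group_action.orbit_sym_aux[OF ga g x refl])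
    show "act g (act (inv\<^bsub>G\<^esub> g) x) = x"
      using group_action.orbit_sym_aux[OF ga i x refl] group.inv_inv[OF grp g] by simp
  qed
qed

theorem corollary5p4p11:
  fixes P :: "'p smfd" and F :: "'p vfield set"
    and G :: "('g, 'c) monoid_scheme" and GM :: "'g smfd" and act :: "'g \<Rightarrow> 'p \<Rightarrow> 'p"
    and M :: "'p set smfd" and FM :: "'p set vfield set"
    and H :: "'g set" and HM :: "'g smfd"
    and \<Phi> :: "'g \<Rightarrow> 'p \<Rightarrow> (('p hpt, 'p) bisub \<times> 'p hpt) set"
  assumes "smooth_manifold P" and "singular_foliation P F"
    and "lie_group G GM" and "connected_space (mtop GM)"
    and "smooth_action G GM P act" and "free_action G P act" and "proper_action GM P act"
    and "\<forall>g \<in> carrier G. pullback P P (act g) F = F"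
    and "quotient_mfd G P act M"
    and "singular_foliation M FM"
    and "pullback P M (orbit G act) FM = vsum (vertical_c P M (orbit G act)) F"
    and "connected_lie_subgroup G GM H HM (foliation_ideal G GM P F act)"
    and "translation_morphism P F act H \<Phi>"
  shows "\<forall>\<xi> \<in> holonomy_groupoid P F.
    orbit (semidirect H G) (star P F act \<Phi>) \<xi> \<subseteq>
      {\<eta> \<in> holonomy_groupoid P F. Xi P F M (orbit G act) \<eta> = Xi P F M (orbit G act) \<xi>}"
proof (intro ballI subsetI)
  fix \<xi> \<eta> assume \<xi>: "\<xi> \<in> holonomy_groupoid P F"
    and "\<eta> \<in> orbit (semidirect H G) (star P F act \<Phi>) \<xi>"
  then obtain h g where h: "h \<in> H" and g: "g \<in> carrier G"
    and \<eta>: "\<eta> = left_star P F \<Phi> h (vec_star P F act g \<xi>)"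
    by (auto simp: orbit_def semidirect_def star_def)
  let ?A = "path_holonomy_atlas P F" and ?\<pi> = "orbit G act"
  have P: "smooth_atlas P" by (rule smooth_manifold_atlas[OF assms(1)])
  have ga: "group_action G (pts P) act" using assms(5) by (simp add: smooth_action_def)
  have grp: "group G" using assms(3) by (simp add: lie_group_def)
  have HG: "H \<subseteq> carrier G"
    using assms(12) subgroup.subset by (auto simp: connected_lie_subgroup_def)
  have i: "inv\<^bsub>G\<^esub> g \<in> carrier G" using group.inv_closed[OF grp g] .
  have \<pi>: "?\<pi> (act a x) = ?\<pi> x" if "a \<in> carrier G" "x \<in> pts P" for a x
    using orbit_action[OF ga grp that] .
  note \<theta> = action_diffeo[OF assms(3) P assms(5) g]
  \<comment> \<open>Every group element preserves F, in particular the inverse of g; the second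
    claim exchanges the roles of the two translations.\<close>
  have inv: "push_field P (act g) (act (inv\<^bsub>G\<^esub> g)) V \<in> F"
    "push_field P (act (inv\<^bsub>G\<^esub> g)) (act g) V \<in> F" if "V \<in> F" for V
    using foliation_push[OF P assms(2) \<theta> _ that] foliation_push[OF P assms(2) diffeo_sym[OF \<theta>] _ that]
      assms(8) g i by simp_all
  obtain U u where U: "(U, u) \<in> atlas_points ?A" "\<xi> = germ_class ?A U u"
    using \<xi> unfolding holonomy_groupoid_def by (rule atlas_groupoidE)
  obtain V v where V: "(V, v) \<in> atlas_points ?A" "local_morphism (push_bisub (act g) U) u V v"
    "vec_star P F act g \<xi> = germ_class ?A V v"
    unfolding U(2)
    by (rule vec_star_germ_class[where act = act and g = g and \<theta>' = "act (inv\<^bsub>G\<^esub> g)",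
          OF P assms(2) \<theta> inv U(1)])
  obtain W w where W: "(W, w) \<in> atlas_points ?A" "src W w = tgt V v" "carries_at P W w (act h)"
    "\<eta> = germ_class ?A (comp_bisub P W V) (Comp w v)"
    unfolding \<eta> V(3) by (rule left_star_germ_class[OF P assms(13) h V(1)])
  note C = comp_points[OF P W(1) V(1) W(2)]
  \<comment> \<open>H lies in G, so the projection absorbs the translation by h as well.\<close>
  have "local_morphism (push_bisub ?\<pi> V) v (push_bisub ?\<pi> (comp_bisub P W V)) (Comp w v)"
    by (rule local_morphism_translation[OF P W(1) V(1) W(2,3)], rule \<pi>) (use h HG in auto)
  from Xi_eqI[OF P V(1) C this]
  have 1: "Xi P F M ?\<pi> \<eta> = Xi P F M ?\<pi> (germ_class ?A V v)" by (simp add: W(4))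
  have "local_morphism (push_bisub ?\<pi> U) u (push_bisub ?\<pi> V) v"
    by (rule local_morphism_push_invariant[OF P U(1) V(1,2)], rule \<pi>[OF g])
  from Xi_eqI[OF P U(1) V(1) this] have "Xi P F M ?\<pi> \<xi> = Xi P F M ?\<pi> (germ_class ?A V v)"
    by (simp add: U(2))
  moreover have "\<eta> \<in> holonomy_groupoid P F"
    unfolding W(4) holonomy_groupoid_def by (rule germ_class_in_groupoid[OF C])
  ultimately show "\<eta> \<in> {\<eta> \<in> holonomy_groupoid P F. Xi P F M ?\<pi> \<eta> = Xi P F M ?\<pi> \<xi>}"
    using 1 by simp
qed

end
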